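(* Let $n>2$, let $G=D_n$ be the simply connected compact group $Spin(2n)$, let $m$ be a positive integer and $p$ a prime. Write $m=p^i m'$ with $p\nmid m'$. (1) If $p=2$, then $N(D_n,m,2)$ is the number of tuples $(b_1,\dots,b_n)\in\mathbb{Z}^n\cup(\mathbb{Z}+\frac12)^n$ such that $$b_1>\dots>b_{n-1}>|b_n|\quad\text{and}\quad p^i>b_1+b_2.$$ (2) If $p>2$, then $N(D_n,m,p)$ is the number of tuples $(b_1,\dots,b_n)\in\mathbb{Z}^n$ such that $$b_1>\dots>b_{n-1}>|b_n|,\quad p^i>b_1+b_2,\quad\text{and}\quad 2\mid(b_1+\dots+b_n).$$
   Context: Let $G$ be a simply connected simple compact Lie group with maximal torus $T$ and weight lattice $\Pi^*=\mathrm{Hom}(T,S^1)$. $\langle\cdot,\cdot\rangle$ is the unique Weyl-invariant inner product on $\Pi^*$ (extended to $\Pi^*\otimes\mathbb{R}$) with $\langle u,u\rangle=2$ for all long roots $u$ (in the simply laced case all roots are long). The fundamental Weyl chamber $V\subset\Pi^*\otimes\mathbb{R}$ is the set of points having non-negative inner product with all positive roots; $\theta$ is the highest root. The level $m$ fundamental alcove is $A=\{x\in V:\langle\theta,x\rangle\le m\}$. A level $m$ regular weight is an element of $\Pi^*$ in the interior of $A$. $N(G,m,p)$ denotes the number of level $m$ regular weights $a$ such that for every weight $w\in\Pi^*$ the denominator (in lowest terms) of the rational number $\langle w,a\rangle/m$ is a power $p^k$, $k\ge0$, of $p$. *)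

theory Defs
  imports "HOL-Analysis.Analysis" "HOL-Computational_Algebra.Primes"
begin

section \<open>Linear groups with a parametrised maximal torus\<close>

text \<open>
  A compact Lie group is given here as a set \<open>G\<close> of invertible linear operators on a complex
  function space, the group operation being composition.  Function types carry the product
  topology, i.e. pointwise convergence; this is the usual topology on any finite-dimensional
  algebra of operators.

  A maximal torus \<open>T\<close> of rank \<open>r\<close> is given together with its exponential map
  \<open>\<phi> : Lie(T) = \<real>\<^sup>r \<rightarrow> T\<close>, a surjective homomorphism.  The space \<open>\<Pi>\<^sup>* \<otimes> \<real>\<close>, the dual of \<open>Lie(T)\<close>,
  is then \<open>\<real>\<^sup>r\<close> as well, a character of \<open>T\<close> being identified with its differential.
\<close>

type_synonym 's operator = "('s \<Rightarrow> complex) \<Rightarrow> ('s \<Rightarrow> complex)"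

definition coords :: "nat \<Rightarrow> (nat \<Rightarrow> real) set" where
  "coords r = topspace (Euclidean_space r)"

definition pairing :: "nat \<Rightarrow> (nat \<Rightarrow> real) \<Rightarrow> (nat \<Rightarrow> real) \<Rightarrow> real" where
  "pairing r x t = (\<Sum>j<r. x j * t j)"

definition torus :: "nat \<Rightarrow> ((nat \<Rightarrow> real) \<Rightarrow> 's operator) \<Rightarrow> 's operator set" where
  "torus r \<phi> = \<phi> ` coords r"

text \<open>\<open>Hom(T, S\<^sup>1)\<close>; values outside \<open>T\<close> are irrelevant.\<close>

definition characters :: "'s operator set \<Rightarrow> ('s operator \<Rightarrow> complex) set" where
  "characters T = {\<xi>. continuous_on T \<xi> \<and> \<xi> ` T \<subseteq> sphere 0 1
     \<and> (\<forall>h\<in>T. \<forall>k\<in>T. \<xi> (h \<circ> k) = \<xi> h * \<xi> k)}"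

definition has_differential ::
    "nat \<Rightarrow> ((nat \<Rightarrow> real) \<Rightarrow> 's operator) \<Rightarrow> ('s operator \<Rightarrow> complex) \<Rightarrow> (nat \<Rightarrow> real) \<Rightarrow> bool" where
  "has_differential r \<phi> \<xi> x \<longleftrightarrow>
     x \<in> coords r \<and> (\<forall>t\<in>coords r. \<xi> (\<phi> t) = cis (pairing r x t))"

definition weight_lattice :: "nat \<Rightarrow> ((nat \<Rightarrow> real) \<Rightarrow> 's operator) \<Rightarrow> (nat \<Rightarrow> real) set" where
  "weight_lattice r \<phi> = {x. \<exists>\<xi>\<in>characters (torus r \<phi>). has_differential r \<phi> \<xi> x}"

text \<open>The tangent space of \<open>G\<close> at the identity, and its complex span in the operators.
  For the group below the latter is the complexification, as
  the real tangent space meets its multiple by \<open>\<i>\<close> only in \<open>0\<close>.\<close>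

definition lie_algebra :: "'s operator set \<Rightarrow> 's operator set" where
  "lie_algebra G = {X. \<exists>\<gamma> :: real \<Rightarrow> 's operator. \<gamma> 0 = id \<and> (\<forall>s. \<gamma> s \<in> G) \<and>
     (\<forall>f a. ((\<lambda>s. \<gamma> s f a) has_vector_derivative X f a) (at 0))}"

definition complex_lie_algebra :: "'s operator set \<Rightarrow> 's operator set" where
  "complex_lie_algebra G = {X. \<exists>(N::nat) c Y. (\<forall>k<N. Y k \<in> lie_algebra G) \<and>
     X = (\<lambda>f a. \<Sum>k<N. c k * Y k f a)}"

text \<open>Roots are the non-trivial characters occurring in the adjoint action of \<open>T\<close>;
  \<open>h X h\<^sup>-\<^sup>1 = \<xi>(h) X\<close> is written without the inverse.\<close>

definition roots ::
    "'s operator set \<Rightarrow> nat \<Rightarrow> ((nat \<Rightarrow> real) \<Rightarrow> 's operator) \<Rightarrow> (nat \<Rightarrow> real) set" where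
  "roots G r \<phi> = {\<alpha>. \<alpha> \<noteq> (\<lambda>_. 0) \<and>
     (\<exists>\<xi>\<in>characters (torus r \<phi>). has_differential r \<phi> \<xi> \<alpha> \<and>
       (\<exists>X\<in>complex_lie_algebra G. X \<noteq> (\<lambda>f a. 0) \<and>
         (\<forall>h\<in>torus r \<phi>. h \<circ> X = (\<lambda>f a. \<xi> h * X (h f) a))))}"


section \<open>The normalised Weyl-invariant inner product\<close>

definition normalizer :: "'s operator set \<Rightarrow> 's operator set \<Rightarrow> 's operator set" where
  "normalizer G T = {g\<in>G. (\<lambda>h. g \<circ> h) ` T = (\<lambda>h. h \<circ> g) ` T}"

text \<open>\<open>\<xi>'(g h g\<^sup>-\<^sup>1) = \<xi>(h)\<close> on \<open>T\<close>: the action of the Weyl group \<open>N(T)/T\<close> on characters.\<close>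

definition weyl_conjugate ::
    "'s operator set \<Rightarrow> 's operator \<Rightarrow> ('s operator \<Rightarrow> complex) \<Rightarrow> ('s operator \<Rightarrow> complex) \<Rightarrow> bool" where
  "weyl_conjugate T g \<xi> \<xi>' \<longleftrightarrow> (\<forall>h\<in>T. \<forall>k\<in>T. g \<circ> h = k \<circ> g \<longrightarrow> \<xi>' k = \<xi> h)"

definition inner_product_on :: "nat \<Rightarrow> ((nat \<Rightarrow> real) \<Rightarrow> (nat \<Rightarrow> real) \<Rightarrow> real) \<Rightarrow> bool" where
  "inner_product_on r ip \<longleftrightarrow>
     (\<forall>x\<in>coords r. \<forall>y\<in>coords r. \<forall>z\<in>coords r. \<forall>c.
        ip (\<lambda>j. c * x j + y j) z = c * ip x z + ip y z) \<and>
     (\<forall>x\<in>coords r. \<forall>y\<in>coords r. ip x y = ip y x) \<and>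
     (\<forall>x\<in>coords r. x \<noteq> (\<lambda>_. 0) \<longrightarrow> ip x x > 0)"

definition weyl_invariant ::
    "'s operator set \<Rightarrow> nat \<Rightarrow> ((nat \<Rightarrow> real) \<Rightarrow> 's operator) \<Rightarrow>
     ((nat \<Rightarrow> real) \<Rightarrow> (nat \<Rightarrow> real) \<Rightarrow> real) \<Rightarrow> bool" where
  "weyl_invariant G r \<phi> ip \<longleftrightarrow>
     (\<forall>g\<in>normalizer G (torus r \<phi>).
      \<forall>\<xi>\<in>characters (torus r \<phi>). \<forall>\<xi>'\<in>characters (torus r \<phi>).
      \<forall>\<eta>\<in>characters (torus r \<phi>). \<forall>\<eta>'\<in>characters (torus r \<phi>). \<forall>x x' y y'.
        has_differential r \<phi> \<xi> x \<longrightarrow> has_differential r \<phi> \<xi>' x' \<longrightarrow>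
        has_differential r \<phi> \<eta> y \<longrightarrow> has_differential r \<phi> \<eta>' y' \<longrightarrow>
        weyl_conjugate (torus r \<phi>) g \<xi> \<xi>' \<longrightarrow> weyl_conjugate (torus r \<phi>) g \<eta> \<eta>' \<longrightarrow>
        ip x' y' = ip x y)"

definition long_roots ::
    "'s operator set \<Rightarrow> nat \<Rightarrow> ((nat \<Rightarrow> real) \<Rightarrow> 's operator) \<Rightarrow>
     ((nat \<Rightarrow> real) \<Rightarrow> (nat \<Rightarrow> real) \<Rightarrow> real) \<Rightarrow> (nat \<Rightarrow> real) set" where
  "long_roots G r \<phi> ip = {\<alpha>\<in>roots G r \<phi>. \<forall>\<beta>\<in>roots G r \<phi>. ip \<beta> \<beta> \<le> ip \<alpha> \<alpha>}"

text \<open>For a simple group this determines \<open>ip\<close> uniquely on \<open>coords r\<close>.\<close>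

definition basic_inner_product ::
    "'s operator set \<Rightarrow> nat \<Rightarrow> ((nat \<Rightarrow> real) \<Rightarrow> 's operator) \<Rightarrow>
     ((nat \<Rightarrow> real) \<Rightarrow> (nat \<Rightarrow> real) \<Rightarrow> real) \<Rightarrow> bool" where
  "basic_inner_product G r \<phi> ip \<longleftrightarrow>
     inner_product_on r ip \<and> weyl_invariant G r \<phi> ip \<and>
     (\<forall>u\<in>long_roots G r \<phi> ip. ip u u = 2)"


section \<open>Alcoves, regular weights and the number \<open>N(G, m, p)\<close>\<close>

text \<open>The positive system chosen by the lexicographic order on \<open>\<real>\<^sup>r\<close>; for the root system
  \<open>\<plusminus> e\<^sub>i \<plusminus> e\<^sub>j\<close> it consists of the \<open>e\<^sub>i \<plusminus> e\<^sub>j\<close> with \<open>i < j\<close>.\<close>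

definition positive_roots ::
    "'s operator set \<Rightarrow> nat \<Rightarrow> ((nat \<Rightarrow> real) \<Rightarrow> 's operator) \<Rightarrow> (nat \<Rightarrow> real) set" where
  "positive_roots G r \<phi> = {\<alpha>\<in>roots G r \<phi>. \<exists>i. \<alpha> i > 0 \<and> (\<forall>j<i. \<alpha> j = 0)}"

definition highest_root ::
    "'s operator set \<Rightarrow> nat \<Rightarrow> ((nat \<Rightarrow> real) \<Rightarrow> 's operator) \<Rightarrow> (nat \<Rightarrow> real)" where
  "highest_root G r \<phi> = (THE \<theta>. \<theta> \<in> roots G r \<phi> \<and>
     (\<forall>\<beta>\<in>roots G r \<phi>. \<exists>c :: (nat \<Rightarrow> real) \<Rightarrow> nat.
        \<forall>j. \<theta> j - \<beta> j = (\<Sum>\<alpha>\<in>positive_roots G r \<phi>. real (c \<alpha>) * \<alpha> j)))"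

definition weyl_chamber ::
    "'s operator set \<Rightarrow> nat \<Rightarrow> ((nat \<Rightarrow> real) \<Rightarrow> 's operator) \<Rightarrow>
     ((nat \<Rightarrow> real) \<Rightarrow> (nat \<Rightarrow> real) \<Rightarrow> real) \<Rightarrow> (nat \<Rightarrow> real) set" where
  "weyl_chamber G r \<phi> ip = {x\<in>coords r. \<forall>\<alpha>\<in>positive_roots G r \<phi>. ip \<alpha> x \<ge> 0}"

definition alcove ::
    "'s operator set \<Rightarrow> nat \<Rightarrow> ((nat \<Rightarrow> real) \<Rightarrow> 's operator) \<Rightarrow>
     ((nat \<Rightarrow> real) \<Rightarrow> (nat \<Rightarrow> real) \<Rightarrow> real) \<Rightarrow> nat \<Rightarrow> (nat \<Rightarrow> real) set" where
  "alcove G r \<phi> ip m = {x\<in>weyl_chamber G r \<phi> ip. ip (highest_root G r \<phi>) x \<le> real m}"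

definition regular_weights ::
    "'s operator set \<Rightarrow> nat \<Rightarrow> ((nat \<Rightarrow> real) \<Rightarrow> 's operator) \<Rightarrow>
     ((nat \<Rightarrow> real) \<Rightarrow> (nat \<Rightarrow> real) \<Rightarrow> real) \<Rightarrow> nat \<Rightarrow> (nat \<Rightarrow> real) set" where
  "regular_weights G r \<phi> ip m =
     weight_lattice r \<phi> \<inter> (Euclidean_space r interior_of alcove G r \<phi> ip m)"

text \<open>\<open>quotient_of\<close> returns numerator and positive denominator in lowest terms.\<close>

definition N_regular ::
    "'s operator set \<Rightarrow> nat \<Rightarrow> ((nat \<Rightarrow> real) \<Rightarrow> 's operator) \<Rightarrow>
     ((nat \<Rightarrow> real) \<Rightarrow> (nat \<Rightarrow> real) \<Rightarrow> real) \<Rightarrow> nat \<Rightarrow> nat \<Rightarrow> nat" where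
  "N_regular G r \<phi> ip m p = card {a\<in>regular_weights G r \<phi> ip m.
     \<forall>w\<in>weight_lattice r \<phi>. \<exists>(q::rat) (k::nat).
       ip w a / real m = of_rat q \<and> snd (quotient_of q) = int p ^ k}"


section \<open>The group \<open>Spin(2n)\<close>\<close>

text \<open>
  The Clifford algebra of Euclidean \<open>\<real>\<^sup>d\<close> (with \<open>v\<^sup>2 = -|v|\<^sup>2\<close>) is realised by its standard
  faithful action on the exterior algebra: a form is the function assigning to \<open>S\<close> its
  coefficient at \<open>e\<^sub>S\<close>, and the \<open>i\<close>-th generator acts by \<open>e\<^sub>i \<and> \<omega> - \<iota>\<^sub>i \<omega>\<close>.
  Index sets are not confined to \<open>{..<d}\<close>, so that one space serves all \<open>d\<close>; by faithfulness
  this affects neither the group nor its topology.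
\<close>

definition clifford_gen :: "nat \<Rightarrow> nat set operator" where
  "clifford_gen i f = (\<lambda>S. (- 1) ^ card {j\<in>S. j < i} *
     (if i \<in> S then f (S - {i}) else - f (insert i S)))"

definition clifford_vec :: "nat \<Rightarrow> (nat \<Rightarrow> real) \<Rightarrow> nat set operator" where
  "clifford_vec d v f = (\<lambda>S. \<Sum>i<d. complex_of_real (v i) * clifford_gen i f S)"

text \<open>\<open>Spin(d)\<close>: products of an even number of unit vectors.\<close>

definition spin_group :: "nat \<Rightarrow> nat set operator set" where
  "spin_group d = {foldr (\<lambda>v g. clifford_vec d v \<circ> g) vs id | vs.
     even (length vs) \<and> (\<forall>v\<in>set vs. (\<Sum>i<d. (v i)\<^sup>2) = 1)}"

text \<open>The standard maximal torus of \<open>Spin(2n)\<close>.  The \<open>j\<close>-th factor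
  \<open>cos (t\<^sub>j/2) + sin (t\<^sub>j/2) e\<^sub>2\<^sub>j e\<^sub>2\<^sub>j\<^sub>+\<^sub>1\<close> covers the rotation by the angle \<open>t\<^sub>j\<close> in the plane of
  \<open>e\<^sub>2\<^sub>j\<close> and \<open>e\<^sub>2\<^sub>j\<^sub>+\<^sub>1\<close>.\<close>

definition spin_rotation :: "nat \<Rightarrow> real \<Rightarrow> nat set operator" where
  "spin_rotation j s f = (\<lambda>S. complex_of_real (cos (s / 2)) * f S
     + complex_of_real (sin (s / 2)) * clifford_gen (2 * j) (clifford_gen (2 * j + 1) f) S)"

definition spin_torus :: "nat \<Rightarrow> (nat \<Rightarrow> real) \<Rightarrow> nat set operator" where
  "spin_torus n t = foldr (\<lambda>j g. spin_rotation j (t j) \<circ> g) [0..<n] id"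

end

theory Submission
  imports Defs "HOL-Library.Multiset"
begin

text \<open>
  Everything is read off from how the torus acts on the Clifford generators.  The vectors
  \<open>e\<^sub>2\<^sub>j \<mp> \<i> e\<^sub>2\<^sub>j\<^sub>+\<^sub>1\<close> have weights \<open>\<plusminus> e\<^sub>j\<close>, and matrix coefficients at the spinor weight vectors give
  the characters \<open>(\<plusminus> 1/2, \<dots>, \<plusminus> 1/2)\<close>, so that the weight lattice is \<open>\<int>\<^sup>n \<union> (\<int> + 1/2)\<^sup>n\<close>.  For a root
  vector \<open>X\<close> of weight \<open>\<alpha>\<close>, bracketing with \<open>X\<close> maps vectors to vectors and shifts weights by \<open>\<alpha>\<close>; hence
  \<open>\<alpha> = \<eta> e\<^sub>l - \<delta> e\<^sub>j\<close>, where \<open>l = j\<close> is excluded because the bracket annihilates squares of vectors.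
  The Weyl elements \<open>e\<^sub>2\<^sub>j e\<^sub>2\<^sub>k\<close> and products of two reflections interchanging two coordinate planes
  force the invariant form to be the standard one.  A regular weight \<open>a\<close> is counted if and only if
  \<open>a = m' b\<close>, with \<open>b\<close> as in the theorem: the condition on the weights \<open>e\<^sub>j\<close> removes \<open>m'\<close>, and for
  odd \<open>p\<close> the spin weight \<open>(1/2, \<dots>, 1/2)\<close> gives the parity condition.
\<close>

section \<open>Clifford algebra\<close>

text \<open>The operators act on all functions on \<open>nat set\<close>, an infinite-dimensional
  space, so arguments by dimension or irreducibility are avoided. Three devices replace them. The
  vacuum, the indicator of the empty set, is mapped by \<open>clifford_gen i\<close> to a form with
  value 1 at \<open>{i}\<close> and 0 at all other singletons, so a vector is recovered from its
  operator by evaluation. Conjugation is written \<open>g v = w g\<close> without inverses, and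
  surjectivity of \<open>g\<close> is used where something must be cancelled. An operator whose
  brackets with all vectors vanish is not identified as a scalar: it is enough that it commutes with
  the torus and hence has weight 0. The main analytic obstacle is that a tangent vector is known
  only through a curve differentiable at 0, coefficient by coefficient; that its bracket with a
  vector is again a vector has to be extracted from this. The hypothesis \<open>n > 2\<close>
  supplies a third index. It is needed to reverse e_j while fixing e_l, and to write 2 e_l as a sum
  of two positive roots.\<close>

definition toggle :: "nat \<Rightarrow> nat set \<Rightarrow> nat set" where
  "toggle i S = (if i \<in> S then S - {i} else insert i S)"

text \<open>The power of -1 counts the generators that e_i has to pass; the first factor separates
  exterior multiplication from contraction.\<close>

definition gen_sign :: "nat \<Rightarrow> nat set \<Rightarrow> complex" where
  "gen_sign i S = (if i \<in> S then 1 else -1) * (-1) ^ card {j\<in>S. j < i}"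

lemma clifford_gen_toggle: "clifford_gen i f S = gen_sign i S * f (toggle i S)"
  by (simp add: clifford_gen_def gen_sign_def toggle_def)

lemma toggle_toggle [simp]: "toggle i (toggle i S) = S"
  by (auto simp: toggle_def)

lemma toggle_commute: "toggle i (toggle j S) = toggle j (toggle i S)"
  by (auto simp: toggle_def)

lemma mem_toggle: "k \<in> toggle i S \<longleftrightarrow> (if k = i then k \<notin> S else k \<in> S)"
  by (auto simp: toggle_def)

lemma gen_sign_toggle_same: "gen_sign i (toggle i S) = - gen_sign i S"
proof -
  have "{j\<in>toggle i S. j < i} = {j\<in>S. j < i}"
    by (auto simp: mem_toggle split: if_splits)
  then show ?thesis
    by (auto simp: gen_sign_def mem_toggle)
qed

lemma gen_sign_toggle_greater: "i < j \<Longrightarrow> gen_sign i (toggle j S) = gen_sign i S"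
proof -
  assume "i < j"
  then have "{k\<in>toggle j S. k < i} = {k\<in>S. k < i}"
    by (auto simp: mem_toggle split: if_splits)
  then show ?thesis
    using \<open>i < j\<close> by (auto simp: gen_sign_def mem_toggle)
qed

text \<open>Toggling \<open>j < i\<close> changes by one the number of indices below
  \<open>i\<close>. The contrast with \<open>gen_sign_toggle_greater\<close> is the source of
  anticommutation.\<close>

lemma gen_sign_toggle_less:
  assumes "j < i"
  shows "gen_sign i (toggle j S) = - gen_sign i S"
proof -
  \<comment> \<open>\<open>S\<close> may be infinite, but only its part below \<open>i\<close> is
    counted, so \<open>card\<close> never falls back to its default value.\<close>
  have fin: "finite {k\<in>S. k < i}" for S :: "nat set"
    by (rule finite_subset[of _ "{..<i}"]) auto
  have *: "(-1::complex) ^ card {k\<in>insert j S. k < i} = - ((-1) ^ card {k\<in>S. k < i})"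
    if "j \<notin> S" for S
  proof -
    have "{k\<in>insert j S. k < i} = insert j {k\<in>S. k < i}"
      using assms by auto
    then show ?thesis using fin[of S] that by simp
  qed
  show ?thesis
  proof (cases "j \<in> S")
    case True
    then have "insert j (S - {j}) = S" by auto
    then have "(-1::complex) ^ card {k\<in>S. k < i} = - ((-1) ^ card {k\<in>S - {j}. k < i})"
      using *[of "S - {j}"] by simp
    then show ?thesis using True assms by (auto simp: gen_sign_def toggle_def)
  next
    case False
    then show ?thesis using *[OF False] assms by (auto simp: gen_sign_def toggle_def)
  qed
qed

lemma gen_sign_square [simp]: "gen_sign i S * gen_sign i S = 1"
  by (simp add: gen_sign_def flip: power_add mult_2)

lemma gen_sign_nonzero [simp]: "gen_sign i S \<noteq> 0"
  by (simp add: gen_sign_def)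

lemma clifford_gen_square: "clifford_gen i (clifford_gen i f) = (\<lambda>S. - f S)"
proof
  fix S
  have "clifford_gen i (clifford_gen i f) S = - (gen_sign i S * gen_sign i S) * f S"
    by (simp add: clifford_gen_toggle gen_sign_toggle_same del: gen_sign_square)
  then show "clifford_gen i (clifford_gen i f) S = - f S" by simp
qed

text \<open>Only the larger of the two indices sees the other one in its sign, so exchanging the
  generators costs exactly one factor -1.\<close>

lemma clifford_gen_anticommute:
  assumes "i \<noteq> j"
  shows "clifford_gen i (clifford_gen j f) = (\<lambda>S. - clifford_gen j (clifford_gen i f) S)"
proof
  fix S
  show "clifford_gen i (clifford_gen j f) S = - clifford_gen j (clifford_gen i f) S"
    using assms
    by (cases "i < j") (auto simp: clifford_gen_toggle gen_sign_toggle_greater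
        gen_sign_toggle_less toggle_commute)
qed

lemma clifford_gen_apply_singleton:
  "clifford_gen i (\<lambda>S. if S = {} then 1 else 0) {k} = (if i = k then 1 else 0)"
proof (cases "i = k")
  case True
  have e: "{j\<in>{k}. j < k} = {}" by auto
  have "gen_sign k {k} = 1" unfolding gen_sign_def e by simp
  then show ?thesis using True by (simp add: clifford_gen_toggle toggle_def)
qed (auto simp: clifford_gen_toggle toggle_def)

section \<open>Complex-linear operators\<close>

definition clinear_op :: "nat set operator \<Rightarrow> bool" where
  "clinear_op h \<longleftrightarrow> (\<forall>c f g. h (\<lambda>S. c * f S + g S) = (\<lambda>S. c * h f S + h g S))"

lemma clinear_opI:
  "(\<And>c f g S. h (\<lambda>S. c * f S + g S) S = c * h f S + h g S) \<Longrightarrow> clinear_op h"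
  by (simp add: clinear_op_def fun_eq_iff)

lemma clinear_opD: "clinear_op h \<Longrightarrow> h (\<lambda>S. c * f S + g S) = (\<lambda>S. c * h f S + h g S)"
  by (simp add: clinear_op_def)

lemma clinear_op_zero: "clinear_op h \<Longrightarrow> h (\<lambda>S. 0) = (\<lambda>S. 0)"
  using clinear_opD[of h "-1" "\<lambda>S. 0" "\<lambda>S. 0"] by simp

lemma clinear_op_scale: "clinear_op h \<Longrightarrow> h (\<lambda>S. c * f S) = (\<lambda>S. c * h f S)"
  using clinear_opD[of h c f "\<lambda>S. 0"] by (simp add: clinear_op_zero)

lemma clinear_op_add: "clinear_op h \<Longrightarrow> h (\<lambda>S. f S + g S) = (\<lambda>S. h f S + h g S)"
  using clinear_opD[of h 1 f g] by simp

lemma clinear_op_minus: "clinear_op h \<Longrightarrow> h (\<lambda>S. - f S) = (\<lambda>S. - h f S)"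
  using clinear_op_scale[of h "-1" f] by simp

lemma clinear_op_diff: "clinear_op h \<Longrightarrow> h (\<lambda>S. f S - g S) = (\<lambda>S. h f S - h g S)"
  using clinear_opD[of h "-1" g f] by simp

lemma clinear_op_sum:
  assumes "clinear_op h" "finite A"
  shows "h (\<lambda>S. \<Sum>i\<in>A. c i * f i S) = (\<lambda>S. \<Sum>i\<in>A. c i * h (f i) S)"
  using assms(2)
  by induction (simp_all add: clinear_op_zero[OF assms(1)] clinear_opD[OF assms(1)])

lemma clinear_op_id: "clinear_op id"
  by (simp add: clinear_op_def)

lemma clinear_op_comp: "clinear_op g \<Longrightarrow> clinear_op h \<Longrightarrow> clinear_op (g \<circ> h)"
  by (simp add: clinear_op_def)

lemma clinear_op_gen: "clinear_op (clifford_gen i)"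
  by (simp add: clinear_op_def clifford_gen_toggle fun_eq_iff algebra_simps)

section \<open>Vectors of the Clifford algebra with complex coefficients, as needed for weight
  vectors\<close>

definition cvec :: "nat \<Rightarrow> (nat \<Rightarrow> complex) \<Rightarrow> nat set operator" where
  "cvec d c f = (\<lambda>S. \<Sum>i<d. c i * clifford_gen i f S)"

lemma clifford_vec_cvec: "clifford_vec d v = cvec d (\<lambda>i. complex_of_real (v i))"
  by (simp add: clifford_vec_def cvec_def fun_eq_iff)

lemma clinear_op_cvec: "clinear_op (cvec d c)"
proof (rule clinear_opI)
  show "cvec d c (\<lambda>S. a * f S + g S) S = a * cvec d c f S + cvec d c g S" for a f g S
    unfolding cvec_def clinear_opD[OF clinear_op_gen]
    by (simp add: algebra_simps sum.distrib sum_distrib_left)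
qed

lemma cvec_linear: "cvec d (\<lambda>i. a * c i + b i) f S = a * cvec d c f S + cvec d b f S"
  by (simp add: cvec_def algebra_simps sum.distrib sum_distrib_left)

lemma cvec_apply_singleton:
  "k < d \<Longrightarrow> cvec d c (\<lambda>S. if S = {} then 1 else 0) {k} = c k"
  by (simp add: cvec_def clifford_gen_apply_singleton if_distrib[of "(*) _"] cong: if_cong)

lemma cvec_single:
  assumes "k < d"
  shows "cvec d (\<lambda>i. if i = k then a else 0) f = (\<lambda>S. a * clifford_gen k f S)"
proof -
  have "(if i = k then a else 0) * x = (if i = k then a * x else 0)" for i and x :: complex
    by simp
  then show ?thesis using assms by (simp add: cvec_def)
qed

text \<open>Once the second double sum is transposed, the off-diagonal terms cancel in pairs. The
  form on the right is complex bilinear, not Hermitian, so that nonzero vectors of square zero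
  exist.\<close>

lemma cvec_anticommutator:
  "cvec d c (cvec d b f) S + cvec d b (cvec d c f) S = - 2 * (\<Sum>i<d. c i * b i) * f S"
proof -
  have exp: "cvec d c (cvec d b f) S
      = (\<Sum>i<d. \<Sum>j<d. c i * b j * clifford_gen i (clifford_gen j f) S)" for c b
    by (simp add: cvec_def clinear_op_sum[OF clinear_op_gen] sum_distrib_left mult.assoc)
  have ac: "clifford_gen i (clifford_gen j f) S + clifford_gen j (clifford_gen i f) S
      = (if i = j then - 2 * f S else 0)" for i j
    using clifford_gen_anticommute[of i j f] by (simp add: clifford_gen_square)
  have "cvec d b (cvec d c f) S = (\<Sum>i<d. \<Sum>j<d. b j * c i * clifford_gen j (clifford_gen i f) S)"
    unfolding exp by (rule sum.swap)
  then have "cvec d c (cvec d b f) S + cvec d b (cvec d c f) S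
      = (\<Sum>i<d. \<Sum>j<d. c i * b j *
          (clifford_gen i (clifford_gen j f) S + clifford_gen j (clifford_gen i f) S))"
    by (simp add: exp sum.distrib algebra_simps)
  also have "\<dots> = (\<Sum>i<d. \<Sum>j<d. if i = j then - 2 * (c i * b j) * f S else 0)"
    unfolding ac by (intro sum.cong refl) simp
  also have "\<dots> = - 2 * (\<Sum>i<d. c i * b i) * f S"
    by (simp add: sum_distrib_left sum_distrib_right)
  finally show ?thesis .
qed

section \<open>The torus\<close>

definition plane :: "nat \<Rightarrow> nat set operator" where
  "plane j f = clifford_gen (2 * j) (clifford_gen (2 * j + 1) f)"

lemma clinear_op_plane: "clinear_op (plane j)"
  unfolding plane_def using clinear_op_comp[OF clinear_op_gen clinear_op_gen] by (simp add: comp_def)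

lemma spin_rotation_plane:
  "spin_rotation j s f = (\<lambda>S. complex_of_real (cos (s / 2)) * f S
     + complex_of_real (sin (s / 2)) * plane j f S)"
  by (simp add: spin_rotation_def plane_def)

lemma clinear_op_rotation: "clinear_op (spin_rotation j s)"
proof (rule clinear_opI)
  show "spin_rotation j s (\<lambda>S. a * f S + g S) S
      = a * spin_rotation j s f S + spin_rotation j s g S" for a f g S
    unfolding spin_rotation_plane clinear_opD[OF clinear_op_plane] by (simp add: algebra_simps)
qed

lemma plane_square: "plane j (plane j f) = (\<lambda>S. - f S)"
proof -
  have "clifford_gen (2*j+1) (clifford_gen (2*j) (clifford_gen (2*j+1) f))
      = clifford_gen (2*j) f"
    by (subst clifford_gen_anticommute)
       (simp_all add: clifford_gen_square clinear_op_minus[OF clinear_op_gen] )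
  then show ?thesis by (simp add: plane_def clifford_gen_square)
qed

lemma plane_commute_gen:
  assumes "b \<noteq> 2 * j" "b \<noteq> 2 * j + 1"
  shows "plane j (clifford_gen b f) = clifford_gen b (plane j f)"
  unfolding plane_def
  using assms by (simp add: clifford_gen_anticommute[of _ b] clinear_op_minus[OF clinear_op_gen])

lemma plane_commute: "plane j (plane k f) = plane k (plane j f)"
proof (cases "j = k")
  case False
  then have "plane j (clifford_gen (2*k) g) = clifford_gen (2*k) (plane j g)"
    "plane j (clifford_gen (2*k+1) g) = clifford_gen (2*k+1) (plane j g)" for g
    by (intro plane_commute_gen; presburger)+
  then show ?thesis unfolding plane_def[of k] by simp
qed simp

text \<open>A rotation is a combination of the identity and \<open>plane j\<close>, so relations
  need only be checked on these bivectors. This is applied to isotropic vectors, to rotations, to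
  root vectors and to representatives of Weyl group elements.\<close>

lemma rotation_intertwine:
  assumes "clinear_op h" "\<And>f. h (plane j f) = plane k (h f)"
  shows "h (spin_rotation j s f) = spin_rotation k s (h f)"
  by (simp add: spin_rotation_plane clinear_opD[OF assms(1)] clinear_op_scale[OF assms(1)] assms(2))

lemma rotation_commute:
  "spin_rotation j s (spin_rotation k r f) = spin_rotation k r (spin_rotation j s f)"
proof (rule rotation_intertwine[OF clinear_op_rotation])
  show "spin_rotation j s (plane k f) = plane k (spin_rotation j s f)" for f
    by (rule rotation_intertwine[symmetric, OF clinear_op_plane]) (rule plane_commute)
qed

lemma rotation_inverse: "spin_rotation j s (spin_rotation j (- s) f) = f"
proof
  fix S
  have *: "plane j (\<lambda>S. a * f S + b * plane j f S) = (\<lambda>S. a * plane j f S - b * f S)" for a b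
    using clinear_opD[OF clinear_op_plane, of j a f "\<lambda>S. b * plane j f S"]
    by (simp add: clinear_op_scale[OF clinear_op_plane] plane_square)
  have "complex_of_real (cos (s/2)) * complex_of_real (cos (s/2))
      + complex_of_real (sin (s/2)) * complex_of_real (sin (s/2))
      = of_real ((cos (s/2))\<^sup>2 + (sin (s/2))\<^sup>2)"
    by (simp only: of_real_mult of_real_add power2_eq_square)
  then have "complex_of_real (cos (s/2)) * complex_of_real (cos (s/2))
      + complex_of_real (sin (s/2)) * complex_of_real (sin (s/2)) = 1" by simp
  then have e: "(complex_of_real (cos (s/2)) * complex_of_real (cos (s/2))
      + complex_of_real (sin (s/2)) * complex_of_real (sin (s/2))) * f S = f S" by simp
  show "spin_rotation j s (spin_rotation j (- s) f) S = f S"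
    unfolding spin_rotation_plane * using e by (simp add: algebra_simps)
qed

section \<open>Weight vectors of the vector representation\<close>

definition isotropic :: "nat \<Rightarrow> complex \<Rightarrow> nat set operator" where
  "isotropic j \<delta> f = (\<lambda>S. clifford_gen (2*j) f S - \<i> * \<delta> * clifford_gen (2*j+1) f S)"

lemma clinear_op_isotropic: "clinear_op (isotropic j \<delta>)"
proof (rule clinear_opI)
  show "isotropic j \<delta> (\<lambda>S. a * f S + g S) S = a * isotropic j \<delta> f S + isotropic j \<delta> g S"
    for a f g S
    unfolding isotropic_def clinear_opD[OF clinear_op_gen] by (simp add: algebra_simps)
qed

lemma plane_isotropic_other:
  assumes "j \<noteq> k"
  shows "isotropic j \<delta> (plane k f) = plane k (isotropic j \<delta> f)"
proof -
  have "clifford_gen (2*j) (plane k f) = plane k (clifford_gen (2*j) f)"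
    "clifford_gen (2*j+1) (plane k f) = plane k (clifford_gen (2*j+1) f)"
    using assms by (intro plane_commute_gen[symmetric]; presburger)+
  then show ?thesis
    by (simp add: isotropic_def clinear_op_diff[OF clinear_op_plane]
        clinear_op_scale[OF clinear_op_plane])
qed

lemma plane_gen_even: "plane j (clifford_gen (2*j) f) = clifford_gen (2*j+1) f"
  unfolding plane_def
  by (subst (2) clifford_gen_anticommute)
     (simp_all add: clifford_gen_square clinear_op_minus[OF clinear_op_gen])

lemma plane_gen_odd: "plane j (clifford_gen (2*j+1) f) = (\<lambda>S. - clifford_gen (2*j) f S)"
  by (simp add: plane_def clifford_gen_square clinear_op_minus[OF clinear_op_gen])

lemma gen_even_plane: "clifford_gen (2*j) (plane j f) = (\<lambda>S. - clifford_gen (2*j+1) f S)"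
  by (simp add: plane_def clifford_gen_square)

lemma gen_odd_plane: "clifford_gen (2*j+1) (plane j f) = clifford_gen (2*j) f"
  unfolding plane_def
  by (subst clifford_gen_anticommute)
     (simp_all add: clifford_gen_square clinear_op_minus[OF clinear_op_gen])

text \<open>The bivector has opposite eigenvalues from the left and from the right. This is what
  turns the half angles in \<open>spin_rotation\<close> into full angles under conjugation.\<close>

lemma plane_isotropic:
  assumes "\<delta> * \<delta> = 1"
  shows "plane j (isotropic j \<delta> f) = (\<lambda>S. \<i> * \<delta> * isotropic j \<delta> f S)"
    and "isotropic j \<delta> (plane j f) = (\<lambda>S. - \<i> * \<delta> * isotropic j \<delta> f S)"
proof -
  have sq: "\<i> * \<delta> * (\<i> * \<delta> * x) = - x" for x
  proof -
    have "\<i> * \<delta> * (\<i> * \<delta> * x) = \<i> * \<i> * (\<delta> * \<delta>) * x" by (simp only: mult_ac)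
    then show ?thesis using assms by simp
  qed
  show "plane j (isotropic j \<delta> f) = (\<lambda>S. \<i> * \<delta> * isotropic j \<delta> f S)"
    unfolding isotropic_def clinear_op_diff[OF clinear_op_plane]
      clinear_op_scale[OF clinear_op_plane] plane_gen_even plane_gen_odd right_diff_distrib sq
    by (rule ext) simp
  show "isotropic j \<delta> (plane j f) = (\<lambda>S. - \<i> * \<delta> * isotropic j \<delta> f S)"
    unfolding isotropic_def gen_even_plane gen_odd_plane right_diff_distrib
      mult_minus_left sq
    by (rule ext) simp
qed

text \<open>The rotation contributes the phase of \<open>\<delta> * s / 2\<close> on the left of the
  isotropic vector and of \<open>- (\<delta> * s / 2)\<close> on its right; the quotient of the two
  is the phase of the full angle.\<close>

lemma rotation_isotropic:
  assumes "\<delta> = 1 \<or> \<delta> = -1"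
  shows "spin_rotation j s (isotropic j (of_real \<delta>) f)
    = (\<lambda>S. cis (\<delta> * s) * isotropic j (of_real \<delta>) (spin_rotation j s f) S)"
proof
  fix S
  let ?C = "complex_of_real (cos (s/2))" and ?D = "complex_of_real (sin (s/2))"
  let ?u = "isotropic j (of_real \<delta>) f S"
  have sq: "complex_of_real \<delta> * complex_of_real \<delta> = 1" using assms by auto
  have 1: "spin_rotation j s (isotropic j (of_real \<delta>) f) S = cis (\<delta> * s / 2) * ?u"
    using assms unfolding spin_rotation_plane plane_isotropic(1)[OF sq]
    by (auto simp: cis.ctr complex_eq_iff algebra_simps)
  have 2: "isotropic j (of_real \<delta>) (spin_rotation j s f) S = cis (- (\<delta> * s / 2)) * ?u"
    using assms unfolding spin_rotation_plane clinear_opD[OF clinear_op_isotropic]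
      clinear_op_scale[OF clinear_op_isotropic] plane_isotropic(2)[OF sq]
    by (auto simp: cis.ctr complex_eq_iff algebra_simps)
  have 3: "cis (\<delta> * s) * cis (- (\<delta> * s / 2)) = cis (\<delta> * s / 2)"
    by (simp add: cis_mult)
  show "spin_rotation j s (isotropic j (of_real \<delta>) f) S
      = cis (\<delta> * s) * isotropic j (of_real \<delta>) (spin_rotation j s f) S"
    unfolding 1 2 by (simp add: 3 flip: mult.assoc)
qed

lemma spin_torus_foldr: "spin_torus n t = foldr (\<lambda>j. spin_rotation j (t j)) [0..<n]"
proof -
  have "foldr (\<lambda>j g. spin_rotation j (t j) \<circ> g) xs id = foldr (\<lambda>j. spin_rotation j (t j)) xs"
    for xs by (induction xs) auto
  then show ?thesis by (simp add: spin_torus_def)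
qed

lemma clinear_op_foldr:
  "(\<And>x. x \<in> set xs \<Longrightarrow> clinear_op (F x)) \<Longrightarrow> clinear_op (foldr F xs)"
  by (induction xs) (auto intro: clinear_op_comp clinear_op_id[unfolded id_def] simp: id_def)

lemma clinear_op_torus: "clinear_op (spin_torus n t)"
  unfolding spin_torus_foldr by (rule clinear_op_foldr) (rule clinear_op_rotation)

text \<open>Used in place of invertibility: any prescribed form, in particular the vacuum, is the
  image of some form under a given torus element.\<close>

lemma surj_torus: "surj (spin_torus n t)"
proof -
  have "surj (foldr (\<lambda>j. spin_rotation j (t j)) xs)" for xs
  proof (induction xs)
    case (Cons j xs)
    have "surj (spin_rotation j (t j))"
      by (rule surjI[of _ "spin_rotation j (- t j)"]) (rule rotation_inverse)
    from comp_surj[OF Cons.IH this] show ?case by (simp add: comp_def)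
  qed simp
  then show ?thesis by (simp add: spin_torus_foldr)
qed

lemma torus_isotropic:
  assumes "\<delta> = 1 \<or> \<delta> = -1" "j < n"
  shows "spin_torus n t (isotropic j (of_real \<delta>) f)
    = (\<lambda>S. cis (\<delta> * t j) * isotropic j (of_real \<delta>) (spin_torus n t f) S)"
proof -
  let ?u = "isotropic j (of_real \<delta>)"
  let ?R = "foldr (\<lambda>j. spin_rotation j (t j))"
  \<comment> \<open>All rotations except the \<open>j\<close>-th commute with \<open>?u\<close>;
    distinctness ensures that the phase is picked up at most once.\<close>
  have "?R xs (?u f) = (\<lambda>S. (if j \<in> set xs then cis (\<delta> * t j) else 1) * ?u (?R xs f) S)"
    if "distinct xs" for xs
    using that
  proof (induction xs)
    case (Cons k xs)
    show ?case
    proof (cases "k = j")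
      case True
      then show ?thesis using Cons by (simp add: rotation_isotropic[OF assms(1)])
    next
      case False
      have "spin_rotation k (t k) (?u g) = ?u (spin_rotation k (t k) g)" for g
        using False by (intro rotation_intertwine[symmetric] clinear_op_isotropic
            plane_isotropic_other) auto
      then show ?thesis using Cons False
        by (simp add: clinear_op_scale[OF clinear_op_rotation])
    qed
  qed simp
  then show ?thesis using assms by (simp add: spin_torus_foldr)
qed

section \<open>Weight vectors of the spin representation\<close>

text \<open>The sign with which \<open>plane j\<close> acts depends only on whether
  \<open>2 * j + 1\<close> belongs to \<open>S\<close>. A joint eigenvector may therefore ignore the
  even indices, and \<open>- \<i> * \<epsilon> j\<close> is the ratio forced by the eigenvalue
  \<open>\<i> * \<epsilon> j\<close>.\<close>

definition spinor :: "nat \<Rightarrow> (nat \<Rightarrow> real) \<Rightarrow> nat set \<Rightarrow> complex" where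
  "spinor n \<epsilon> S = (\<Prod>j<n. if 2 * j + 1 \<in> S then - \<i> * of_real (\<epsilon> j) else 1)"

lemma plane_spinor:
  assumes "j < n" "\<epsilon> j = 1 \<or> \<epsilon> j = -1"
  shows "plane j (spinor n \<epsilon>) = (\<lambda>S. \<i> * of_real (\<epsilon> j) * spinor n \<epsilon> S)"
proof
  fix S
  let ?a = "2 * j" and ?b = "2 * j + 1"
  have even: "spinor n \<epsilon> (toggle ?a T) = spinor n \<epsilon> T" for T
    unfolding spinor_def by (intro prod.cong refl) (auto simp: mem_toggle; presburger)
  have split: "spinor n \<epsilon> T = (if ?b \<in> T then - \<i> * of_real (\<epsilon> j) else 1)
      * (\<Prod>k\<in>{..<n}-{j}. if 2 * k + 1 \<in> T then - \<i> * of_real (\<epsilon> k) else 1)" for T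
    unfolding spinor_def using assms by (subst prod.remove[of _ j]) auto
  have rest: "(\<Prod>k\<in>{..<n}-{j}. if 2 * k + 1 \<in> toggle ?b S then - \<i> * of_real (\<epsilon> k) else 1)
     = (\<Prod>k\<in>{..<n}-{j}. if 2 * k + 1 \<in> S then - \<i> * of_real (\<epsilon> k) else (1::complex))"
    by (intro prod.cong refl) (auto simp: mem_toggle)
  have fin: "finite {k\<in>S. k < ?a}"
    by (rule finite_subset[of _ "{..<?a}"]) auto
  have "{k\<in>S. k < ?b} = (if ?a \<in> S then insert ?a {k\<in>S. k < ?a} else {k\<in>S. k < ?a})"
    by (auto simp: less_Suc_eq)
  \<comment> \<open>The indices below \<open>2 * j\<close> are counted twice and cancel; the
    presence of \<open>2 * j\<close> enters once directly and once through the count for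
    \<open>2 * j + 1\<close>, and cancels as well.\<close>
  then have sgn: "gen_sign ?a S * gen_sign ?b (toggle ?a S) = (if ?b \<in> S then 1 else -1)"
    using fin by (subst gen_sign_toggle_less) (auto simp: gen_sign_def simp flip: power_add mult_2)
  have "plane j (spinor n \<epsilon>) S
      = gen_sign ?a S * gen_sign ?b (toggle ?a S) * spinor n \<epsilon> (toggle ?b S)"
    by (simp add: plane_def clifford_gen_toggle toggle_commute[of ?b ?a] even
        del: One_nat_def add_Suc_right)
  also have "\<dots> = \<i> * of_real (\<epsilon> j) * spinor n \<epsilon> S"
    unfolding sgn split[of "toggle ?b S"] split[of S] rest using assms(2)
    by (auto simp: mem_toggle)
  finally show "plane j (spinor n \<epsilon>) S = \<i> * of_real (\<epsilon> j) * spinor n \<epsilon> S" .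
qed

lemma torus_spinor:
  assumes "\<And>j. j < n \<Longrightarrow> \<epsilon> j = 1 \<or> \<epsilon> j = -1"
  shows "spin_torus n t (spinor n \<epsilon>) = (\<lambda>S. cis (\<Sum>j<n. \<epsilon> j / 2 * t j) * spinor n \<epsilon> S)"
proof -
  have rot: "spin_rotation j (t j) (spinor n \<epsilon>) = (\<lambda>S. cis (\<epsilon> j / 2 * t j) * spinor n \<epsilon> S)"
    if "j < n" for j
    unfolding spin_rotation_plane plane_spinor[of j n \<epsilon>, OF that assms[OF that]]
    using assms[OF that]
    by (auto simp: cis.ctr complex_eq_iff algebra_simps)
  have "foldr (\<lambda>j. spin_rotation j (t j)) xs (spinor n \<epsilon>)
      = (\<lambda>S. cis (\<Sum>j\<leftarrow>xs. \<epsilon> j / 2 * t j) * spinor n \<epsilon> S)" if "set xs \<subseteq> {..<n}" for xs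
    using that
  proof (induction xs)
    case (Cons j xs)
    then have "foldr (\<lambda>j. spin_rotation j (t j)) (j # xs) (spinor n \<epsilon>)
      = (\<lambda>S. cis (\<Sum>j\<leftarrow>xs. \<epsilon> j / 2 * t j) * (cis (\<epsilon> j / 2 * t j) * spinor n \<epsilon> S))"
      using rot[of j] by (simp add: clinear_op_scale[OF clinear_op_rotation])
    then show ?case by (simp add: mult_ac flip: cis_mult)
  qed simp
  from this[of "[0..<n]"] show ?thesis
    by (simp add: spin_torus_foldr interv_sum_list_conv_sum_set_nat atLeast0LessThan)
qed

section \<open>The weight lattice\<close>

lemma coords_iff: "x \<in> coords r \<longleftrightarrow> (\<forall>j\<ge>r. x j = 0)"
  by (simp add: coords_def topspace_Euclidean_space)

definition spin_weights :: "nat \<Rightarrow> (nat \<Rightarrow> real) set" where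
  "spin_weights n = {x\<in>coords n. (\<forall>j<n. x j \<in> \<int>) \<or> (\<forall>j<n. x j - 1/2 \<in> \<int>)}"

lemma rotation_2pi: "spin_rotation j (2 * pi * real k) f = (\<lambda>S. (-1) ^ k * f S)"
  by (simp add: spin_rotation_plane cos_npi2 sin_npi2)

lemma torus_2pi:
  "spin_torus n (\<lambda>j. 2 * pi * real (k j)) f = (\<lambda>S. (-1) ^ (\<Sum>j<n. k j) * f S)"
proof -
  have "foldr (\<lambda>j. spin_rotation j (2 * pi * real (k j))) xs f
      = (\<lambda>S. (-1) ^ (\<Sum>j\<leftarrow>xs. k j) * f S)" for xs
    by (induction xs) (simp_all add: rotation_2pi power_add, simp add: mult.assoc)
  from this[of "[0..<n]"] show ?thesis
    by (simp add: spin_torus_foldr interv_sum_list_conv_sum_set_nat atLeast0LessThan)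
qed

lemma cis_eq_one_int:
  assumes "cis (2 * pi * y) = 1"
  shows "y \<in> \<int>"
proof -
  have "cos (2 * pi * y) = 1" using assms by (simp add: complex_eq_iff)
  then obtain k :: int where "2 * pi * y = of_int k * 2 * pi"
    using cos_one_2pi_int by blast
  then have "y = of_int k" by simp
  then show ?thesis by simp
qed

text \<open>A single full turn lifts to -1 in the spin group, so only an even total number of turns
  is trivial. This parity is what leaves room for half-integral weights.\<close>

lemma has_differential_2pi:
  assumes "has_differential n (spin_torus n) \<xi> x"
    and "\<And>j. j \<ge> n \<Longrightarrow> k j = 0" "even (\<Sum>j<n. k j)"
  shows "(\<Sum>j<n. x j * real (k j)) \<in> \<int>"
proof -
  have t: "(\<lambda>j. 2 * pi * real (k j)) \<in> coords n" "(\<lambda>j. 0) \<in> coords n"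
    using assms(2) by (auto simp: coords_iff)
  have "spin_torus n (\<lambda>j. 2 * pi * real (k j)) = spin_torus n (\<lambda>j. 0)"
    using torus_2pi[of n "\<lambda>_. 0"] assms(3) by (simp add: torus_2pi fun_eq_iff)
  moreover have "\<forall>t\<in>coords n. \<xi> (spin_torus n t) = cis (pairing n x t)"
    using assms(1) by (simp add: has_differential_def)
  ultimately have "cis (pairing n x (\<lambda>j. 2 * pi * real (k j))) = cis (pairing n x (\<lambda>j. 0))"
    using t by (metis (no_types, lifting))
  then have "cis (2 * pi * (\<Sum>j<n. x j * real (k j))) = 1"
    by (simp add: pairing_def sum_distrib_left mult_ac)
  then show ?thesis by (rule cis_eq_one_int)
qed

lemma weight_lattice_subset: "weight_lattice n (spin_torus n) \<subseteq> spin_weights n"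
proof
  fix x assume "x \<in> weight_lattice n (spin_torus n)"
  then obtain \<xi> where d: "has_differential n (spin_torus n) \<xi> x"
    by (auto simp: weight_lattice_def)
  \<comment> \<open>The even tuples tested are 2 e_j and, below, e_j + e_l; together they allow only
    coordinates that are all integral or all half-integral.\<close>
  have double: "2 * x j \<in> \<int>" if "j < n" for j
    using has_differential_2pi[OF d, of "\<lambda>i. if i = j then 2 else 0"] that
    by (simp add: if_distrib[of real] if_distrib[of "(*) _"] mult.commute cong: if_cong)
  have add: "x j + x l \<in> \<int>" if "j < n" "l < n" "j \<noteq> l" for j l
  proof -
    let ?k = "\<lambda>i. (if i = j then 1 else 0) + (if i = l then 1 else 0) :: nat"
    have "(\<Sum>i<n. x i * real (?k i)) \<in> \<int>"
      using that by (intro has_differential_2pi[OF d]) (auto simp: sum.distrib)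
    then show ?thesis
      using that by (simp add: if_distrib[of real] if_distrib[of "(*) _"] distrib_left sum.distrib
          cong: if_cong)
  qed
  have "(\<forall>j<n. x j \<in> \<int>) \<or> (\<forall>j<n. x j - 1/2 \<in> \<int>)"
  proof (cases "\<exists>l<n. x l \<in> \<int>")
    case True
    then obtain l where l: "l < n" "x l \<in> \<int>" by auto
    have "x j \<in> \<int>" if "j < n" for j
      using add[OF that l(1)] l(2) by (cases "j = l") (auto dest: Ints_diff)
    then show ?thesis by blast
  next
    case False
    have "x j - 1/2 \<in> \<int>" if "j < n" for j
    proof -
      obtain k :: int where k: "2 * x j = of_int k" using double[OF \<open>j < n\<close>] by (rule Ints_cases)
      have "odd k"
      proof
        assume "even k"
        then obtain q where "k = 2 * q" by (elim evenE)
        then have "x j = of_int q" using k by simp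
        then show False using False that by auto
      qed
      then obtain q where "k = 2 * q + 1" by (elim oddE)
      then have "x j - 1/2 = of_int q" using k by (simp add: field_simps)
      then show ?thesis by simp
    qed
    then show ?thesis by blast
  qed
  then show "x \<in> spin_weights n"
    using d by (simp add: spin_weights_def has_differential_def)
qed

section \<open>Construction of enough characters\<close>

lemma pairing_add: "pairing n (\<lambda>j. x j + y j) t = pairing n x t + pairing n y t"
  by (simp add: pairing_def algebra_simps sum.distrib)

lemma weight_lattice_add:
  assumes "x \<in> weight_lattice n \<phi>" "y \<in> weight_lattice n \<phi>"
  shows "(\<lambda>j. x j + y j) \<in> weight_lattice n \<phi>"
proof -
  obtain \<xi> \<eta> where c: "\<xi> \<in> characters (torus n \<phi>)" "\<eta> \<in> characters (torus n \<phi>)"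
    and d: "has_differential n \<phi> \<xi> x" "has_differential n \<phi> \<eta> y"
    using assms by (auto simp: weight_lattice_def)
  have "(\<lambda>h. \<xi> h * \<eta> h) \<in> characters (torus n \<phi>)"
    using c by (auto simp: characters_def norm_mult image_subset_iff intro!: continuous_on_mult)
  moreover have "has_differential n \<phi> (\<lambda>h. \<xi> h * \<eta> h) (\<lambda>j. x j + y j)"
    using d by (auto simp: has_differential_def coords_iff pairing_add cis_mult)
  ultimately show ?thesis by (auto simp: weight_lattice_def)
qed

lemma weight_lattice_minus:
  assumes "x \<in> weight_lattice n \<phi>"
  shows "(\<lambda>j. - x j) \<in> weight_lattice n \<phi>"
proof -
  obtain \<xi> where c: "\<xi> \<in> characters (torus n \<phi>)" and d: "has_differential n \<phi> \<xi> x"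
    using assms by (auto simp: weight_lattice_def)
  have "(\<lambda>h. cnj (\<xi> h)) \<in> characters (torus n \<phi>)"
    using c by (auto simp: characters_def image_subset_iff intro!: continuous_on_cnj)
  moreover have "has_differential n \<phi> (\<lambda>h. cnj (\<xi> h)) (\<lambda>j. - x j)"
    using d by (auto simp: has_differential_def coords_iff pairing_def cis_cnj sum_negf)
  ultimately show ?thesis by (auto simp: weight_lattice_def)
qed

lemma spin_weight_in_lattice:
  assumes "\<And>j. j < n \<Longrightarrow> \<epsilon> j = 1 \<or> \<epsilon> j = -1"
  shows "(\<lambda>j. if j < n then \<epsilon> j / 2 else 0) \<in> weight_lattice n (spin_torus n)"
proof -
  define \<xi> where "\<xi> = (\<lambda>h :: nat set operator. h (spinor n \<epsilon>) {})"
  define \<kappa> where "\<kappa> t = cis (\<Sum>j<n. \<epsilon> j / 2 * t j)" for t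
  have one: "spinor n \<epsilon> {} = 1" by (simp add: spinor_def)
  have ev: "spin_torus n t (spinor n \<epsilon>) = (\<lambda>S. \<kappa> t * spinor n \<epsilon> S)" for t
    unfolding \<kappa>_def by (rule torus_spinor[OF assms])
  have val: "\<xi> (spin_torus n t) = \<kappa> t" for t
    by (simp add: \<xi>_def ev one)
  have mul: "\<xi> (spin_torus n t \<circ> spin_torus n s) = \<kappa> t * \<kappa> s" for t s
    by (simp add: \<xi>_def ev clinear_op_scale[OF clinear_op_torus] one)
  \<comment> \<open>Evaluating an operator at a fixed form and a fixed index is a coordinate map for
    the product topology, taken twice; nothing about the topology of the torus itself is
    involved.\<close>
  have "continuous_on UNIV \<xi>"
    unfolding \<xi>_def
    by (rule continuous_on_product_then_coordinatewise[OF continuous_on_product_coordinates])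
  then have "continuous_on (torus n (spin_torus n)) \<xi>"
    by (rule continuous_on_subset) simp
  then have "\<xi> \<in> characters (torus n (spin_torus n))"
    by (auto simp: characters_def torus_def val mul) (simp add: \<kappa>_def)
  moreover have "has_differential n (spin_torus n) \<xi> (\<lambda>j. if j < n then \<epsilon> j / 2 else 0)"
    by (auto simp: has_differential_def coords_iff val \<kappa>_def pairing_def intro!: arg_cong[of _ _ cis] sum.cong)
  ultimately show ?thesis by (auto simp: weight_lattice_def)
qed

definition unit_vec :: "nat \<Rightarrow> nat \<Rightarrow> real" where
  "unit_vec j = (\<lambda>i. if i = j then 1 else 0)"

lemma unit_vec_coords [simp]: "j < n \<Longrightarrow> unit_vec j \<in> coords n"
  by (auto simp: unit_vec_def coords_iff)

text \<open>e_j is the sum of (1/2, ..., 1/2) and the spin weight whose only positive entry is at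
  \<open>j\<close>.\<close>

lemma unit_vec_in_lattice:
  assumes "j < n"
  shows "unit_vec j \<in> weight_lattice n (spin_torus n)"
proof -
  let ?\<epsilon> = "\<lambda>i. if i = j then 1 else (-1::real)"
  have "(\<lambda>i. (if i < n then 1/2 else 0) + (if i < n then ?\<epsilon> i / 2 else 0))
      \<in> weight_lattice n (spin_torus n)"
    using spin_weight_in_lattice[of n "\<lambda>_. 1"] spin_weight_in_lattice[of n ?\<epsilon>]
    by (intro weight_lattice_add) auto
  also have "(\<lambda>i. (if i < n then 1/2 else 0) + (if i < n then ?\<epsilon> i / 2 else 0)) = unit_vec j"
    using assms by (auto simp: unit_vec_def fun_eq_iff)
  finally show ?thesis .
qed

lemma zero_in_lattice: "n > 0 \<Longrightarrow> (\<lambda>_. 0) \<in> weight_lattice n (spin_torus n)"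
  using weight_lattice_add[OF unit_vec_in_lattice weight_lattice_minus[OF unit_vec_in_lattice], of 0 n 0]
  by simp

lemma integral_in_lattice:
  assumes "n > 0" "x \<in> coords n" "\<And>j. j < n \<Longrightarrow> x j \<in> \<int>"
  shows "x \<in> weight_lattice n (spin_torus n)"
proof -
  have nat: "(\<lambda>i. real k * unit_vec j i) \<in> weight_lattice n (spin_torus n)" if "j < n" for j k
  proof (induction k)
    case (Suc k)
    then show ?case
      using weight_lattice_add[OF Suc unit_vec_in_lattice[OF that]]
      by (simp add: distrib_right add.commute)
  qed (simp add: zero_in_lattice[OF assms(1)])
  have int: "(\<lambda>i. of_int k * unit_vec j i) \<in> weight_lattice n (spin_torus n)" if "j < n" for j k
    using nat[OF that, of "nat k"] weight_lattice_minus[OF nat[OF that, of "nat (- k)"]]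
    by (cases "k \<ge> 0") simp_all
  have "l \<le> n \<Longrightarrow> (\<lambda>i. if i < l then x i else 0) \<in> weight_lattice n (spin_torus n)" for l
  proof (induction l)
    case (Suc l)
    obtain k where k: "x l = of_int k" using assms(3)[of l] Suc.prems by (auto elim: Ints_cases)
    have "(\<lambda>i. if i < Suc l then x i else 0)
      = (\<lambda>i. (if i < l then x i else 0) + of_int k * unit_vec l i)"
      using k by (auto simp: unit_vec_def fun_eq_iff less_Suc_eq)
    then show ?case using weight_lattice_add[OF Suc.IH int[of l k]] Suc.prems by simp
  qed (simp add: zero_in_lattice[OF assms(1)])
  moreover have "(\<lambda>i. if i < n then x i else 0) = x"
    using assms(2) by (auto simp: coords_iff fun_eq_iff)
  ultimately show ?thesis by (metis order_refl)
qed

lemma weight_lattice_spin: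
  assumes "n > 0"
  shows "weight_lattice n (spin_torus n) = spin_weights n"
proof (rule antisym[OF weight_lattice_subset], rule subsetI)
  fix x assume x: "x \<in> spin_weights n"
  then have c: "x \<in> coords n" by (simp add: spin_weights_def)
  consider "\<forall>j<n. x j \<in> \<int>" | "\<forall>j<n. x j - 1/2 \<in> \<int>" using x by (auto simp: spin_weights_def)
  then show "x \<in> weight_lattice n (spin_torus n)"
  proof cases
    case 1
    then show ?thesis using integral_in_lattice[OF assms c] by blast
  next
    case 2
    let ?h = "\<lambda>i. if i < n then 1/2 else (0::real)"
    have "(\<lambda>i. x i - ?h i) \<in> weight_lattice n (spin_torus n)"
      using 2 c by (intro integral_in_lattice[OF assms]) (auto simp: coords_iff)
    from weight_lattice_add[OF this spin_weight_in_lattice[of n "\<lambda>_. 1"]]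
    show ?thesis by simp
  qed
qed

section \<open>The Lie algebra and the roots\<close>

text \<open>\<open>w\<close> is minus the reflection of \<open>u\<close> in the hyperplane
  orthogonal to the unit vector \<open>v\<close>, hence has the same length;
  \<open>v u = w v\<close> is conjugation by \<open>v\<close> without an inverse.\<close>

lemma clifford_vec_comp_exchange:
  assumes "(\<Sum>i<d. (v i)\<^sup>2) = 1"
  obtains w where "(\<Sum>i<d. (w i)\<^sup>2) = (\<Sum>i<d. (u i)\<^sup>2)"
    "\<And>f. clifford_vec d v (clifford_vec d u f) = clifford_vec d w (clifford_vec d v f)"
proof -
  define r where "r = (\<Sum>i<d. u i * v i)"
  define w where "w i = 2 * r * v i - u i" for i
  have "(\<Sum>i<d. (w i)\<^sup>2) = (\<Sum>i<d. 4 * r\<^sup>2 * (v i)\<^sup>2 - 4 * r * (u i * v i) + (u i)\<^sup>2)"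
    by (intro sum.cong refl) (simp add: w_def power2_eq_square algebra_simps)
  also have "\<dots> = 4 * r\<^sup>2 * (\<Sum>i<d. (v i)\<^sup>2) - 4 * r * (\<Sum>i<d. u i * v i) + (\<Sum>i<d. (u i)\<^sup>2)"
    by (simp add: sum.distrib sum_subtractf sum_distrib_left)
  also have "\<dots> = (\<Sum>i<d. (u i)\<^sup>2)"
    by (simp add: assms flip: r_def) (simp add: power2_eq_square)
  finally have norm: "(\<Sum>i<d. (w i)\<^sup>2) = (\<Sum>i<d. (u i)\<^sup>2)" .
  have "clifford_vec d v (clifford_vec d u f) S = clifford_vec d w (clifford_vec d v f) S" for f S
  proof -
    let ?v = "\<lambda>i. complex_of_real (v i)" and ?u = "\<lambda>i. complex_of_real (u i)"
    have uv: "(\<Sum>i<d. ?u i * ?v i) = of_real r"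
      by (simp add: r_def)
    have vv: "(\<Sum>i<d. ?v i * ?v i) = 1"
      using assms by (simp add: power2_eq_square flip: of_real_mult of_real_sum)
    have "clifford_vec d w (clifford_vec d v f) S
      = 2 * of_real r * cvec d ?v (cvec d ?v f) S - cvec d ?u (cvec d ?v f) S"
      using cvec_linear[of d "2 * of_real r" ?v "\<lambda>i. - ?u i" "cvec d ?v f" S]
        cvec_linear[of d "-1" ?u "\<lambda>i. 0" "cvec d ?v f" S]
      by (simp add: clifford_vec_cvec w_def) (simp add: cvec_def)
    also have "cvec d ?v (cvec d ?v f) S = - f S"
      using cvec_anticommutator[of d ?v ?v f S] by (simp add: vv)
    also have "2 * of_real r * - f S - cvec d ?u (cvec d ?v f) S = cvec d ?v (cvec d ?u f) S"
      using cvec_anticommutator[of d ?u ?v f S] unfolding uv by (simp add: algebra_simps)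
    finally show ?thesis by (simp add: clifford_vec_cvec)
  qed
  then show thesis using norm that by blast
qed

lemma surj_clifford_vec:
  assumes "(\<Sum>i<d. (v i)\<^sup>2) = 1"
  shows "surj (clifford_vec d v)"
proof (rule surjI)
  fix f
  let ?v = "\<lambda>i. complex_of_real (v i)"
  have vv: "(\<Sum>i<d. ?v i * ?v i) = 1"
    using assms by (simp add: power2_eq_square flip: of_real_mult of_real_sum)
  have "cvec d ?v (cvec d ?v f) S = - f S" for S
    using cvec_anticommutator[of d ?v ?v f S] by (simp add: vv)
  then show "clifford_vec d v (\<lambda>S. - clifford_vec d v f S) = f"
    by (simp add: clifford_vec_cvec clinear_op_minus[OF clinear_op_cvec])
qed

definition clifford_prod :: "nat \<Rightarrow> (nat \<Rightarrow> real) list \<Rightarrow> nat set operator" where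
  "clifford_prod d vs = foldr (\<lambda>v g. clifford_vec d v \<circ> g) vs id"

lemma clifford_prod_Nil: "clifford_prod d [] = id"
  by (simp add: clifford_prod_def)

lemma clifford_prod_Cons: "clifford_prod d (v # vs) = clifford_vec d v \<circ> clifford_prod d vs"
  by (simp add: clifford_prod_def)

lemma spin_groupE:
  assumes "g \<in> spin_group d"
  obtains vs where "g = clifford_prod d vs" "\<forall>v\<in>set vs. (\<Sum>i<d. (v i)\<^sup>2) = 1"
  using assms by (auto simp: spin_group_def clifford_prod_def)

lemma spin_group_linear: "g \<in> spin_group d \<Longrightarrow> clinear_op g"
proof (elim spin_groupE)
  fix vs assume g: "g = clifford_prod d vs"
  have "clinear_op (clifford_prod d vs)"
    by (induction vs) (simp_all only: clifford_prod_Nil clifford_prod_Cons clinear_op_id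
        clinear_op_comp clinear_op_cvec clifford_vec_cvec)
  then show "clinear_op g" by (simp only: g)
qed

lemma surj_spin_group: "g \<in> spin_group d \<Longrightarrow> surj g"
proof (elim spin_groupE)
  fix vs assume g: "g = clifford_prod d vs" and u: "\<forall>v\<in>set vs. (\<Sum>i<d. (v i)\<^sup>2) = 1"
  from u have "surj (clifford_prod d vs)"
  proof (induction vs)
    case Nil
    show ?case unfolding clifford_prod_Nil by (rule surj_id)
  next
    case (Cons v vs)
    then show ?case unfolding clifford_prod_Cons
      by (intro comp_surj surj_clifford_vec) simp_all
  qed
  then show "surj g" by (simp only: g)
qed

text \<open>The exchange is iterated over the factors of \<open>g\<close>. Preservation of length
  matters later: it bounds the vectors attached to a curve in the group.\<close>

lemma spin_group_conjugate:
  assumes "g \<in> spin_group d"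
  obtains w where "(\<Sum>i<d. (w i)\<^sup>2) = (\<Sum>i<d. (u i)\<^sup>2)"
    "\<And>f. g (clifford_vec d u f) = clifford_vec d w (g f)"
proof -
  obtain vs where g: "g = clifford_prod d vs" and u: "\<forall>v\<in>set vs. (\<Sum>i<d. (v i)\<^sup>2) = 1"
    using assms by (rule spin_groupE)
  from u have "\<exists>w. (\<Sum>i<d. (w i)\<^sup>2) = (\<Sum>i<d. (u i)\<^sup>2) \<and>
      (\<forall>f. clifford_prod d vs (clifford_vec d u f) = clifford_vec d w (clifford_prod d vs f))"
  proof (induction vs)
    case Nil
    show ?case by (intro exI[of _ u]) (simp add: clifford_prod_Nil)
  next
    case (Cons v vs)
    from Cons.prems have "\<forall>v\<in>set vs. (\<Sum>i<d. (v i)\<^sup>2) = 1" "(\<Sum>i<d. (v i)\<^sup>2) = 1"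
      by simp_all
    with Cons.IH obtain w where w: "(\<Sum>i<d. (w i)\<^sup>2) = (\<Sum>i<d. (u i)\<^sup>2)"
      "\<forall>f. clifford_prod d vs (clifford_vec d u f) = clifford_vec d w (clifford_prod d vs f)"
      by blast
    obtain w' where "(\<Sum>i<d. (w' i)\<^sup>2) = (\<Sum>i<d. (w i)\<^sup>2)"
      "\<And>f. clifford_vec d v (clifford_vec d w f) = clifford_vec d w' (clifford_vec d v f)"
      using clifford_vec_comp_exchange[of v d w] \<open>(\<Sum>i<d. (v i)\<^sup>2) = 1\<close> by blast
    then show ?case using w by (intro exI[of _ w']) (simp add: clifford_prod_Cons)
  qed
  then show thesis using that unfolding g by blast
qed

section \<open>Tangent vectors and their brackets with vectors\<close>

lemma has_vector_derivative_quotient: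
  fixes f :: "real \<Rightarrow> complex"
  shows "(f has_vector_derivative D) (at 0) \<longleftrightarrow> ((\<lambda>s. (f s - f 0) / of_real s) \<longlongrightarrow> D) (at 0)"
proof -
  have "norm (f (0 + h) - f 0 - h *\<^sub>R D) / norm h = norm ((f h - f 0) / of_real h - D)"
    if "h \<noteq> 0" for h
  proof -
    have "(f h - f 0) / of_real h - D = (f h - f 0 - of_real h * D) / of_real h"
      using that by (simp add: field_simps)
    then show ?thesis by (simp add: norm_divide scaleR_conv_of_real)
  qed
  then have "((\<lambda>h. norm (f (0 + h) - f 0 - h *\<^sub>R D) / norm h) \<longlongrightarrow> 0) (at 0)
      \<longleftrightarrow> ((\<lambda>h. norm ((f h - f 0) / of_real h - D)) \<longlongrightarrow> 0) (at 0)"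
    by (intro filterlim_cong refl) (auto simp: eventually_at_filter)
  then show ?thesis
    by (simp add: has_vector_derivative_def has_derivative_at bounded_linear_scaleR_left
        tendsto_norm_zero_iff LIM_zero_iff)
qed

text \<open>For a curve \<open>\<gamma>\<close> in the spin group, \<open>\<gamma>(s) e\<^sub>a = v(s) \<gamma>(s)\<close> with unit vectors \<open>v(s)\<close>.  The
  coordinates of \<open>v(s)\<close> solve a linear system whose matrix is differentiable with value \<open>1\<close> at
  \<open>s = 0\<close>; as they are bounded, they are themselves differentiable at \<open>0\<close>.\<close>

lemma lie_algebra_commutator:
  assumes X: "X \<in> lie_algebra (spin_group d)" and a: "a < d"
  shows "\<exists>c. \<forall>f S. X (clifford_gen a f) S = clifford_gen a (X f) S + cvec d c f S"
proof -
  obtain \<gamma> :: "real \<Rightarrow> nat set operator" where \<gamma>0: "\<gamma> 0 = id" and \<gamma>: "\<And>s. \<gamma> s \<in> spin_group d"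
    and der: "\<And>f S. ((\<lambda>s. \<gamma> s f S) has_vector_derivative X f S) (at 0)"
    using X by (auto simp: lie_algebra_def)
  have quot: "((\<lambda>s. (\<gamma> s f S - f S) / of_real s) \<longlongrightarrow> X f S) (at 0)" for f S
    using der[of f S] by (simp add: has_vector_derivative_quotient \<gamma>0)
  have lim: "((\<lambda>s. \<gamma> s f S) \<longlongrightarrow> f S) (at 0)" for f S
    using has_vector_derivative_continuous[OF der[of f S]] by (simp add: continuous_at \<gamma>0)
  have gquot: "((\<lambda>s. (clifford_gen j (\<gamma> s f) S - clifford_gen j f S) / of_real s)
      \<longlongrightarrow> clifford_gen j (X f) S) (at 0)" for j f S
    using tendsto_mult_left[OF quot[of f "toggle j S"], of "gen_sign j S"]
    by (simp add: clifford_gen_toggle right_diff_distrib)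
  have glim: "((\<lambda>s. clifford_gen j (\<gamma> s f) S) \<longlongrightarrow> clifford_gen j f S) (at 0)" for j f S
    unfolding clifford_gen_toggle by (intro tendsto_mult_left lim)
  let ?a = "\<lambda>i. if i = a then 1 else (0::real)"
  have gen_a: "clifford_vec d ?a f = clifford_gen a f" for f
    using cvec_single[OF a, of 1 f] by (simp add: clifford_vec_cvec if_distrib cong: if_cong)
  have "\<exists>w. (\<Sum>i<d. (w i)\<^sup>2) = 1 \<and> (\<forall>f. \<gamma> s (clifford_gen a f) = clifford_vec d w (\<gamma> s f))" for s
  proof -
    have "(\<Sum>i<d. (?a i)\<^sup>2) = 1" using a by (simp add: if_distrib[of "\<lambda>x. x\<^sup>2"] cong: if_cong)
    then show ?thesis using spin_group_conjugate[where u = ?a, OF \<gamma>[of s]] unfolding gen_a by metis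
  qed
  then obtain v :: "real \<Rightarrow> nat \<Rightarrow> real" where v1: "\<And>s. (\<Sum>i<d. (v s i)\<^sup>2) = 1"
    and v: "\<And>s f. \<gamma> s (clifford_gen a f) = clifford_vec d (v s) (\<gamma> s f)"
    by metis
  have bound: "norm (complex_of_real (v s j)) \<le> 1" if "j < d" for s j
  proof -
    have "(v s j)\<^sup>2 \<le> (\<Sum>i<d. (v s i)\<^sup>2)" using that by (intro member_le_sum) auto
    then show ?thesis using v1[of s] by (simp add: abs_square_le_1)
  qed
  let ?e = "\<lambda>S::nat set. if S = {} then 1 else (0::complex)"
  define M where "M s k j = clifford_gen j (\<gamma> s ?e) {k}" for s k j
  have M0: "M 0 k j = (if j = k then 1 else 0)" for k j
    by (simp add: M_def \<gamma>0 clifford_gen_apply_singleton)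
  have Mlim: "((\<lambda>s. M s k j - M 0 k j) \<longlongrightarrow> 0) (at 0)" for k j
    using tendsto_diff[OF glim[of j ?e "{k}"] tendsto_const[of "M 0 k j"]] by (simp add: M_def \<gamma>0)
  define W where "W s k = \<gamma> s (clifford_gen a ?e) {k}" for s k
  have W: "W s k = (\<Sum>j<d. of_real (v s j) * M s k j)" for s k
    by (simp add: W_def M_def v clifford_vec_def)
  \<comment> \<open>\<open>M 0\<close> is the identity matrix, so each coordinate equals a known
    function minus an error in which bounded coordinates multiply entries tending to 0. This yields
    continuity at 0 first; with continuity available, the same identity divided by \<open>s\<close>
    converges.\<close>
  have vW: "complex_of_real (v s k) = W s k - (\<Sum>j<d. of_real (v s j) * (M s k j - M 0 k j))"
    if "k < d" for s k
    using that by (simp add: W right_diff_distrib sum_subtractf M0 if_distrib[of "(*) _"] cong: if_cong)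
  have Wlim: "((\<lambda>s. W s k) \<longlongrightarrow> W 0 k) (at 0)" for k
    using lim by (simp add: W_def \<gamma>0)
  have vlim: "((\<lambda>s. complex_of_real (v s k)) \<longlongrightarrow> of_real (v 0 k)) (at 0)" if "k < d" for k
  proof -
    have "((\<lambda>s. of_real (v s j) * (M s k j - M 0 k j)) \<longlongrightarrow> 0) (at 0)" if "j < d" for j
    proof (rule Lim_null_comparison[OF _ tendsto_norm_zero[OF Mlim[of k j]]])
      show "\<forall>\<^sub>F s in at 0. norm (of_real (v s j) * (M s k j - M 0 k j)) \<le> norm (M s k j - M 0 k j)"
        using bound[OF that] by (intro always_eventually) (simp add: norm_mult mult_left_le_one_le)
    qed
    then have "((\<lambda>s. W s k - (\<Sum>j<d. of_real (v s j) * (M s k j - M 0 k j)))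
        \<longlongrightarrow> W 0 k - (\<Sum>j<d. 0)) (at 0)"
      by (intro tendsto_diff Wlim tendsto_sum) auto
    then show ?thesis using vW[OF that] by (simp add: vW[OF that, of 0])
  qed
  \<comment> \<open>The derivative that formal differentiation of \<open>vW\<close> at 0
    predicts.\<close>
  define c where "c k = X (clifford_gen a ?e) {k}
      - (\<Sum>j<d. of_real (v 0 j) * clifford_gen j (X ?e) {k})" for k
  have vquot: "((\<lambda>s. (complex_of_real (v s k) - of_real (v 0 k)) / of_real s) \<longlongrightarrow> c k) (at 0)"
    if "k < d" for k
  proof -
    have "((\<lambda>s. (W s k - W 0 k) / of_real s
          - (\<Sum>j<d. of_real (v s j) * ((M s k j - M 0 k j) / of_real s))) \<longlongrightarrow> c k) (at 0)"
      unfolding c_def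
    proof (intro tendsto_diff tendsto_sum tendsto_mult)
      show "((\<lambda>s. (W s k - W 0 k) / of_real s) \<longlongrightarrow> X (clifford_gen a ?e) {k}) (at 0)"
        using quot[of "clifford_gen a ?e" "{k}"] by (simp add: W_def \<gamma>0)
      show "((\<lambda>s. (M s k j - M 0 k j) / of_real s) \<longlongrightarrow> clifford_gen j (X ?e) {k}) (at 0)" for j
        using gquot[of j ?e "{k}"] by (simp add: M_def \<gamma>0)
    qed (use vlim in auto)
    moreover have "(complex_of_real (v s k) - of_real (v 0 k)) / of_real s
        = (W s k - W 0 k) / of_real s
          - (\<Sum>j<d. of_real (v s j) * ((M s k j - M 0 k j) / of_real s))" for s
    proof -
      have "complex_of_real (v s k) - of_real (v 0 k)
          = W s k - W 0 k - (\<Sum>j<d. of_real (v s j) * (M s k j - M 0 k j))"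
        using vW[OF that, of s] vW[OF that, of 0] by simp
      then show ?thesis
        by (simp only: diff_divide_distrib[of "W s k - W 0 k"] sum_divide_distrib times_divide_eq_right)
    qed
    ultimately show ?thesis by simp
  qed
  have "X (clifford_gen a f) S - clifford_gen a (X f) S = cvec d c f S" for f S
  proof (rule tendsto_unique[of "at (0::real)"])
    show "((\<lambda>s. (\<gamma> s (clifford_gen a f) S - clifford_gen a f S) / of_real s
        - (clifford_gen a (\<gamma> s f) S - clifford_gen a f S) / of_real s)
        \<longlongrightarrow> X (clifford_gen a f) S - clifford_gen a (X f) S) (at 0)"
      by (intro tendsto_diff quot gquot)
    have "((\<lambda>s. \<Sum>j<d. (complex_of_real (v s j) - of_real (v 0 j)) / of_real s
        * clifford_gen j (\<gamma> s f) S) \<longlongrightarrow> cvec d c f S) (at 0)"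
      unfolding cvec_def by (intro tendsto_sum tendsto_mult glim vquot) auto
    moreover have "(\<Sum>j<d. (complex_of_real (v s j) - of_real (v 0 j)) / of_real s
        * clifford_gen j (\<gamma> s f) S)
      = (\<gamma> s (clifford_gen a f) S - clifford_gen a f S) / of_real s
        - (clifford_gen a (\<gamma> s f) S - clifford_gen a f S) / of_real s" for s
    proof -
      \<comment> \<open>Since the curve starts at the identity, \<open>v 0\<close> represents the
        generator e_a itself. Hence the commutator of \<open>\<gamma> s\<close> with e_a is
        \<open>v s - v 0\<close> applied after \<open>\<gamma> s\<close>, and the difference
        quotients of \<open>v\<close> appear.\<close>
      have "clifford_gen a g = clifford_vec d (v 0) g" for g
        using v[of 0 g] by (simp add: \<gamma>0)
      then have "(\<Sum>j<d. (complex_of_real (v s j) - of_real (v 0 j)) * clifford_gen j (\<gamma> s f) S)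
          = \<gamma> s (clifford_gen a f) S - clifford_gen a (\<gamma> s f) S"
        unfolding v by (simp add: clifford_vec_def left_diff_distrib sum_subtractf)
      then show ?thesis
        by (simp only: times_divide_eq_left flip: sum_divide_distrib diff_divide_distrib) simp
    qed
    ultimately show "((\<lambda>s. (\<gamma> s (clifford_gen a f) S - clifford_gen a f S) / of_real s
        - (clifford_gen a (\<gamma> s f) S - clifford_gen a f S) / of_real s) \<longlongrightarrow> cvec d c f S) (at 0)"
      by simp
  qed simp
  then show ?thesis by (intro exI[of _ c]) (simp add: algebra_simps)
qed

text \<open>Linearity is not built into \<open>lie_algebra\<close>; it passes from the curve to its
  derivative by uniqueness of derivatives.\<close>

lemma lie_algebra_linear:
  assumes "X \<in> lie_algebra (spin_group d)"
  shows "clinear_op X"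
proof (rule clinear_opI)
  fix c f g S
  obtain \<gamma> :: "real \<Rightarrow> nat set operator" where \<gamma>: "\<And>s. \<gamma> s \<in> spin_group d"
    and der: "\<And>f S. ((\<lambda>s. \<gamma> s f S) has_vector_derivative X f S) (at 0)"
    using assms by (auto simp: lie_algebra_def)
  have "((\<lambda>s. c * \<gamma> s f S + \<gamma> s g S) has_vector_derivative c * X f S + X g S) (at 0)"
    by (intro has_vector_derivative_add has_vector_derivative_mult_right der)
  then have "((\<lambda>s. \<gamma> s (\<lambda>S. c * f S + g S) S) has_vector_derivative c * X f S + X g S) (at 0)"
    by (simp add: clinear_opD[OF spin_group_linear[OF \<gamma>]])
  from vector_derivative_unique_at[OF der this]
  show "X (\<lambda>S. c * f S + g S) S = c * X f S + X g S" .
qed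

lemma complex_lie_algebra_linear:
  assumes "X \<in> complex_lie_algebra (spin_group d)"
  shows "clinear_op X"
proof -
  obtain N :: nat and c Y where L: "\<forall>k<N. Y k \<in> lie_algebra (spin_group d)"
    and X: "X = (\<lambda>f a. \<Sum>k<N. c k * Y k f a)"
    using assms unfolding complex_lie_algebra_def by blast
  then have Y: "clinear_op (Y k)" if "k < N" for k
    using that lie_algebra_linear by blast
  have "(\<Sum>k<N. c k * Y k (\<lambda>S. a * f S + g S) S)
      = (\<Sum>k<N. a * (c k * Y k f S) + c k * Y k g S)" for a f g S
    by (intro sum.cong refl, simp only: lessThan_iff clinear_opD[OF Y]) (simp add: algebra_simps)
  then show ?thesis
    by (intro clinear_opI) (simp add: X sum.distrib sum_distrib_left)
qed

text \<open>The bracket is linear both in the tangent operator and in the vector, so the statement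
  for generators extends to complex combinations of either.\<close>

lemma complex_lie_algebra_commutator:
  assumes "X \<in> complex_lie_algebra (spin_group d)"
  shows "\<exists>c. \<forall>f S. X (cvec d b f) S = cvec d b (X f) S + cvec d c f S"
proof -
  obtain N :: nat and c Y where Y: "\<forall>k<N. Y k \<in> lie_algebra (spin_group d)"
    and X: "X = (\<lambda>f a. \<Sum>k<N. c k * Y k f a)"
    using assms unfolding complex_lie_algebra_def by blast
  have "\<forall>k a. k < N \<and> a < d \<longrightarrow> (\<exists>r. \<forall>f S.
      Y k (clifford_gen a f) S = clifford_gen a (Y k f) S + cvec d r f S)"
    using lie_algebra_commutator Y by blast
  then obtain r where r: "\<And>k a f S. k < N \<Longrightarrow> a < d \<Longrightarrow>
      Y k (clifford_gen a f) S = clifford_gen a (Y k f) S + cvec d (r k a) f S"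
    by metis
  have Xa: "X (clifford_gen a f) S = clifford_gen a (X f) S + (\<Sum>k<N. c k * cvec d (r k a) f S)"
    if "a < d" for a f S
    unfolding X using that
    by (simp add: r clinear_op_sum[OF clinear_op_gen] algebra_simps sum.distrib)
  have "X (cvec d b f) S = cvec d b (X f) S + cvec d (\<lambda>i. \<Sum>a<d. \<Sum>k<N. b a * c k * r k a i) f S"
    for f S
  proof -
    have "X (cvec d b f) S = (\<Sum>a<d. b a * X (clifford_gen a f) S)"
      unfolding cvec_def by (simp add: clinear_op_sum[OF complex_lie_algebra_linear[OF assms]])
    also have "\<dots> = cvec d b (X f) S + (\<Sum>a<d. \<Sum>k<N. b a * c k * cvec d (r k a) f S)"
      by (simp add: Xa distrib_left sum.distrib sum_distrib_left cvec_def mult.assoc)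
    also have "(\<Sum>a<d. \<Sum>k<N. b a * c k * cvec d (r k a) f S)
        = (\<Sum>a<d. \<Sum>k<N. \<Sum>i<d. b a * c k * r k a i * clifford_gen i f S)"
      by (simp add: cvec_def sum_distrib_left mult.assoc)
    also have "\<dots> = (\<Sum>a<d. \<Sum>i<d. \<Sum>k<N. b a * c k * r k a i * clifford_gen i f S)"
      by (intro sum.cong refl sum.swap)
    also have "\<dots> = (\<Sum>i<d. \<Sum>a<d. \<Sum>k<N. b a * c k * r k a i * clifford_gen i f S)"
      by (rule sum.swap)
    also have "\<dots> = cvec d (\<lambda>i. \<Sum>a<d. \<Sum>k<N. b a * c k * r k a i) f S"
      by (simp add: cvec_def sum_distrib_right)
    finally show ?thesis .
  qed
  then show ?thesis by blast
qed

lemma gen_comp_in_lie_algebra: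
  assumes "a < d" "b < d" "a \<noteq> b"
  shows "(\<lambda>f. clifford_gen a (clifford_gen b f)) \<in> lie_algebra (spin_group d)"
proof -
  define \<gamma> :: "real \<Rightarrow> nat set operator" where "\<gamma> s f =
    (\<lambda>S. of_real (cos s) * f S + of_real (sin s) * clifford_gen a (clifford_gen b f) S)" for s f
  have "\<gamma> s \<in> spin_group d" for s
  proof -
    \<comment> \<open>Because e_a squares to -1, the product of e_a with - cos s e_a + sin s e_b is
      cos s + sin s e_a e_b, which exhibits the curve as a product of two unit vectors.\<close>
    define v where "v i = (if i = a then 1 else (0::real))" for i
    define w where "w i = (if i = a then - cos s else 0) + (if i = b then sin s else 0)" for i
    have v: "clifford_vec d v f = clifford_gen a f" for f
      using cvec_single[OF assms(1), of 1 f]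
      by (simp add: clifford_vec_cvec v_def if_distrib cong: if_cong)
    have w: "clifford_vec d w f
        = (\<lambda>S. of_real (- cos s) * clifford_gen a f S + of_real (sin s) * clifford_gen b f S)" for f
    proof -
      have "(\<lambda>i. complex_of_real (w i)) = (\<lambda>i. 1 * (if i = a then of_real (- cos s) else 0)
          + (if i = b then of_real (sin s) else 0))"
        by (auto simp: w_def)
      then have "clifford_vec d w f S = 1 * cvec d (\<lambda>i. if i = a then of_real (- cos s) else 0) f S
          + cvec d (\<lambda>i. if i = b then of_real (sin s) else 0) f S" for S
        unfolding clifford_vec_cvec by (simp only: cvec_linear)
      then show ?thesis
        unfolding cvec_single[OF assms(1)] cvec_single[OF assms(2)] mult_1_left by (rule ext)
    qed
    have "(v i)\<^sup>2 = (if i = a then 1 else 0)"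
      "(w i)\<^sup>2 = (if i = a then (cos s)\<^sup>2 else 0) + (if i = b then (sin s)\<^sup>2 else 0)" for i
      using assms(3) by (auto simp: v_def w_def)
    then have "(\<Sum>i<d. (v i)\<^sup>2) = 1" "(\<Sum>i<d. (w i)\<^sup>2) = 1"
      using assms by (simp_all add: sum.distrib)
    moreover have "\<gamma> s = foldr (\<lambda>v g. clifford_vec d v \<circ> g) [v, w] id"
      by (simp add: fun_eq_iff v w \<gamma>_def clinear_op_diff[OF clinear_op_gen]
          clinear_op_scale[OF clinear_op_gen] clifford_gen_square)
    ultimately show ?thesis unfolding spin_group_def by (intro CollectI exI[of _ "[v, w]"]) simp
  qed
  moreover have "\<gamma> 0 = id" by (simp add: \<gamma>_def fun_eq_iff)
  moreover have "((\<lambda>s. \<gamma> s f S) has_vector_derivative clifford_gen a (clifford_gen b f) S) (at 0)"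
    for f S
  proof -
    have "((\<lambda>s. complex_of_real (cos s)) has_vector_derivative of_real 0) (at 0)"
      "((\<lambda>s. complex_of_real (sin s)) has_vector_derivative of_real 1) (at 0)"
      by (intro has_vector_derivative_of_real;
          auto simp flip: has_real_derivative_iff_has_vector_derivative intro!: derivative_eq_intros)+
    from has_vector_derivative_add[OF has_vector_derivative_mult_left[OF this(1), of "f S"]
        has_vector_derivative_mult_left[OF this(2), of "clifford_gen a (clifford_gen b f) S"]]
    show ?thesis by (simp add: \<gamma>_def)
  qed
  ultimately show ?thesis unfolding lie_algebra_def by blast
qed

section \<open>The roots\<close>

lemma cis_pairing_eq_one:
  assumes "x \<in> coords n" "\<And>t. t \<in> coords n \<Longrightarrow> cis (pairing n x t) = 1"
  shows "x = (\<lambda>_. 0)"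
proof
  fix j
  show "x j = 0"
  proof (rule ccontr)
    assume nz: "x j \<noteq> 0"
    have j: "j < n"
      by (rule ccontr) (use assms(1) nz in \<open>simp add: coords_iff\<close>)
    \<comment> \<open>The point on the \<open>j\<close>-th axis is scaled so that \<open>cis\<close>
      takes the value -1.\<close>
    have "pairing n x (\<lambda>i. if i = j then pi / x j else 0) = pi"
      using j nz by (simp add: pairing_def if_distrib[of "(*) _"] cong: if_cong)
    then show False using assms(2)[of "\<lambda>i. if i = j then pi / x j else 0"] j
      by (simp add: coords_iff)
  qed
qed

section \<open>Weight decomposition of complex vectors\<close>

lemma cvec_isotropic:
  assumes "j < n"
  shows "isotropic j \<delta> = cvec (2 * n)
    (\<lambda>i. if i = 2 * j then 1 else if i = 2 * j + 1 then - \<i> * \<delta> else 0)"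
proof (rule ext, rule ext)
  fix f S
  have jn: "2 * j < 2 * n" "2 * j + 1 < 2 * n" using assms by auto
  have "(\<lambda>i. if i = 2 * j then 1 else if i = 2 * j + 1 then - \<i> * \<delta> else 0)
     = (\<lambda>i. 1 * (if i = 2 * j then 1 else 0) + (if i = 2 * j + 1 then - \<i> * \<delta> else 0))"
    by auto
  then show "isotropic j \<delta> f S = cvec (2 * n)
    (\<lambda>i. if i = 2 * j then 1 else if i = 2 * j + 1 then - \<i> * \<delta> else 0) f S"
    by (simp only: cvec_linear cvec_single[OF jn(1)] cvec_single[OF jn(2)] isotropic_def) simp
qed

text \<open>The coordinate of \<open>\<Sum> c\<^sub>i e\<^sub>i\<close> along the weight vector of weight \<open>\<eta> e\<^sub>k\<close>, up to a factor.\<close>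

definition weight_coord :: "(nat \<Rightarrow> complex) \<Rightarrow> nat \<Rightarrow> real \<Rightarrow> complex" where
  "weight_coord c k \<eta> = c (2 * k) + \<i> * of_real \<eta> * c (2 * k + 1)"

lemma sum_pairs: "(\<Sum>i<2 * n. F i) = (\<Sum>k<n. F (2 * k) + F (2 * k + 1))"
  for F :: "nat \<Rightarrow> 'a :: comm_monoid_add"
  by (induction n) (simp_all add: add.assoc)

lemma cvec_weight_decomposition:
  "cvec (2 * n) c f S = (\<Sum>k<n. \<Sum>\<eta>\<in>{1,-1}. weight_coord c k \<eta> / 2 * isotropic k (of_real \<eta>) f S)"
  unfolding cvec_def sum_pairs weight_coord_def isotropic_def
  by (intro sum.cong refl) (simp add: field_simps)

lemma torus_cvec:
  "spin_torus n t (cvec (2 * n) c f) = (\<lambda>S. \<Sum>k<n. \<Sum>\<eta>\<in>{1,-1}.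
     cis (\<eta> * t k) * (weight_coord c k \<eta> / 2 * isotropic k (of_real \<eta>) (spin_torus n t f) S))"
proof -
  have "cvec (2 * n) c f = (\<lambda>S. \<Sum>k<n. 1 * (\<Sum>\<eta>\<in>{1,-1}. weight_coord c k \<eta> / 2 * isotropic k (of_real \<eta>) f S))"
    by (simp only: cvec_weight_decomposition[abs_def] mult_1_left)
  then have "spin_torus n t (cvec (2 * n) c f) = (\<lambda>S. \<Sum>k<n. 1 *
      spin_torus n t (\<lambda>S. \<Sum>\<eta>\<in>{1,-1}. weight_coord c k \<eta> / 2 * isotropic k (of_real \<eta>) f S) S)"
    by (simp only: clinear_op_sum[OF clinear_op_torus finite_lessThan])
  also have "\<dots> = (\<lambda>S. \<Sum>k<n. \<Sum>\<eta>\<in>{1,-1}.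
     cis (\<eta> * t k) * (weight_coord c k \<eta> / 2 * isotropic k (of_real \<eta>) (spin_torus n t f) S))"
  proof (unfold mult_1_left, rule ext, rule sum.cong[OF refl])
    fix S k assume k: "k \<in> {..<n}"
    have "spin_torus n t (isotropic k (of_real \<eta>) f) S
        = cis (\<eta> * t k) * isotropic k (of_real \<eta>) (spin_torus n t f) S" if "\<eta> \<in> {1,-1}" for \<eta>
      using torus_isotropic[of \<eta> k n t f] that k by auto
    then have "(\<Sum>\<eta>\<in>{1,-1}. weight_coord c k \<eta> / 2 * spin_torus n t (isotropic k (of_real \<eta>) f) S)
      = (\<Sum>\<eta>\<in>{1,-1}. cis (\<eta> * t k) * (weight_coord c k \<eta> / 2 * isotropic k (of_real \<eta>) (spin_torus n t f) S))"
      by (intro sum.cong refl) (simp only: mult.left_commute)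
    then show "spin_torus n t (\<lambda>S. \<Sum>\<eta>\<in>{1,-1}. weight_coord c k \<eta> / 2 * isotropic k (of_real \<eta>) f S) S
      = (\<Sum>\<eta>\<in>{1,-1}. cis (\<eta> * t k) * (weight_coord c k \<eta> / 2 * isotropic k (of_real \<eta>) (spin_torus n t f) S))"
      by (subst clinear_op_sum[OF clinear_op_torus]) auto
  qed
  finally show ?thesis .
qed

text \<open>For signs, \<open>1 + \<eta> * \<eta>'\<close> is 2 or 0, so this combination of
  coefficients is dual to the weight vectors; the 2 cancels the halves in
  \<open>cvec_weight_decomposition\<close>.\<close>

lemma isotropic_apply_singleton:
  "isotropic k (of_real \<eta>') (\<lambda>S. if S = {} then 1 else 0) {2 * l}
    + \<i> * of_real \<eta> * isotropic k (of_real \<eta>') (\<lambda>S. if S = {} then 1 else 0) {2 * l + 1}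
    = (if k = l then 1 + of_real (\<eta> * \<eta>') else 0)"
proof -
  have "2 * k + 1 \<noteq> 2 * l" "2 * k \<noteq> 2 * l + 1" by presburger+
  then show ?thesis
    unfolding isotropic_def clifford_gen_apply_singleton by (simp add: algebra_simps)
qed

text \<open>Evaluating both sides at the basis vector indexed by the empty set extracts the
  coordinates.\<close>

lemma torus_cvec_weight:
  assumes "spin_torus n t f = (\<lambda>S. if S = {} then 1 else 0)"
    and "spin_torus n t (cvec (2 * n) c f) = (\<lambda>S. z * cvec (2 * n) c (spin_torus n t f) S)"
    and "l < n" "\<eta> = 1 \<or> \<eta> = -1"
  shows "z * weight_coord c l \<eta> = cis (\<eta> * t l) * weight_coord c l \<eta>"
proof -
  let ?e = "\<lambda>S::nat set. if S = {} then 1 else (0::complex)"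
  let ?P = "\<lambda>g :: nat set \<Rightarrow> complex. g {2 * l} + \<i> * of_real \<eta> * g {2 * l + 1}"
  have "?P (\<lambda>S. z * cvec (2 * n) c ?e S) = z * ?P (cvec (2 * n) c ?e)"
    by (simp add: algebra_simps)
  also have "?P (cvec (2 * n) c ?e) = weight_coord c l \<eta>"
    using assms(3) unfolding weight_coord_def
    by (subst (1 2) cvec_apply_singleton) auto
  finally have 1: "?P (spin_torus n t (cvec (2 * n) c f)) = z * weight_coord c l \<eta>"
    using assms(1,2) by simp
  have "?P (spin_torus n t (cvec (2 * n) c f)) = (\<Sum>k<n. \<Sum>\<eta>'\<in>{1,-1}.
      cis (\<eta>' * t k) * (weight_coord c k \<eta>' / 2 * ?P (isotropic k (of_real \<eta>') ?e)))"
    unfolding torus_cvec assms(1) sum_distrib_left sum.distrib[symmetric]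
    by (intro sum.cong refl) (simp only: distrib_left mult_ac)
  also have "\<dots> = (\<Sum>k<n. if k = l then cis (\<eta> * t l) * weight_coord c l \<eta> else 0)"
    unfolding isotropic_apply_singleton using assms(4) by (intro sum.cong refl) auto
  also have "\<dots> = cis (\<eta> * t l) * weight_coord c l \<eta>"
    using assms(3) by simp
  finally show ?thesis unfolding 1 .
qed

section \<open>Identification of the root system\<close>

definition D_roots :: "nat \<Rightarrow> (nat \<Rightarrow> real) set" where
  "D_roots n = {\<lambda>i. \<delta> * unit_vec j i + \<delta>' * unit_vec k i | j k \<delta> \<delta>'.
     j < k \<and> k < n \<and> \<delta> \<in> {1,-1} \<and> \<delta>' \<in> {1,-1}}"

lemma D_rootsI:
  assumes "j \<noteq> k" "j < n" "k < n" "\<delta> \<in> {1,-1}" "\<delta>' \<in> {1,-1}"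
  shows "(\<lambda>i. \<delta> * unit_vec j i + \<delta>' * unit_vec k i) \<in> D_roots n"
proof (cases "j < k")
  case True
  then show ?thesis using assms unfolding D_roots_def by blast
next
  case False
  then have "(\<lambda>i. \<delta>' * unit_vec k i + \<delta> * unit_vec j i) \<in> D_roots n"
    using assms unfolding D_roots_def
    by (intro CollectI exI[of _ k] exI[of _ j] exI[of _ \<delta>'] exI[of _ \<delta>]) auto
  then show ?thesis by (simp add: add.commute)
qed

lemma pairing_unit_vec: "j < n \<Longrightarrow> pairing n (\<lambda>i. c * unit_vec j i) t = c * t j"
  by (simp add: pairing_def unit_vec_def if_distrib[of "(*) _"] if_distrib[of "\<lambda>x. x * _"] cong: if_cong)

lemma isotropic_square:
  assumes "\<delta> \<in> {1,-1}"
  shows "isotropic j (of_real \<delta>) (isotropic j (of_real \<delta>) f) = (\<lambda>S. 0)"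
proof
  fix S
  have "clifford_gen (2*j+1) (clifford_gen (2*j) f) = (\<lambda>S. - clifford_gen (2*j) (clifford_gen (2*j+1) f) S)"
    by (rule clifford_gen_anticommute) simp
  then show "isotropic j (of_real \<delta>) (isotropic j (of_real \<delta>) f) S = 0"
    using assms unfolding isotropic_def clinear_op_diff[OF clinear_op_gen]
      clinear_op_scale[OF clinear_op_gen] clifford_gen_square
    by (auto simp: right_diff_distrib)
qed

text \<open>The bilinear form pairs a weight with its negative. The anticommutator therefore sees
  precisely the component that would produce a root - 2 \<delta> e_j.\<close>

lemma isotropic_cvec_anticommutator:
  assumes "j < n"
  shows "isotropic j (of_real \<delta>) (cvec (2*n) c f) S + cvec (2*n) c (isotropic j (of_real \<delta>) f) S
     = - 2 * weight_coord c j (- \<delta>) * f S"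
proof -
  have "(\<Sum>i<2*n. (if i = 2 * j then 1 else if i = 2 * j + 1 then - \<i> * of_real \<delta> else 0) * c i)
     = (\<Sum>k<n. if k = j then weight_coord c j (- \<delta>) else 0)"
    unfolding sum_pairs by (intro sum.cong refl) (auto simp: weight_coord_def; presburger)
  also have "\<dots> = weight_coord c j (- \<delta>)" using assms by simp
  finally show ?thesis
    unfolding cvec_isotropic[OF assms] by (simp only: cvec_anticommutator)
qed

text \<open>The generators are combinations of isotropic vectors and the torus is built from the
  generators. This settles the case of an operator whose brackets with all weight vectors
  vanish.\<close>

lemma torus_commute:
  assumes "clinear_op X"
    and comm: "\<And>j \<delta> f. j < n \<Longrightarrow> \<delta> \<in> {1,-1} \<Longrightarrow>
      X (isotropic j (of_real \<delta>) f) = isotropic j (of_real \<delta>) (X f)"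
  shows "X (spin_torus n t f) = spin_torus n t (X f)"
proof -
  have even: "clifford_gen (2*j) f
      = (\<lambda>S. (1/2) * isotropic j (of_real 1) f S + (1/2) * isotropic j (of_real (-1)) f S)"
    and odd: "clifford_gen (2*j+1) f
      = (\<lambda>S. (\<i>/2) * isotropic j (of_real 1) f S + (-\<i>/2) * isotropic j (of_real (-1)) f S)" for j f
    by (simp_all add: isotropic_def fun_eq_iff field_simps)
  have "X (clifford_gen (2*j) f) = clifford_gen (2*j) (X f)"
    "X (clifford_gen (2*j+1) f) = clifford_gen (2*j+1) (X f)" if "j < n" for j f
    unfolding even odd clinear_opD[OF assms(1)] clinear_op_scale[OF assms(1)]
    using comm[OF that, of 1 f] comm[OF that, of "-1" f] by simp_all
  then have plane: "X (plane j f) = plane j (X f)" if "j < n" for j f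
    using that by (simp add: plane_def)
  have "set xs \<subseteq> {..<n} \<Longrightarrow> X (foldr (\<lambda>j. spin_rotation j (t j)) xs f)
      = foldr (\<lambda>j. spin_rotation j (t j)) xs (X f)" for xs
    by (induction xs) (simp_all add: rotation_intertwine[OF assms(1) plane])
  from this[of "[0..<n]"] show ?thesis by (simp add: spin_torus_foldr atLeast0LessThan)
qed

text \<open>Two cases. If the bracket of \<open>X\<close> with a vector of weight \<delta> e_j has a
  component of weight \<eta> e_l, comparing characters determines \<open>\<alpha>\<close>. If all
  such brackets vanish, \<open>X\<close> commutes with the torus and \<open>\<alpha>\<close> would
  be 0.\<close>

lemma roots_subset: "roots (spin_group (2 * n)) n (spin_torus n) \<subseteq> D_roots n"
proof
  fix \<alpha> assume "\<alpha> \<in> roots (spin_group (2 * n)) n (spin_torus n)"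
  then obtain \<xi> X where \<alpha>0: "\<alpha> \<noteq> (\<lambda>_. 0)" and diff: "has_differential n (spin_torus n) \<xi> \<alpha>"
    and X: "X \<in> complex_lie_algebra (spin_group (2 * n))" and X0: "X \<noteq> (\<lambda>f a. 0)"
    and h: "\<And>h. h \<in> torus n (spin_torus n) \<Longrightarrow> h \<circ> X = (\<lambda>f a. \<xi> h * X (h f) a)"
    unfolding roots_def by blast
  have \<alpha>c: "\<alpha> \<in> coords n" using diff by (simp add: has_differential_def)
  have lin: "clinear_op X" using complex_lie_algebra_linear[OF X] .
  have weight: "spin_torus n t (X f) = (\<lambda>a. cis (pairing n \<alpha> t) * X (spin_torus n t f) a)"
    if "t \<in> coords n" for t f
    using fun_cong[OF h[of "spin_torus n t"], of f] that diff
    by (auto simp: torus_def has_differential_def)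
  have "\<exists>c. \<forall>f S. X (isotropic j (of_real \<delta>) f) S = isotropic j (of_real \<delta>) (X f) S + cvec (2*n) c f S"
    if "j < n" for j \<delta>
    unfolding cvec_isotropic[OF that] by (rule complex_lie_algebra_commutator[OF X])
  then obtain C where "\<And>j \<delta> f S. j < n \<Longrightarrow> X (isotropic j (of_real \<delta>) f) S
      = isotropic j (of_real \<delta>) (X f) S + cvec (2*n) (C j \<delta>) f S"
    by metis
  then have C: "X (isotropic j (of_real \<delta>) f)
      = (\<lambda>S. isotropic j (of_real \<delta>) (X f) S + cvec (2*n) (C j \<delta>) f S)" if "j < n" for j \<delta> f
    using that by blast
  show "\<alpha> \<in> D_roots n"
  proof (cases "\<exists>j l \<delta> \<eta>. j < n \<and> l < n \<and> \<delta> \<in> {1,-1} \<and> \<eta> \<in> {1,-1} \<and> weight_coord (C j \<delta>) l \<eta> \<noteq> 0")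
    case True
    then obtain j l \<delta> \<eta> where j: "j < n" and l: "l < n" and \<delta>: "\<delta> \<in> {1,-1}" and \<eta>: "\<eta> \<in> {1,-1}"
      and nz: "weight_coord (C j \<delta>) l \<eta> \<noteq> 0" by blast
    let ?u = "isotropic j (of_real \<delta>)"
    let ?\<beta> = "\<lambda>i. \<eta> * unit_vec l i - \<delta> * unit_vec j i"
    have eq: "cis (pairing n \<alpha> t) * cis (\<delta> * t j) = cis (\<eta> * t l)" if t: "t \<in> coords n" for t
    proof -
      \<comment> \<open>\<open>f\<close> depends on \<open>t\<close>: it is chosen so that the
        identity, after the torus element is moved past the vector, is evaluated at the
        vacuum.\<close>
      obtain f where f: "spin_torus n t f = (\<lambda>S. if S = {} then 1 else 0)"
        using surj_torus[of n t] by (metis surjD)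
      let ?\<tau> = "spin_torus n t"
      have u: "?\<tau> (?u g) = (\<lambda>S. cis (\<delta> * t j) * ?u (?\<tau> g) S)" for g
        using torus_isotropic[of \<delta> j n t g] \<delta> j by auto
      have "cvec (2*n) (C j \<delta>) f = (\<lambda>S. X (?u f) S - ?u (X f) S)"
        using C[OF j, of \<delta> f] by simp
      then have "?\<tau> (cvec (2*n) (C j \<delta>) f) = (\<lambda>S. ?\<tau> (X (?u f)) S - ?\<tau> (?u (X f)) S)"
        by (simp add: clinear_op_diff[OF clinear_op_torus])
      also have "\<dots> = (\<lambda>S. cis (pairing n \<alpha> t) * cis (\<delta> * t j) * (X (?u (?\<tau> f)) S - ?u (X (?\<tau> f)) S))"
        by (simp add: weight[OF t] u clinear_op_scale[OF lin] clinear_op_scale[OF clinear_op_isotropic]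
            algebra_simps)
      also have "\<dots> = (\<lambda>S. cis (pairing n \<alpha> t) * cis (\<delta> * t j) * cvec (2*n) (C j \<delta>) (?\<tau> f) S)"
        using C[OF j, of \<delta> "?\<tau> f"] by simp
      finally have "cis (pairing n \<alpha> t) * cis (\<delta> * t j) * weight_coord (C j \<delta>) l \<eta>
          = cis (\<eta> * t l) * weight_coord (C j \<delta>) l \<eta>"
        using torus_cvec_weight[OF f _ l] \<eta> by blast
      then show ?thesis using nz by simp
    qed
    have "cis (pairing n (\<lambda>i. \<alpha> i - ?\<beta> i) t) = 1" if t: "t \<in> coords n" for t
    proof -
      have "pairing n (\<lambda>i. \<alpha> i - ?\<beta> i) t
          = pairing n \<alpha> t + pairing n (\<lambda>i. \<delta> * unit_vec j i) t - pairing n (\<lambda>i. \<eta> * unit_vec l i) t"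
        by (simp add: pairing_def algebra_simps sum.distrib sum_subtractf)
      then have "pairing n (\<lambda>i. \<alpha> i - ?\<beta> i) t = pairing n \<alpha> t + \<delta> * t j - \<eta> * t l"
        by (simp add: pairing_unit_vec j l)
      then show ?thesis using eq[OF t] by (simp add: cis_mult flip: cis_divide)
    qed
    moreover have "(\<lambda>i. \<alpha> i - ?\<beta> i) \<in> coords n"
      using \<alpha>c j l by (auto simp: coords_iff unit_vec_def)
    ultimately have "(\<lambda>i. \<alpha> i - ?\<beta> i) = (\<lambda>_. 0)" using cis_pairing_eq_one by blast
    then have \<alpha>: "\<alpha> = ?\<beta>" by (simp add: fun_eq_iff)
    have "j \<noteq> l"
    proof
      assume "j = l"
      then have "\<delta> \<noteq> \<eta>" using \<alpha> \<alpha>0 by auto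
      then have \<eta>\<delta>: "\<eta> = - \<delta>" using \<delta> \<eta> by auto
      \<comment> \<open>Applying \<open>X\<close> to \<open>?u (?u ?f)\<close>, which is 0, leaves
        the anticommutator of \<open>?u\<close> with its own bracket. It is a scalar multiple of the
        identity, so a form not vanishing at \<open>{}\<close> shows that the scalar is 0.\<close>
      let ?f = "\<lambda>S :: nat set. 1 :: complex"
      have "X (?u (?u ?f)) {} = ?u (?u (X ?f)) {}
          + (?u (cvec (2*n) (C j \<delta>) ?f) {} + cvec (2*n) (C j \<delta>) (?u ?f) {})"
        by (simp add: C[OF j] clinear_op_add[OF clinear_op_isotropic])
      then have "weight_coord (C j \<delta>) j (- \<delta>) = 0"
        using \<delta> unfolding isotropic_cvec_anticommutator[OF j]
        by (simp add: isotropic_square[OF \<delta>] clinear_op_zero[OF lin])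
      then show False using nz \<open>j = l\<close> \<eta>\<delta> by simp
    qed
    have "(\<lambda>i. \<eta> * unit_vec l i + (- \<delta>) * unit_vec j i) \<in> D_roots n"
    proof (rule D_rootsI)
      show "- \<delta> \<in> {1, -1}" using \<delta> by auto
    qed (use \<open>j \<noteq> l\<close> j l \<eta> in simp_all)
    then show ?thesis unfolding \<alpha> by simp
  next
    case False
    then have zero: "weight_coord (C j \<delta>) k \<eta> = 0"
      if "j < n" "\<delta> \<in> {1,-1}" "k < n" "\<eta> \<in> {1,-1}" for j \<delta> k \<eta>
      using that by blast
    have "cvec (2*n) (C j \<delta>) f S = 0" if "j < n" "\<delta> \<in> {1,-1}" for j \<delta> f S
      unfolding cvec_weight_decomposition
      by (intro sum.neutral ballI) (simp only: zero[OF that] lessThan_iff div_0 mult_zero_left)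
    then have "X (isotropic j (of_real \<delta>) f) = isotropic j (of_real \<delta>) (X f)"
      if "j < n" "\<delta> \<in> {1,-1}" for j \<delta> f
      using that C[OF that(1), of \<delta> f] by simp
    then have comm: "X (spin_torus n t f) = spin_torus n t (X f)" for t f
      using torus_commute[OF lin] by blast
    obtain f S where fS: "X f S \<noteq> 0" using X0 by (auto simp: fun_eq_iff)
    have "cis (pairing n \<alpha> t) = 1" if t: "t \<in> coords n" for t
    proof -
      obtain g where g: "f = spin_torus n t g" using surj_torus[of n t] by (metis surjD)
      have "X f S = cis (pairing n \<alpha> t) * X f S"
        using fun_cong[OF weight[OF t, of g], of S] by (simp add: g comm)
      then show ?thesis using fS by simp
    qed
    then have "\<alpha> = (\<lambda>_. 0)" using cis_pairing_eq_one[OF \<alpha>c] by blast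
    then show ?thesis using \<alpha>0 by simp
  qed
qed

lemma D_roots_subset: "D_roots n \<subseteq> roots (spin_group (2 * n)) n (spin_torus n)"
proof
  fix \<alpha> assume "\<alpha> \<in> D_roots n"
  then obtain j k \<delta> \<delta>' where jk: "j < k" "k < n" and s: "\<delta> \<in> {1,-1}" "\<delta>' \<in> {1,-1}"
    and \<alpha>: "\<alpha> = (\<lambda>i. \<delta> * unit_vec j i + \<delta>' * unit_vec k i)"
    by (auto simp: D_roots_def)
  have "\<alpha> j = \<delta>" using jk by (simp add: \<alpha> unit_vec_def)
  then have \<alpha>0: "\<alpha> \<noteq> (\<lambda>_. 0)" using s by auto
  have "\<alpha> \<in> weight_lattice n (spin_torus n)"
    using jk s by (intro integral_in_lattice) (auto simp: \<alpha> coords_iff unit_vec_def)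
  then obtain \<xi> where \<xi>: "\<xi> \<in> characters (torus n (spin_torus n))"
    and diff: "has_differential n (spin_torus n) \<xi> \<alpha>"
    by (auto simp: weight_lattice_def)
  \<comment> \<open>A product of weight vectors from different planes has the sum of their weights.
    It expands into four products of distinct generators, each tangent to the group.\<close>
  define X where "X f = isotropic j (of_real \<delta>) (isotropic k (of_real \<delta>') f)" for f
  have "X \<in> complex_lie_algebra (spin_group (2 * n))"
  proof -
    define c where "c = [1, - \<i> * of_real \<delta>', - \<i> * of_real \<delta>, - of_real (\<delta> * \<delta>') :: complex]"
    define Y :: "nat set operator list" where "Y = [\<lambda>f. clifford_gen (2*j) (clifford_gen (2*k) f),
      \<lambda>f. clifford_gen (2*j) (clifford_gen (2*k+1) f),
      \<lambda>f. clifford_gen (2*j+1) (clifford_gen (2*k) f),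
      \<lambda>f. clifford_gen (2*j+1) (clifford_gen (2*k+1) f)]"
    have "Y ! i \<in> lie_algebra (spin_group (2 * n))" if "i < 4" for i
    proof -
      have "i = 0 \<or> i = 1 \<or> i = 2 \<or> i = 3" using that by auto
      moreover have "Suc (2 * j) \<noteq> 2 * k" "2 * j \<noteq> Suc (2 * k)" by presburger+
      ultimately show ?thesis unfolding Y_def using jk
        by (elim disjE) (simp_all add: gen_comp_in_lie_algebra)
    qed
    moreover have "X = (\<lambda>f a. \<Sum>i<4. c ! i * (Y ! i) f a)"
      by (simp add: X_def fun_eq_iff isotropic_def clinear_op_diff[OF clinear_op_gen]
          clinear_op_scale[OF clinear_op_gen] c_def Y_def numeral_eq_Suc lessThan_Suc algebra_simps)
    ultimately show ?thesis unfolding complex_lie_algebra_def by blast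
  qed
  moreover have "X \<noteq> (\<lambda>f a. 0)"
  proof -
    \<comment> \<open>At \<open>{2*j, 2*k}\<close> only one of the four products applied to the
      vacuum has a nonzero value, so nothing can cancel.\<close>
    let ?e = "\<lambda>S::nat set. if S = {} then 1 else (0::complex)"
    let ?S = "{2*j, 2*k}"
    have ne: "Suc (2 * j) \<noteq> 2 * k" "2 * j \<noteq> Suc (2 * k)" by presburger+
    have off: "clifford_gen a (clifford_gen b ?e) ?S = 0" if "x \<in> toggle b (toggle a ?S)" for a b x
      using that by (auto simp: clifford_gen_toggle)
    have "clifford_gen (2*j) (clifford_gen (2*k+1) ?e) ?S = 0"
      by (rule off[of "2*k+1"]) (use jk ne in \<open>simp add: mem_toggle\<close>)
    moreover have "clifford_gen (2*j+1) (clifford_gen (2*k) ?e) ?S = 0"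
      by (rule off[of "2*j+1"]) (use jk ne in \<open>simp add: mem_toggle\<close>)
    moreover have "clifford_gen (2*j+1) (clifford_gen (2*k+1) ?e) ?S = 0"
      by (rule off[of "2*j+1"]) (use jk ne in \<open>simp add: mem_toggle\<close>)
    moreover have "toggle (2*k) (toggle (2*j) ?S) = {}"
      using jk by (auto simp: toggle_def)
    then have "clifford_gen (2*j) (clifford_gen (2*k) ?e) ?S
        = gen_sign (2*j) ?S * gen_sign (2*k) (toggle (2*j) ?S)"
      by (simp add: clifford_gen_toggle)
    ultimately have "X ?e ?S = gen_sign (2*j) ?S * gen_sign (2*k) (toggle (2*j) ?S)"
      by (simp add: X_def isotropic_def clinear_op_diff[OF clinear_op_gen]
          clinear_op_scale[OF clinear_op_gen])
    then show ?thesis by (metis gen_sign_nonzero mult_eq_0_iff)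
  qed
  moreover have "h \<circ> X = (\<lambda>f a. \<xi> h * X (h f) a)" if hT: "h \<in> torus n (spin_torus n)" for h
  proof -
    obtain t where t: "t \<in> coords n" and h: "h = spin_torus n t"
      using hT unfolding torus_def by blast
    have "pairing n \<alpha> t = \<delta> * t j + \<delta>' * t k"
      using jk unfolding \<alpha> pairing_add by (simp add: pairing_unit_vec)
    then have "\<xi> h = cis (\<delta> * t j) * cis (\<delta>' * t k)"
      using diff t by (simp add: has_differential_def h cis_mult)
    moreover have "h (isotropic j (of_real \<delta>) g) = (\<lambda>S. cis (\<delta> * t j) * isotropic j (of_real \<delta>) (h g) S)"
      "h (isotropic k (of_real \<delta>') g) = (\<lambda>S. cis (\<delta>' * t k) * isotropic k (of_real \<delta>') (h g) S)" for g
      unfolding h using s jk by (intro torus_isotropic; auto)+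
    ultimately show ?thesis
      by (intro ext) (simp add: X_def clinear_op_scale[OF clinear_op_isotropic])
  qed
  ultimately show "\<alpha> \<in> roots (spin_group (2 * n)) n (spin_torus n)"
    unfolding roots_def using \<alpha>0 \<xi> diff by blast
qed

lemma roots_spin: "roots (spin_group (2 * n)) n (spin_torus n) = D_roots n"
  using roots_subset D_roots_subset by blast

section \<open>The normalised inner product\<close>

text \<open>Taking \<open>W\<close> to be an involution makes one intertwining relation give both
  inclusions of the normalizer condition. Preservation of \<open>pairing\<close> lets the same
  \<open>W\<close> act on the Lie algebra of the torus and on weights.\<close>

lemma weyl_invariantD:
  assumes inv: "weyl_invariant (spin_group (2 * n)) n (spin_torus n) ip"
    and g: "g \<in> spin_group (2 * n)"
    and W: "\<And>t. t \<in> coords n \<Longrightarrow> W t \<in> coords n" "\<And>t. W (W t) = t"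
    and conj: "\<And>t f. t \<in> coords n \<Longrightarrow> g (spin_torus n t f) = spin_torus n (W t) (g f)"
    and pair: "\<And>x t. pairing n (W x) (W t) = pairing n x t"
    and L: "x \<in> weight_lattice n (spin_torus n)" "y \<in> weight_lattice n (spin_torus n)"
      "W x \<in> weight_lattice n (spin_torus n)" "W y \<in> weight_lattice n (spin_torus n)"
  shows "ip (W x) (W y) = ip x y"
proof -
  let ?T = "torus n (spin_torus n)"
  have comp: "g \<circ> spin_torus n t = spin_torus n (W t) \<circ> g" if "t \<in> coords n" for t
    using conj[OF that] by (simp add: fun_eq_iff)
  have comp': "spin_torus n t \<circ> g = g \<circ> spin_torus n (W t)" if "t \<in> coords n" for t
    using comp[OF W(1)[OF that]] by (simp add: W(2))
  have "(\<lambda>h. g \<circ> h) ` ?T = (\<lambda>h. h \<circ> g) ` ?T"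
  proof (intro antisym subsetI)
    fix k assume "k \<in> (\<lambda>h. g \<circ> h) ` ?T"
    then obtain t where "t \<in> coords n" "k = g \<circ> spin_torus n t" unfolding torus_def by blast
    then show "k \<in> (\<lambda>h. h \<circ> g) ` ?T" using comp[of t] W(1)[of t] unfolding torus_def by blast
  next
    fix k assume "k \<in> (\<lambda>h. h \<circ> g) ` ?T"
    then obtain t where "t \<in> coords n" "k = spin_torus n t \<circ> g" unfolding torus_def by blast
    then show "k \<in> (\<lambda>h. g \<circ> h) ` ?T" using comp'[of t] W(1)[of t] unfolding torus_def by blast
  qed
  then have norm: "g \<in> normalizer (spin_group (2 * n)) ?T"
    using g by (simp add: normalizer_def)
  have wc: "weyl_conjugate ?T g \<xi> \<xi>'"
    if d: "has_differential n (spin_torus n) \<xi> x" "has_differential n (spin_torus n) \<xi>' (W x)" for \<xi> \<xi>' x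
    unfolding weyl_conjugate_def
  proof (intro ballI impI)
    fix h k assume h: "h \<in> ?T" and eq: "g \<circ> h = k \<circ> g"
    obtain t where t: "t \<in> coords n" "h = spin_torus n t" using h unfolding torus_def by blast
    \<comment> \<open>Surjectivity of \<open>g\<close> then cancels it on the right and determines
      \<open>k\<close>.\<close>
    have "k (g f) = spin_torus n (W t) (g f)" for f
      using fun_cong[OF eq, of f] conj[OF t(1), of f] by (simp add: t)
    then have k: "k = spin_torus n (W t)"
      using surj_spin_group[OF g] by (metis ext surjD)
    show "\<xi>' k = \<xi> h"
      using d t W(1)[OF t(1)] by (simp add: k has_differential_def pair)
  qed
  obtain \<xi> \<xi>' \<eta> \<eta>' where
    "\<xi> \<in> characters ?T" "has_differential n (spin_torus n) \<xi> x"
    "\<xi>' \<in> characters ?T" "has_differential n (spin_torus n) \<xi>' (W x)"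
    "\<eta> \<in> characters ?T" "has_differential n (spin_torus n) \<eta> y"
    "\<eta>' \<in> characters ?T" "has_differential n (spin_torus n) \<eta>' (W y)"
    using L unfolding weight_lattice_def by blast
  then show ?thesis
    using inv norm wc[of \<xi> x \<xi>'] wc[of \<eta> y \<eta>'] unfolding weyl_invariant_def by blast
qed

lemma rotation_intertwine_minus:
  assumes "clinear_op h" "\<And>f. h (plane j f) = (\<lambda>S. - plane k (h f) S)"
  shows "h (spin_rotation j s f) = spin_rotation k (- s) (h f)"
  by (simp add: spin_rotation_plane clinear_opD[OF assms(1)] clinear_op_scale[OF assms(1)] assms(2))

lemma clifford_gen_as_vec:
  assumes "a < d"
  shows "clifford_gen a = clifford_vec d (unit_vec a)"
proof
  fix f
  have "(\<lambda>i. complex_of_real (unit_vec a i)) = (\<lambda>i. if i = a then 1 else 0)"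
    by (auto simp: unit_vec_def)
  then show "clifford_gen a f = clifford_vec d (unit_vec a) f"
    using cvec_single[OF assms, of 1 f] by (simp add: clifford_vec_cvec)
qed

lemma spin_group_pair:
  assumes "(\<Sum>i<d. (v i)\<^sup>2) = 1" "(\<Sum>i<d. (w i)\<^sup>2) = 1"
  shows "clifford_vec d v \<circ> clifford_vec d w \<in> spin_group d"
  unfolding spin_group_def using assms by (intro CollectI exI[of _ "[v, w]"]) simp

lemma unit_vec_norm: "a < d \<Longrightarrow> (\<Sum>i<d. (unit_vec a i)\<^sup>2) = 1"
  by (simp add: unit_vec_def if_distrib[of "\<lambda>x. x\<^sup>2"] cong: if_cong)

lemma gen_even_plane_commute:
  "clifford_gen (2*j) (plane i f) = (if i = j then (\<lambda>S. - plane i (clifford_gen (2*j) f) S)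
     else plane i (clifford_gen (2*j) f))"
proof (cases "i = j")
  case True
  then show ?thesis by (simp add: gen_even_plane plane_gen_even)
next
  case False
  then have "2 * j \<noteq> 2 * i" "2 * j \<noteq> 2 * i + 1" by presburger+
  then show ?thesis using False by (simp add: plane_commute_gen)
qed

section \<open>Weyl group elements and the form they preserve\<close>

text \<open>Each generator reverses the bivector of its own plane and commutes with the other
  bivectors. Membership in the spin group requires an even number of factors, so two coordinates are
  reversed together.\<close>

lemma inner_product_sign_change:
  assumes inv: "weyl_invariant (spin_group (2 * n)) n (spin_torus n) ip"
    and jk: "j < n" "k < n" "j \<noteq> k"
    and W: "W = (\<lambda>x i. if i = j \<or> i = k then - x i else (x i :: real))"
    and L: "x \<in> weight_lattice n (spin_torus n)" "y \<in> weight_lattice n (spin_torus n)"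
      "W x \<in> weight_lattice n (spin_torus n)" "W y \<in> weight_lattice n (spin_torus n)"
  shows "ip (W x) (W y) = ip x y"
proof (rule weyl_invariantD[OF inv _ _ _ _ _ L])
  let ?g = "clifford_gen (2*j) \<circ> clifford_gen (2*k)"
  have lt: "2 * j < 2 * n" "2 * k < 2 * n" using jk by auto
  show "?g \<in> spin_group (2 * n)"
    unfolding clifford_gen_as_vec[OF lt(1)] clifford_gen_as_vec[OF lt(2)]
    by (intro spin_group_pair unit_vec_norm lt)
  show "W t \<in> coords n" if "t \<in> coords n" for t
    using that jk by (auto simp: W coords_iff)
  show "W (W t) = t" for t by (auto simp: W)
  show "pairing n (W x) (W t) = pairing n x t" for x t
    unfolding pairing_def by (intro sum.cong refl) (simp add: W)
  have lin: "clinear_op ?g" by (intro clinear_op_comp clinear_op_gen)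
  have plane: "?g (plane i f) = (if i = j \<or> i = k then (\<lambda>S. - plane i (?g f) S) else plane i (?g f))"
    for i f
    using jk(3) by (auto simp: gen_even_plane_commute clinear_op_minus[OF clinear_op_gen])
  have rot: "?g (spin_rotation i (t i) f) = spin_rotation i (W t i) (?g f)" for i t f
  proof (cases "i = j \<or> i = k")
    case True
    have "?g (spin_rotation i (t i) f) = spin_rotation i (- t i) (?g f)"
      using plane[of i] True by (intro rotation_intertwine_minus[OF lin]) simp
    then show ?thesis using True by (simp add: W)
  next
    case False
    have "?g (spin_rotation i (t i) f) = spin_rotation i (t i) (?g f)"
      using plane[of i] False by (intro rotation_intertwine[OF lin]) simp
    then show ?thesis using False by (simp add: W)
  qed
  have "?g (foldr (\<lambda>j. spin_rotation j (t j)) xs f) = foldr (\<lambda>j. spin_rotation j (W t j)) xs (?g f)" for xs t f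
  proof (induction xs)
    case (Cons i xs)
    then show ?case using rot[of i t "foldr (\<lambda>j. spin_rotation j (t j)) xs f"] by simp
  qed simp
  then show "?g (spin_torus n t f) = spin_torus n (W t) (?g f)" for t f
    by (simp only: spin_torus_foldr)
qed

text \<open>The unit normal of the mirror that exchanges the axes \<open>a\<close> and
  \<open>b\<close>.\<close>

definition swap_vec :: "nat \<Rightarrow> nat \<Rightarrow> nat \<Rightarrow> real" where
  "swap_vec a b i = (unit_vec a i - unit_vec b i) / sqrt 2"

lemma swap_vec_norm:
  assumes "a < d" "b < d" "a \<noteq> b"
  shows "(\<Sum>i<d. (swap_vec a b i)\<^sup>2) = 1"
proof -
  have "(swap_vec a b i)\<^sup>2 = ((unit_vec a i)\<^sup>2 + (unit_vec b i)\<^sup>2) / 2" for i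
    using assms(3) by (auto simp: swap_vec_def power_divide unit_vec_def)
  then have "(\<Sum>i<d. (swap_vec a b i)\<^sup>2) = (\<Sum>i<d. ((unit_vec a i)\<^sup>2 + (unit_vec b i)\<^sup>2) / 2)"
    by (simp only:)
  also have "\<dots> = 1"
    using unit_vec_norm[OF assms(1)] unit_vec_norm[OF assms(2)]
    by (simp add: sum.distrib flip: sum_divide_distrib)
  finally show ?thesis .
qed

lemma clifford_vec_swap:
  assumes "a < d" "b < d"
  shows "clifford_vec d (swap_vec a b) f
    = (\<lambda>S. complex_of_real (1 / sqrt 2) * (clifford_gen a f S - clifford_gen b f S))"
proof
  fix S
  have "clifford_gen c f S = (\<Sum>i<d. of_real (unit_vec c i) * clifford_gen i f S)" if "c < d" for c
    using fun_cong[OF fun_cong[OF clifford_gen_as_vec[OF that], of f], of S]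
    by (simp add: clifford_vec_def)
  then show "clifford_vec d (swap_vec a b) f S
      = complex_of_real (1 / sqrt 2) * (clifford_gen a f S - clifford_gen b f S)"
    using assms by (simp add: clifford_vec_def swap_vec_def sum_divide_distrib
        diff_divide_distrib left_diff_distrib sum_subtractf)
qed

text \<open>Conjugation by a vector is minus the reflection, which explains the sign; it disappears
  when two such vectors are composed.\<close>

lemma swap_vec_gen:
  assumes "a < d" "b < d" "a \<noteq> b"
  shows "clifford_vec d (swap_vec a b) (clifford_gen c f)
    = (\<lambda>S. - clifford_gen (Transposition.transpose a b c) (clifford_vec d (swap_vec a b) f) S)"
  unfolding clifford_vec_swap[OF assms(1,2)] clinear_op_scale[OF clinear_op_gen]
    clinear_op_diff[OF clinear_op_gen]
  using assms(3) clifford_gen_anticommute[of a b f] clifford_gen_anticommute[of a c f]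
    clifford_gen_anticommute[of b c f]
  by (cases "c = a"; cases "c = b") (auto simp: clifford_gen_square Transposition.transpose_def
      fun_eq_iff diff_divide_distrib add_divide_distrib)

text \<open>Conjugation by a swap delivers the rotations of the torus in permuted order; since they
  commute, the original order can be restored.\<close>

lemma foldr_commuting_permuted:
  assumes "\<And>x y. F x \<circ> F y = F y \<circ> F x" "mset xs = mset ys"
  shows "foldr F xs = foldr F ys"
  unfolding foldr_conv_fold using assms by (intro fold_multiset_equiv) simp_all

text \<open>One reflection exchanges the even axes and the other the odd axes of the two planes.
  Their minus signs cancel, and each bivector goes to the other without a sign, so angles are
  permuted but not reversed.\<close>

lemma inner_product_swap:
  assumes inv: "weyl_invariant (spin_group (2 * n)) n (spin_torus n) ip"
    and jk: "j < n" "k < n" "j \<noteq> k"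
    and L: "x \<in> weight_lattice n (spin_torus n)" "y \<in> weight_lattice n (spin_torus n)"
      "x \<circ> Transposition.transpose j k \<in> weight_lattice n (spin_torus n)"
      "y \<circ> Transposition.transpose j k \<in> weight_lattice n (spin_torus n)"
  shows "ip (x \<circ> Transposition.transpose j k) (y \<circ> Transposition.transpose j k) = ip x y"
proof (rule weyl_invariantD[where W = "\<lambda>x. x \<circ> Transposition.transpose j k", OF inv _ _ _ _ _ L])
  let ?u = "clifford_vec (2*n) (swap_vec (2*j) (2*k))"
  let ?v = "clifford_vec (2*n) (swap_vec (2*j+1) (2*k+1))"
  let ?g = "?u \<circ> ?v"
  let ?p = "Transposition.transpose j k"
  have lt: "2*j < 2*n" "2*k < 2*n" "2*j \<noteq> 2*k" "2*j+1 < 2*n" "2*k+1 < 2*n" "2*j+1 \<noteq> 2*k+1"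
    using jk by auto
  show "?g \<in> spin_group (2 * n)"
    by (intro spin_group_pair swap_vec_norm lt)
  show "t \<circ> ?p \<in> coords n" if "t \<in> coords n" for t :: "nat \<Rightarrow> real"
    using that jk by (auto simp: coords_iff Transposition.transpose_def)
  show "t \<circ> ?p \<circ> ?p = t" for t :: "nat \<Rightarrow> real" by (simp add: fun_eq_iff)
  have bij: "bij_betw ?p {..<n} {..<n}"
    using jk by (intro bij_betwI[where g = ?p]) (auto simp: Transposition.transpose_def)
  show "pairing n (x \<circ> ?p) (t \<circ> ?p) = pairing n x t" for x t
    unfolding pairing_def using sum.reindex_bij_betw[OF bij, of "\<lambda>i. x i * t i"] by simp
  have lin: "clinear_op ?u" "clinear_op ?v" "clinear_op ?g"
    by (simp_all only: clifford_vec_cvec clinear_op_comp clinear_op_cvec)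
  have even: "?g (clifford_gen (2*i) f) = clifford_gen (2 * ?p i) (?g f)" for i f
  proof -
    have "Transposition.transpose (2*j+1) (2*k+1) (2*i) = 2*i" "Transposition.transpose (2*j) (2*k) (2*i) = 2 * ?p i"
      by (auto simp: Transposition.transpose_def; presburger)+
    then show ?thesis
      by (simp only: o_apply swap_vec_gen[OF lt(1-3)] swap_vec_gen[OF lt(4-6)]
          clinear_op_minus[OF lin(1)] minus_minus)
  qed
  have odd: "?g (clifford_gen (2*i+1) f) = clifford_gen (2 * ?p i + 1) (?g f)" for i f
  proof -
    have "Transposition.transpose (2*j+1) (2*k+1) (2*i+1) = 2 * ?p i + 1"
      "Transposition.transpose (2*j) (2*k) (2 * ?p i + 1) = 2 * ?p i + 1"
      by (auto simp: Transposition.transpose_def; presburger)+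
    then show ?thesis
      by (simp only: o_apply swap_vec_gen[OF lt(1-3)] swap_vec_gen[OF lt(4-6)]
          clinear_op_minus[OF lin(1)] minus_minus)
  qed
  have plane: "?g (plane i f) = plane (?p i) (?g f)" for i f
    unfolding plane_def by (simp only: even odd)
  have rot: "?g (spin_rotation i s f) = spin_rotation (?p i) s (?g f)" for i s f
    by (rule rotation_intertwine[OF lin(3) plane])
  show "?g (spin_torus n t f) = spin_torus n (t \<circ> ?p) (?g f)" for t f
  proof -
    have "?g (foldr (\<lambda>i. spin_rotation i (t i)) xs f)
        = foldr (\<lambda>i. spin_rotation i ((t \<circ> ?p) i)) (map ?p xs) (?g f)" for xs
    proof (induction xs)
      case (Cons i xs)
      then show ?case using rot[of i "t i" "foldr (\<lambda>i. spin_rotation i (t i)) xs f"] by simp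
    qed simp
    moreover have "foldr (\<lambda>i. spin_rotation i ((t \<circ> ?p) i)) (map ?p [0..<n])
        = foldr (\<lambda>i. spin_rotation i ((t \<circ> ?p) i)) [0..<n]"
    proof (rule foldr_commuting_permuted)
      show "spin_rotation x r \<circ> spin_rotation y s = spin_rotation y s \<circ> spin_rotation x r" for x y r s
        by (simp add: fun_eq_iff rotation_commute[of x r y s])
      have "distinct (map ?p [0..<n])" "set (map ?p [0..<n]) = set [0..<n]"
        using bij by (auto simp: distinct_map bij_betw_def atLeast0LessThan)
      then show "mset (map ?p [0..<n]) = mset [0..<n]"
        using set_eq_iff_mset_eq_distinct distinct_upt by blast
    qed
    ultimately show ?thesis by (simp only: spin_torus_foldr)
  qed
qed

lemma inner_product_linear:
  assumes "inner_product_on n ip" "x \<in> coords n" "y \<in> coords n" "z \<in> coords n"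
  shows "ip (\<lambda>i. c * x i + y i) z = c * ip x z + ip y z"
  using assms unfolding inner_product_on_def by blast

lemma zero_coords: "(\<lambda>_. 0) \<in> coords n"
  by (simp add: coords_iff)

lemma inner_product_zero:
  assumes "inner_product_on n ip" "z \<in> coords n"
  shows "ip (\<lambda>_. 0) z = 0"
  using inner_product_linear[OF assms(1) zero_coords zero_coords assms(2), of 1] by simp

lemma inner_product_expand:
  assumes ip: "inner_product_on n ip" and x: "x \<in> coords n" and z: "z \<in> coords n"
  shows "ip x z = (\<Sum>j<n. x j * ip (unit_vec j) z)"
proof -
  have "k \<le> n \<Longrightarrow> ip (\<lambda>i. if i < k then x i else 0) z = (\<Sum>j<k. x j * ip (unit_vec j) z)" for k
  proof (induction k)
    case 0
    show ?case using inner_product_zero[OF ip z] by simp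
  next
    case (Suc k)
    have "(\<lambda>i. if i < Suc k then x i else 0) = (\<lambda>i. x k * unit_vec k i + (if i < k then x i else 0))"
      by (auto simp: unit_vec_def less_Suc_eq)
    moreover have "unit_vec k \<in> coords n" "(\<lambda>i. if i < k then x i else 0) \<in> coords n"
      using Suc.prems by (auto simp: coords_iff unit_vec_def)
    ultimately show ?case
      using Suc inner_product_linear[OF ip, of "unit_vec k" "\<lambda>i. if i < k then x i else 0" z "x k"] z
      by simp
  qed
  moreover have "(\<lambda>i. if i < n then x i else 0) = x"
    using x by (auto simp: coords_iff fun_eq_iff)
  ultimately show ?thesis by (metis order_refl)
qed

lemma basic_inner_product_eq_pairing:
  assumes n: "n > 2" and basic: "basic_inner_product (spin_group (2 * n)) n (spin_torus n) ip"
    and x: "x \<in> coords n" and y: "y \<in> coords n"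
  shows "ip x y = pairing n x y"
proof -
  have ip: "inner_product_on n ip" and inv: "weyl_invariant (spin_group (2 * n)) n (spin_torus n) ip"
    and long: "\<And>u. u \<in> long_roots (spin_group (2 * n)) n (spin_torus n) ip \<Longrightarrow> ip u u = 2"
    using basic by (auto simp: basic_inner_product_def)
  have scale: "ip (\<lambda>i. c * x i) z = c * ip x z" if "x \<in> coords n" "z \<in> coords n" for c x z
    using inner_product_linear[OF ip that(1) zero_coords that(2), of c]
      inner_product_zero[OF ip that(2)] by simp
  have sym: "ip x z = ip z x" if "x \<in> coords n" "z \<in> coords n" for x z
    using ip that unfolding inner_product_on_def by blast
  note L = unit_vec_in_lattice
  have orth: "ip (unit_vec j) (unit_vec l) = 0" if jl: "j < n" "l < n" "j \<noteq> l" for j l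
  proof -
    \<comment> \<open>The reversal must move e_j and fix e_l, so its second coordinate has to avoid
      both indices.\<close>
    have "\<exists>k\<in>{0,1,2}. k \<noteq> j \<and> k \<noteq> l" by auto
    then obtain k where k: "k \<in> {0,1,2}" "k \<noteq> j" "k \<noteq> l" by blast
    then have kn: "k < n" using n by auto
    define W where "W = (\<lambda>x i. if i = j \<or> i = k then - x i else (x i :: real))"
    have Wj: "W (unit_vec j) = (\<lambda>i. (-1) * unit_vec j i)" and Wl: "W (unit_vec l) = unit_vec l"
      using k jl by (auto simp: W_def unit_vec_def)
    have "ip (W (unit_vec j)) (W (unit_vec l)) = ip (unit_vec j) (unit_vec l)"
      using jl kn k L[OF jl(1)] L[OF jl(2)] weight_lattice_minus[OF L[OF jl(1)]]
      by (intro inner_product_sign_change[OF inv jl(1) kn _ W_def]) (auto simp: Wj Wl)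
    then have "ip (\<lambda>i. (-1) * unit_vec j i) (unit_vec l) = ip (unit_vec j) (unit_vec l)"
      by (simp only: Wj Wl)
    then show ?thesis using scale[of "unit_vec j" "unit_vec l" "-1"] jl by simp
  qed
  define c where "c = ip (unit_vec 0) (unit_vec 0)"
  have diag: "ip (unit_vec j) (unit_vec j) = c" if "j < n" for j
  proof (cases "j = 0")
    case False
    have "unit_vec 0 \<circ> Transposition.transpose 0 j = unit_vec j"
      using False by (auto simp: unit_vec_def Transposition.transpose_def)
    then show ?thesis
      using inner_product_swap[OF inv, of 0 j "unit_vec 0" "unit_vec 0"] that False L
      by (simp add: c_def)
  qed (simp add: c_def)
  have main: "ip x y = c * pairing n x y" if x: "x \<in> coords n" and y: "y \<in> coords n" for x y
  proof -
    have "ip (unit_vec j) y = c * y j" if "j < n" for j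
    proof -
      have "ip (unit_vec j) y = ip y (unit_vec j)" using that y by (simp add: sym)
      also have "\<dots> = (\<Sum>l<n. y l * ip (unit_vec l) (unit_vec j))"
        using that y by (simp add: inner_product_expand[OF ip])
      also have "\<dots> = (\<Sum>l<n. if l = j then c * y j else 0)"
        using that by (intro sum.cong refl) (auto simp: orth diag)
      finally show ?thesis using that by simp
    qed
    then have "ip x y = (\<Sum>j<n. x j * (c * y j))"
      using inner_product_expand[OF ip x y] by simp
    then show ?thesis by (simp add: pairing_def sum_distrib_left mult_ac)
  qed
  have norm2: "pairing n \<alpha> \<alpha> = 2" "\<alpha> \<in> coords n" if \<alpha>: "\<alpha> \<in> D_roots n" for \<alpha>
  proof -
    obtain j k \<delta> \<delta>' where jk: "j < k" "k < n" "\<delta> \<in> {1,-1}" "\<delta>' \<in> {1,-1}"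
      and eq: "\<alpha> = (\<lambda>i. \<delta> * unit_vec j i + \<delta>' * unit_vec k i)"
      using \<alpha> unfolding D_roots_def by blast
    have "\<alpha> i * \<alpha> i = (if i = j then 1 else 0) + (if i = k then 1 else 0)" for i
      using jk by (auto simp: eq unit_vec_def)
    then show "pairing n \<alpha> \<alpha> = 2" using jk by (simp add: pairing_def sum.distrib)
    show "\<alpha> \<in> coords n" using jk by (auto simp: eq coords_iff unit_vec_def)
  qed
  \<comment> \<open>All roots have squared length \<open>2 * c\<close>, so every root is long, and
    one of them fixes the scale.\<close>
  have root: "(\<lambda>i. 1 * unit_vec 0 i + 1 * unit_vec 1 i) \<in> D_roots n"
    using n by (intro D_rootsI) auto
  then have "(\<lambda>i. 1 * unit_vec 0 i + 1 * unit_vec 1 i) \<in> long_roots (spin_group (2 * n)) n (spin_torus n) ip"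
    unfolding long_roots_def roots_spin by (simp add: main norm2)
  from long[OF this] have "c = 1" using main norm2[OF root] by simp
  then show ?thesis using main[OF x y] by simp
qed

section \<open>Alcoves\<close>

definition D_positive_roots :: "nat \<Rightarrow> (nat \<Rightarrow> real) set" where
  "D_positive_roots n = {\<lambda>i. unit_vec j i + \<delta> * unit_vec k i | j k \<delta>.
     j < k \<and> k < n \<and> \<delta> \<in> {1,-1}}"

lemma D_positive_rootsI:
  "j < k \<Longrightarrow> k < n \<Longrightarrow> \<delta> \<in> {1,-1} \<Longrightarrow> (\<lambda>i. unit_vec j i + \<delta> * unit_vec k i) \<in> D_positive_roots n"
  unfolding D_positive_roots_def by blast

lemma D_positive_rootsE:
  assumes "\<alpha> \<in> D_positive_roots n"
  obtains j k \<delta> where "j < k" "k < n" "\<delta> \<in> {1,-1}" "\<alpha> = (\<lambda>i. unit_vec j i + \<delta> * unit_vec k i)"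
  using assms unfolding D_positive_roots_def by blast

lemma D_positive_roots_coords: "\<alpha> \<in> D_positive_roots n \<Longrightarrow> \<alpha> \<in> coords n"
  by (erule D_positive_rootsE) (auto simp: coords_iff unit_vec_def)

lemma positive_roots_spin:
  "positive_roots (spin_group (2 * n)) n (spin_torus n) = D_positive_roots n"
proof (intro antisym subsetI)
  fix \<alpha> assume "\<alpha> \<in> positive_roots (spin_group (2 * n)) n (spin_torus n)"
  then obtain i where "\<alpha> \<in> D_roots n" and i: "\<alpha> i > 0" "\<And>j. j < i \<Longrightarrow> \<alpha> j = 0"
    unfolding positive_roots_def roots_spin by blast
  then obtain j k \<delta> \<delta>' where jk: "j < k" "k < n" "\<delta> \<in> {1,-1}" "\<delta>' \<in> {1,-1}"
    and \<alpha>: "\<alpha> = (\<lambda>i. \<delta> * unit_vec j i + \<delta>' * unit_vec k i)"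
    unfolding D_roots_def by blast
  have j: "\<alpha> j = \<delta>" "\<And>l. l < j \<Longrightarrow> \<alpha> l = 0" using jk by (auto simp: \<alpha> unit_vec_def)
  have "\<alpha> j \<noteq> 0" unfolding j(1) using jk(3) by auto
  then have "i = j" using i j(2) by (metis less_irrefl linorder_neqE_nat)
  then have "\<delta> = 1" using i(1) j(1) jk(3) by auto
  then show "\<alpha> \<in> D_positive_roots n" using D_positive_rootsI[OF jk(1,2,4)] by (simp add: \<alpha>)
next
  fix \<alpha> assume "\<alpha> \<in> D_positive_roots n"
  then obtain j k \<delta> where jk: "j < k" "k < n" "\<delta> \<in> {1,-1}"
    and \<alpha>: "\<alpha> = (\<lambda>i. unit_vec j i + \<delta> * unit_vec k i)"
    by (rule D_positive_rootsE)
  have "(\<lambda>i. 1 * unit_vec j i + \<delta> * unit_vec k i) \<in> D_roots n"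
    using jk by (intro D_rootsI) auto
  then have "\<alpha> \<in> D_roots n" by (simp add: \<alpha>)
  moreover have "\<alpha> j > 0" "\<forall>l<j. \<alpha> l = 0" using jk by (auto simp: \<alpha> unit_vec_def)
  ultimately show "\<alpha> \<in> positive_roots (spin_group (2 * n)) n (spin_torus n)"
    unfolding positive_roots_def roots_spin by blast
qed

lemma finite_D_positive_roots: "finite (D_positive_roots n)"
proof (rule finite_subset)
  show "D_positive_roots n
      \<subseteq> (\<lambda>(j, k, \<delta>) i. unit_vec j i + \<delta> * unit_vec k i) ` ({..<n} \<times> {..<n} \<times> {1,-1})"
  proof
    fix \<alpha> assume "\<alpha> \<in> D_positive_roots n"
    then obtain j k \<delta> where "j < k" "k < n" "\<delta> \<in> {1,-1}"
      "\<alpha> = (\<lambda>i. unit_vec j i + \<delta> * unit_vec k i)"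
      by (rule D_positive_rootsE)
    then show "\<alpha> \<in> (\<lambda>(j, k, \<delta>) i. unit_vec j i + \<delta> * unit_vec k i) ` ({..<n} \<times> {..<n} \<times> {1,-1})"
      by (intro image_eqI[of _ _ "(j, k, \<delta>)"]) simp_all
  qed
qed simp

lemma pairing_root:
  assumes "j < n" "k < n"
  shows "pairing n (\<lambda>i. unit_vec j i + \<delta> * unit_vec k i) x = x j + \<delta> * x k"
proof -
  have "pairing n (unit_vec j) x = x j"
    using pairing_unit_vec[OF assms(1), of 1 x] by simp
  then show ?thesis by (simp add: pairing_add pairing_unit_vec assms)
qed

section \<open>The highest root\<close>

text \<open>Shaped so that unfolding it matches the dominance clause of
  \<open>highest_root\<close>.\<close>

definition positive_cone :: "nat \<Rightarrow> (nat \<Rightarrow> real) set" where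
  "positive_cone n = {x. \<exists>c :: (nat \<Rightarrow> real) \<Rightarrow> nat.
     \<forall>j. x j = (\<Sum>\<alpha>\<in>D_positive_roots n. real (c \<alpha>) * \<alpha> j)}"

lemma positive_cone_zero: "(\<lambda>_. 0) \<in> positive_cone n"
  unfolding positive_cone_def by (intro CollectI exI[of _ "\<lambda>_. 0"]) simp

lemma positive_cone_add:
  assumes "x \<in> positive_cone n" "y \<in> positive_cone n"
  shows "(\<lambda>i. x i + y i) \<in> positive_cone n"
proof -
  obtain c d :: "(nat \<Rightarrow> real) \<Rightarrow> nat"
    where "\<forall>j. x j = (\<Sum>\<alpha>\<in>D_positive_roots n. real (c \<alpha>) * \<alpha> j)"
      "\<forall>j. y j = (\<Sum>\<alpha>\<in>D_positive_roots n. real (d \<alpha>) * \<alpha> j)"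
    using assms unfolding positive_cone_def by blast
  then show ?thesis unfolding positive_cone_def
    by (intro CollectI exI[of _ "\<lambda>\<alpha>. c \<alpha> + d \<alpha>"]) (simp add: distrib_right sum.distrib)
qed

lemma positive_cone_root:
  assumes "\<alpha> \<in> D_positive_roots n"
  shows "\<alpha> \<in> positive_cone n"
proof -
  have "\<alpha> j = (\<Sum>\<beta>\<in>D_positive_roots n. real (if \<beta> = \<alpha> then 1 else 0) * \<beta> j)" for j
  proof -
    have "(\<Sum>\<beta>\<in>D_positive_roots n. real (if \<beta> = \<alpha> then 1 else 0) * \<beta> j)
       = (\<Sum>\<beta>\<in>D_positive_roots n. if \<beta> = \<alpha> then \<alpha> j else 0)"
      by (intro sum.cong refl) simp
    then show ?thesis using assms by (simp add: finite_D_positive_roots)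
  qed
  then show ?thesis unfolding positive_cone_def
    by (intro CollectI exI[of _ "\<lambda>\<beta>. if \<beta> = \<alpha> then 1 else 0"]) blast
qed

definition D_highest_root :: "nat \<Rightarrow> real" where
  "D_highest_root = (\<lambda>i. unit_vec 0 i + 1 * unit_vec 1 i)"

lemma D_highest_root_positive: "n > 2 \<Longrightarrow> D_highest_root \<in> D_positive_roots n"
  unfolding D_highest_root_def by (intro D_positive_rootsI) auto

text \<open>The difference splits as (e_0 - \<delta> e_j) + (e_1 - \<delta>' e_k), where
  \<open>j < k\<close> gives \<open>0 \<le> j\<close> and \<open>1 \<le> k\<close>. Each bracket is
  a positive root, zero, or twice a unit vector.\<close>

lemma highest_root_dominates:
  assumes n: "n > 2" and \<beta>: "\<beta> \<in> D_roots n"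
  shows "(\<lambda>i. D_highest_root i - \<beta> i) \<in> positive_cone n"
proof -
  note rt = positive_cone_root[OF D_positive_rootsI]
  have pm: "(\<lambda>i. unit_vec l i - \<delta> * unit_vec j i) \<in> positive_cone n"
    if j: "l \<le> j" "j < n" and l: "l < 2" and \<delta>: "\<delta> \<in> {1,-1}" for j l \<delta>
  proof (cases "l = j")
    case False
    then have "(\<lambda>i. unit_vec l i + (- \<delta>) * unit_vec j i) \<in> positive_cone n"
      using j \<delta> by (intro rt) auto
    then show ?thesis by simp
  next
    case True
    \<comment> \<open>2 e_l is not a root; it is reached through the third axis, as
      \<open>l < 2 < n\<close>.\<close>
    have "(\<lambda>i. (unit_vec l i + 1 * unit_vec 2 i) + (unit_vec l i + (-1) * unit_vec 2 i)) \<in> positive_cone n"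
      using l n by (intro positive_cone_add rt) auto
    then show ?thesis using True \<delta> positive_cone_zero by auto
  qed
  obtain j k \<delta> \<delta>' where jk: "j < k" "k < n" "\<delta> \<in> {1,-1}" "\<delta>' \<in> {1,-1}"
    and eq: "\<beta> = (\<lambda>i. \<delta> * unit_vec j i + \<delta>' * unit_vec k i)"
    using \<beta> unfolding D_roots_def by blast
  have "(\<lambda>i. (unit_vec 0 i - \<delta> * unit_vec j i) + (unit_vec 1 i - \<delta>' * unit_vec k i)) \<in> positive_cone n"
    using jk by (intro positive_cone_add pm) auto
  moreover have "(\<lambda>i. D_highest_root i - \<beta> i)
      = (\<lambda>i. (unit_vec 0 i - \<delta> * unit_vec j i) + (unit_vec 1 i - \<delta>' * unit_vec k i))"
    by (simp add: D_highest_root_def eq fun_eq_iff)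
  ultimately show ?thesis by simp
qed

text \<open>The vector \<open>(n, n - 1, \<dots>, 1)\<close> is strictly dominant; it separates the cone from its negative.\<close>

lemma positive_cone_antisym:
  assumes "x \<in> positive_cone n" "(\<lambda>i. - x i) \<in> positive_cone n"
  shows "x = (\<lambda>_. 0)"
proof -
  define \<rho> where "\<rho> i = real n - real i" for i
  have pos: "pairing n \<alpha> \<rho> > 0" if \<alpha>: "\<alpha> \<in> D_positive_roots n" for \<alpha>
  proof -
    obtain j k \<delta> where jk: "j < k" "k < n" "\<delta> \<in> {1,-1}"
      and \<alpha>: "\<alpha> = (\<lambda>i. unit_vec j i + \<delta> * unit_vec k i)"
      using \<alpha> by (rule D_positive_rootsE)
    then show ?thesis by (auto simp: pairing_root \<rho>_def)
  qed
  have pair: "pairing n y \<rho> = (\<Sum>\<alpha>\<in>D_positive_roots n. real (c \<alpha>) * pairing n \<alpha> \<rho>)"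
    if "\<forall>j. y j = (\<Sum>\<alpha>\<in>D_positive_roots n. real (c \<alpha>) * \<alpha> j)" for y and c :: "(nat \<Rightarrow> real) \<Rightarrow> nat"
  proof -
    have "pairing n y \<rho> = (\<Sum>j<n. \<Sum>\<alpha>\<in>D_positive_roots n. real (c \<alpha>) * (\<alpha> j * \<rho> j))"
      using that by (simp add: pairing_def sum_distrib_right mult.assoc)
    also have "\<dots> = (\<Sum>\<alpha>\<in>D_positive_roots n. \<Sum>j<n. real (c \<alpha>) * (\<alpha> j * \<rho> j))"
      by (rule sum.swap)
    finally show ?thesis by (simp add: pairing_def sum_distrib_left)
  qed
  have nonneg: "pairing n y \<rho> \<ge> 0" if y: "y \<in> positive_cone n" for y
  proof -
    obtain c :: "(nat \<Rightarrow> real) \<Rightarrow> nat" where c: "\<forall>j. y j = (\<Sum>\<alpha>\<in>D_positive_roots n. real (c \<alpha>) * \<alpha> j)"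
      using y unfolding positive_cone_def by blast
    show ?thesis unfolding pair[OF c]
      by (intro sum_nonneg mult_nonneg_nonneg less_imp_le[OF pos]) auto
  qed
  obtain c :: "(nat \<Rightarrow> real) \<Rightarrow> nat" where c: "\<forall>j. x j = (\<Sum>\<alpha>\<in>D_positive_roots n. real (c \<alpha>) * \<alpha> j)"
    using assms(1) unfolding positive_cone_def by blast
  have "pairing n (\<lambda>i. - x i) \<rho> = - pairing n x \<rho>"
    by (simp add: pairing_def sum_negf)
  then have "pairing n x \<rho> = 0"
    using nonneg[OF assms(1)] nonneg[OF assms(2)] by simp
  then have sum0: "(\<Sum>\<alpha>\<in>D_positive_roots n. real (c \<alpha>) * pairing n \<alpha> \<rho>) = 0"
    using pair[OF c] by simp
  \<comment> \<open>A vanishing sum of nonnegative terms has only zero terms, and the pairings with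
    \<open>\<rho>\<close> are strictly positive, so all coefficients vanish.\<close>
  have "real (c \<alpha>) * pairing n \<alpha> \<rho> = 0" if "\<alpha> \<in> D_positive_roots n" for \<alpha>
    using sum_nonneg_0[OF finite_D_positive_roots _ sum0 that] pos by (simp add: less_imp_le)
  then have "c \<alpha> = 0" if "\<alpha> \<in> D_positive_roots n" for \<alpha>
    using that pos[OF that] by fastforce
  then show ?thesis using c by (simp add: fun_eq_iff)
qed

lemma highest_root_spin:
  assumes n: "n > 2"
  shows "highest_root (spin_group (2 * n)) n (spin_torus n) = D_highest_root"
proof -
  let ?P = "\<lambda>\<theta>. \<theta> \<in> D_roots n \<and> (\<forall>\<beta>\<in>D_roots n. (\<lambda>i. \<theta> i - \<beta> i) \<in> positive_cone n)"
  have root: "D_highest_root \<in> D_roots n"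
    using D_highest_root_positive[OF n] positive_roots_spin[of n] roots_spin[of n]
    unfolding positive_roots_def by blast
  have "(THE \<theta>. ?P \<theta>) = D_highest_root"
  proof (rule the_equality)
    show "?P D_highest_root" using root highest_root_dominates[OF n] by blast
  next
    fix \<theta> assume \<theta>: "?P \<theta>"
    have "(\<lambda>i. \<theta> i - D_highest_root i) \<in> positive_cone n" using \<theta> root by blast
    moreover have "(\<lambda>i. - (\<theta> i - D_highest_root i)) \<in> positive_cone n"
      using highest_root_dominates[OF n, of \<theta>] \<theta> by simp
    ultimately have "(\<lambda>i. \<theta> i - D_highest_root i) = (\<lambda>_. 0)" by (rule positive_cone_antisym)
    then show "\<theta> = D_highest_root" by (simp add: fun_eq_iff)
  qed
  then show ?thesis
    unfolding highest_root_def positive_roots_spin roots_spin positive_cone_def by simp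
qed

section \<open>The interior of the alcove\<close>

lemma Euclidean_space_coords: "Euclidean_space n = top_of_set (coords n)"
  by (simp add: Euclidean_space_def euclidean_product_topology coords_def topspace_Euclidean_space)

lemma continuous_on_pairing: "continuous_on UNIV (pairing n \<alpha>)"
  unfolding pairing_def
  by (rule continuous_on_sum, rule continuous_on_mult_left, rule continuous_on_product_coordinates)

lemma interior_alcove_inner:
  assumes "finite R"
  shows "{x\<in>coords n. (\<forall>\<alpha>\<in>R. pairing n \<alpha> x > 0) \<and> pairing n \<theta> x < m}
    \<subseteq> Euclidean_space n interior_of {x\<in>coords n. (\<forall>\<alpha>\<in>R. pairing n \<alpha> x \<ge> 0) \<and> pairing n \<theta> x \<le> m}"
    (is "?I \<subseteq> _")
proof (rule interior_of_maximal)
  show "?I \<subseteq> {x\<in>coords n. (\<forall>\<alpha>\<in>R. pairing n \<alpha> x \<ge> 0) \<and> pairing n \<theta> x \<le> m}"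
    by (auto intro: less_imp_le)
  have "open {x. 0 < pairing n \<alpha> x}" for \<alpha>
    by (rule open_Collect_less[OF continuous_on_const continuous_on_pairing])
  moreover have "open {x. pairing n \<theta> x < m}"
    by (rule open_Collect_less[OF continuous_on_pairing continuous_on_const])
  ultimately have "open ((\<Inter>\<alpha>\<in>R. {x. 0 < pairing n \<alpha> x}) \<inter> {x. pairing n \<theta> x < m})"
    using assms by (intro open_Int open_INT) auto
  moreover have "?I = coords n \<inter> ((\<Inter>\<alpha>\<in>R. {x. 0 < pairing n \<alpha> x}) \<inter> {x. pairing n \<theta> x < m})"
    by auto
  ultimately show "openin (Euclidean_space n) ?I"
    unfolding Euclidean_space_coords openin_open by blast
qed

lemma interior_of_perturb:
  assumes x: "x \<in> Euclidean_space n interior_of A" and v: "v \<in> coords n"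
  obtains s :: real where "s > 0" "(\<lambda>i. x i + s * v i) \<in> A" "(\<lambda>i. x i + (- s) * v i) \<in> A"
proof -
  obtain U where U: "open U" "x \<in> coords n \<inter> U" "coords n \<inter> U \<subseteq> A"
    using x unfolding interior_of_def Euclidean_space_coords openin_open by blast
  let ?l = "\<lambda>s::real. \<lambda>i. x i + s * v i"
  have "continuous_on UNIV ?l"
    by (rule continuous_on_coordinatewise_then_product) (intro continuous_intros)
  then have "open (?l -` U)" using U(1) by (simp add: continuous_on_open_vimage)
  moreover have "0 \<in> ?l -` U" using U(2) by simp
  ultimately obtain e where e: "e > 0" "ball 0 e \<subseteq> ?l -` U"
    using open_contains_ball by blast
  have "?l s \<in> A" if "\<bar>s\<bar> < e" for s
  proof -
    have "?l s \<in> U" using e(2) that by (auto simp: subset_iff)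
    moreover have "?l s \<in> coords n" using U(2) v by (simp add: coords_iff)
    ultimately show ?thesis using U(3) by blast
  qed
  from this[of "e/2"] this[of "- (e/2)"] show thesis using e(1) by (intro that[of "e/2"]) auto
qed

lemma pairing_perturb: "pairing n \<alpha> (\<lambda>i. x i + s * v i) = pairing n \<alpha> x + s * pairing n \<alpha> v"
  by (simp add: pairing_def algebra_simps sum.distrib sum_distrib_left)

text \<open>From an interior point one may move a little against a normal \<open>\<alpha>\<close>,
  or along \<open>\<theta>\<close>, and stay in the region. This changes the corresponding pairing
  by \<open>s\<close> times a positive squared length, so each weak inequality is strict.\<close>

lemma interior_alcove:
  assumes "finite R" "\<And>\<alpha>. \<alpha> \<in> insert \<theta> R \<Longrightarrow> \<alpha> \<in> coords n \<and> pairing n \<alpha> \<alpha> > 0"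
  shows "Euclidean_space n interior_of {x\<in>coords n. (\<forall>\<alpha>\<in>R. pairing n \<alpha> x \<ge> 0) \<and> pairing n \<theta> x \<le> m}
    = {x\<in>coords n. (\<forall>\<alpha>\<in>R. pairing n \<alpha> x > 0) \<and> pairing n \<theta> x < m}"
    (is "_ interior_of ?A = ?I")
proof (rule antisym[OF _ interior_alcove_inner[OF assms(1)]], rule subsetI)
  fix x assume x: "x \<in> Euclidean_space n interior_of ?A"
  then have "x \<in> ?A" by (rule subsetD[OF interior_of_subset])
  moreover have "pairing n \<alpha> x > 0" if \<alpha>: "\<alpha> \<in> R" for \<alpha>
  proof -
    have "\<alpha> \<in> coords n" using assms(2) \<alpha> by blast
    then obtain s :: real where "s > 0" "(\<lambda>i. x i + s * \<alpha> i) \<in> ?A" "(\<lambda>i. x i + (- s) * \<alpha> i) \<in> ?A"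
      by (rule interior_of_perturb[OF x])
    then have "pairing n \<alpha> x \<ge> s * pairing n \<alpha> \<alpha>" "s * pairing n \<alpha> \<alpha> > 0"
      using \<alpha> assms(2) pairing_perturb[of n \<alpha> x "- s" \<alpha>] by auto
    then show ?thesis by simp
  qed
  moreover have "pairing n \<theta> x < m"
  proof -
    have "\<theta> \<in> coords n" using assms(2) by blast
    then obtain s :: real where "s > 0" "(\<lambda>i. x i + s * \<theta> i) \<in> ?A" "(\<lambda>i. x i + (- s) * \<theta> i) \<in> ?A"
      by (rule interior_of_perturb[OF x])
    then have "pairing n \<theta> x + s * pairing n \<theta> \<theta> \<le> m" "s * pairing n \<theta> \<theta> > 0"
      using assms(2) by (auto simp: pairing_perturb)
    then show ?thesis by simp
  qed
  ultimately show "x \<in> ?I" by blast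
qed

lemma regular_weights_spin:
  assumes n: "n > 2" and basic: "basic_inner_product (spin_group (2 * n)) n (spin_torus n) ip"
  shows "regular_weights (spin_group (2 * n)) n (spin_torus n) ip m =
    {a\<in>spin_weights n. (\<forall>j k. j < k \<longrightarrow> k < n \<longrightarrow> a j + a k > 0 \<and> a j - a k > 0) \<and> a 0 + a 1 < real m}"
proof -
  note ip = basic_inner_product_eq_pairing[OF n basic]
  note theta = D_highest_root_positive[OF n]
  have norm: "\<alpha> \<in> coords n \<and> pairing n \<alpha> \<alpha> > 0" if \<alpha>: "\<alpha> \<in> D_positive_roots n" for \<alpha>
  proof -
    obtain j k \<delta> where jk: "j < k" "k < n" "\<delta> \<in> {1,-1}"
      and eq: "\<alpha> = (\<lambda>i. unit_vec j i + \<delta> * unit_vec k i)"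
      using \<alpha> by (rule D_positive_rootsE)
    have "pairing n \<alpha> \<alpha> = \<alpha> j + \<delta> * \<alpha> k"
      using jk by (subst eq) (simp add: pairing_root)
    also have "\<dots> > 0" using jk by (auto simp: eq unit_vec_def)
    finally show ?thesis using D_positive_roots_coords[OF \<alpha>] by simp
  qed
  have "alcove (spin_group (2 * n)) n (spin_torus n) ip m
     = {x\<in>coords n. (\<forall>\<alpha>\<in>D_positive_roots n. pairing n \<alpha> x \<ge> 0) \<and> pairing n D_highest_root x \<le> real m}"
    unfolding alcove_def weyl_chamber_def positive_roots_spin highest_root_spin[OF n]
    using D_positive_roots_coords theta by (auto simp: ip)
  then have "Euclidean_space n interior_of alcove (spin_group (2 * n)) n (spin_torus n) ip m
     = {x\<in>coords n. (\<forall>\<alpha>\<in>D_positive_roots n. pairing n \<alpha> x > 0) \<and> pairing n D_highest_root x < real m}"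
    using norm theta by (simp only:) (intro interior_alcove finite_D_positive_roots; auto)
  moreover have "(\<forall>\<alpha>\<in>D_positive_roots n. pairing n \<alpha> x > 0)
      \<longleftrightarrow> (\<forall>j k. j < k \<longrightarrow> k < n \<longrightarrow> x j + x k > 0 \<and> x j - x k > 0)" for x
  proof
    assume L: "\<forall>\<alpha>\<in>D_positive_roots n. pairing n \<alpha> x > 0"
    show "\<forall>j k. j < k \<longrightarrow> k < n \<longrightarrow> x j + x k > 0 \<and> x j - x k > 0"
    proof (intro allI impI)
      fix j k assume jk: "j < k" "k < n"
      have "0 < x j + \<delta> * x k" if "\<delta> \<in> {1,-1}" for \<delta>
        using L[rule_format, OF D_positive_rootsI[OF jk that]] jk by (simp add: pairing_root)
      from this[of 1] this[of "-1"] show "x j + x k > 0 \<and> x j - x k > 0" by simp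
    qed
  next
    assume R: "\<forall>j k. j < k \<longrightarrow> k < n \<longrightarrow> x j + x k > 0 \<and> x j - x k > 0"
    show "\<forall>\<alpha>\<in>D_positive_roots n. pairing n \<alpha> x > 0"
    proof
      fix \<alpha> assume "\<alpha> \<in> D_positive_roots n"
      then obtain j k \<delta> where jk: "j < k" "k < n" "\<delta> \<in> {1,-1}"
        and eq: "\<alpha> = (\<lambda>i. unit_vec j i + \<delta> * unit_vec k i)"
        by (rule D_positive_rootsE)
      have "pairing n \<alpha> x = x j + \<delta> * x k" using jk by (simp add: eq pairing_root)
      then show "pairing n \<alpha> x > 0" using R jk by fastforce
    qed
  qed
  moreover have "pairing n D_highest_root x = x 0 + x 1" for x
    using n pairing_root[of 0 n 1 1 x] by (simp add: D_highest_root_def)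
  moreover have "weight_lattice n (spin_torus n) = spin_weights n"
    using n by (intro weight_lattice_spin) simp
  ultimately show ?thesis
    unfolding regular_weights_def by (auto simp: spin_weights_def)
qed

text \<open>The right-hand side lists the inequalities for the simple roots: consecutive
  differences, with the last difference and the last sum combined in the absolute value.\<close>

lemma chamber_iff_decreasing:
  fixes b :: "nat \<Rightarrow> real"
  assumes n: "n > 2"
  shows "(\<forall>j k. j < k \<longrightarrow> k < n \<longrightarrow> b j + b k > 0 \<and> b j - b k > 0)
    \<longleftrightarrow> (\<forall>j. j + 2 < n \<longrightarrow> b j > b (j + 1)) \<and> b (n - 2) > \<bar>b (n - 1)\<bar>"
    (is "?L \<longleftrightarrow> ?R")
proof
  assume L: ?L
  have "b j > b (j + 1)" if "j + 2 < n" for j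
    using L[rule_format, of j "j + 1"] that by simp
  moreover have "b (n - 2) > \<bar>b (n - 1)\<bar>"
  proof -
    have "n - 2 < n - 1" "n - 1 < n" using n by auto
    then have "b (n - 2) + b (n - 1) > 0 \<and> b (n - 2) - b (n - 1) > 0" using L by blast
    then show ?thesis by (simp add: abs_less_iff)
  qed
  ultimately show ?R by blast
next
  assume R: ?R
  have step: "b (Suc j) < b j" if "Suc j < n" for j
  proof (cases "j + 2 < n")
    case True
    then show ?thesis using R by simp
  next
    case False
    then have "j = n - 2" "Suc j = n - 1" using that by auto
    moreover have "b (n - 1) < b (n - 2)" using conjunct2[OF R] by linarith
    ultimately show ?thesis by (simp only:)
  qed
  have dec: "j < k \<Longrightarrow> k < n \<Longrightarrow> b k < b j" for j k
  proof (induction k)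
    case (Suc k)
    then show ?case using step[of k] by (cases "j = k") auto
  qed simp
  show ?L
  proof (intro allI impI)
    fix j k assume jk: "j < k" "k < n"
    have "j = n - 2 \<or> j < n - 2" using jk by auto
    then have j: "b (n - 2) \<le> b j" using dec[of j "n - 2"] n by auto
    \<comment> \<open>Entries before the last are at least \<open>b (n - 2)\<close>, which is
      positive; the last one is controlled by the absolute value. With
      \<open>b (n - 2) \<le> b j\<close> this gives the sum inequality for every pair.\<close>
    have "- b k < b (n - 2)"
    proof (cases "k = n - 1")
      case True
      then show ?thesis using R by auto
    next
      case False
      then have "k = n - 2 \<or> k < n - 2" using jk by auto
      then have "b (n - 2) \<le> b k" using dec[of k "n - 2"] n by auto
      moreover have "b (n - 2) > 0" using R by linarith
      ultimately show ?thesis by simp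
    qed
    then show "b j + b k > 0 \<and> b j - b k > 0" using dec[OF jk] j by simp
  qed
qed

section \<open>Counting\<close>

definition p_power_denom :: "nat \<Rightarrow> real \<Rightarrow> bool" where
  "p_power_denom p r \<longleftrightarrow> (\<exists>k. r * real p ^ k \<in> \<int>)"

text \<open>The reduced denominator divides any power of \<open>p\<close> that clears the fraction,
  and divisors of a prime power are powers of the same prime. Clearing denominators avoids reduced
  fractions from here on.\<close>

lemma p_power_denom_iff:
  assumes "prime p"
  shows "(\<exists>(q::rat) (k::nat). r = of_rat q \<and> snd (quotient_of q) = int p ^ k) \<longleftrightarrow> p_power_denom p r"
proof
  assume "\<exists>(q::rat) (k::nat). r = of_rat q \<and> snd (quotient_of q) = int p ^ k"
  then obtain q :: rat and k :: nat where r: "r = of_rat q" and k: "snd (quotient_of q) = int p ^ k"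
    by blast
  obtain a b where ab: "quotient_of q = (a, b)" by fastforce
  have "q = of_int a / of_int b" using quotient_of_div[OF ab] .
  then have "r * real p ^ k = of_int a"
    using k ab assms by (simp add: r of_rat_divide of_rat_power prime_gt_0_nat)
  then show "p_power_denom p r" unfolding p_power_denom_def by (metis Ints_of_int)
next
  assume "p_power_denom p r"
  then obtain k and z :: int where z: "r * real p ^ k = of_int z"
    unfolding p_power_denom_def by (metis Ints_cases)
  have p0: "p > 0" using assms by (simp add: prime_gt_0_nat)
  define q :: rat where "q = of_int z / of_int (int p ^ k)"
  obtain a b where ab: "quotient_of q = (a, b)" by fastforce
  have b: "b > 0" "coprime a b" "q = of_int a / of_int b"
    using quotient_of_denom_pos[OF ab] quotient_of_coprime[OF ab] quotient_of_div[OF ab] by auto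
  have "of_int (a * int p ^ k) = (of_int (z * b) :: rat)"
    using b(1,3) p0 by (simp add: q_def field_simps)
  then have "a * int p ^ k = z * b" by (simp only: of_int_eq_iff)
  then have "b dvd a * int p ^ k" by simp
  then have "b dvd int p ^ k"
    using b(2) by (simp add: coprime_dvd_mult_right_iff coprime_commute)
  then have "nat b dvd p ^ k" using b(1) by (simp add: nat_dvd_iff)
  then obtain l where "nat b = p ^ l" using divides_primepow_nat[OF assms] by blast
  then have "b = int p ^ l" using b(1) by (metis int_nat_eq less_imp_le of_nat_power)
  moreover have "r = of_rat q"
    using z p0 by (simp add: q_def of_rat_divide of_rat_power field_simps)
  ultimately show "\<exists>(q::rat) (k::nat). r = of_rat q \<and> snd (quotient_of q) = int p ^ k"
    using ab by (metis snd_conv)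
qed

text \<open>All Lie theory is eliminated here; what remains is a count of lattice points.\<close>

lemma N_regular_spin:
  assumes n: "n > 2" and basic: "basic_inner_product (spin_group (2 * n)) n (spin_torus n) ip"
    and p: "prime p"
  shows "N_regular (spin_group (2 * n)) n (spin_torus n) ip m p = card {a\<in>spin_weights n.
     (\<forall>j. j + 2 < n \<longrightarrow> a j > a (j + 1)) \<and> a (n - 2) > \<bar>a (n - 1)\<bar> \<and> real m > a 0 + a 1 \<and>
     (\<forall>w\<in>spin_weights n. p_power_denom p (pairing n w a / real m))}"
proof -
  have wl: "weight_lattice n (spin_torus n) = spin_weights n"
    using n by (intro weight_lattice_spin) simp
  have "ip w a = pairing n w a" if "w \<in> spin_weights n" "a \<in> spin_weights n" for w a
    using that by (intro basic_inner_product_eq_pairing[OF n basic]) (auto simp: spin_weights_def)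
  then show ?thesis
    unfolding N_regular_def p_power_denom_iff[OF p] regular_weights_spin[OF n basic]
      chamber_iff_decreasing[OF n] wl
    by (intro arg_cong[of _ _ card]) auto
qed

lemma spin_weights_double:
  assumes "a \<in> spin_weights n" "j < n"
  obtains A :: int where "2 * a j = of_int A"
proof -
  consider "a j \<in> \<int>" | "a j - 1/2 \<in> \<int>" using assms by (auto simp: spin_weights_def)
  then have "2 * a j \<in> \<int>"
  proof cases
    case 2
    then have "2 * (a j - 1/2) + 1 \<in> \<int>" by (intro Ints_add Ints_mult) auto
    then show ?thesis by (simp add: algebra_simps)
  qed (auto intro: Ints_mult)
  then show thesis using that by (metis Ints_cases)
qed

lemma unit_vec_spin_weight: "j < n \<Longrightarrow> unit_vec j \<in> spin_weights n"
  by (auto simp: spin_weights_def unit_vec_def coords_iff)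

text \<open>The weight e_j is the test; doubling makes the coordinate integral, and coprimality of
  \<open>m'\<close> to \<open>p\<close> lets \<open>m'\<close> be split off. The second equation
  retains the parity information that forces \<open>B\<close> to be even when \<open>p\<close> is
  odd.\<close>

lemma p_power_denom_coordinate:
  assumes p: "prime p" and m: "m = p ^ i * m'" "\<not> p dvd m'"
    and a: "a \<in> spin_weights n" "j < n"
    and denom: "\<And>w. w \<in> spin_weights n \<Longrightarrow> p_power_denom p (pairing n w a / real m)"
  obtains B z :: int and k where "2 * a j = real m' * of_int B" "B * int p ^ k = 2 * int p ^ i * z"
proof -
  have p0: "p > 0" using p by (simp add: prime_gt_0_nat)
  have m0: "m' > 0" using m(2) by (cases "m' = 0") auto
  obtain A :: int where A: "2 * a j = of_int A" using spin_weights_double[OF a] .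
  have "pairing n (unit_vec j) a = a j"
    using pairing_unit_vec[OF a(2), of 1 a] by simp
  then obtain k and z :: int where z: "a j / real m * real p ^ k = of_int z"
    using denom[OF unit_vec_spin_weight[OF a(2)]] unfolding p_power_denom_def by (metis Ints_cases)
  have "of_int (A * int p ^ k) = (of_int (2 * int p ^ i * z * int m') :: real)"
    using z p0 m0 by (simp add: m field_simps flip: A)
  then have eq: "A * int p ^ k = 2 * int p ^ i * z * int m'" by (simp only: of_int_eq_iff)
  have "coprime (int m') (int p ^ k)"
    using prime_imp_coprime[OF p m(2)] by (simp add: coprime_commute)
  moreover have "int m' dvd A * int p ^ k" by (simp add: eq)
  ultimately have "int m' dvd A" by (simp add: coprime_dvd_mult_left_iff)
  then obtain B where B: "A = int m' * B" by blast
  have "int m' * (B * int p ^ k) = int m' * (2 * int p ^ i * z)"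
    using eq by (simp add: B mult_ac)
  then have "B * int p ^ k = 2 * int p ^ i * z" using m0 by simp
  moreover have "2 * a j = real m' * of_int B" using A B by simp
  ultimately show thesis using that by blast
qed

lemma pairing_scale: "pairing n w (\<lambda>j. c * b j) = c * pairing n w b"
  by (simp add: pairing_def sum_distrib_left mult_ac)

lemma chain_scale:
  fixes b :: "nat \<Rightarrow> real"
  assumes "c > 0"
  shows "(\<forall>j. j + 2 < n \<longrightarrow> c * b j > c * b (j + 1)) \<longleftrightarrow> (\<forall>j. j + 2 < n \<longrightarrow> b j > b (j + 1))"
    and "c * b (n - 2) > \<bar>c * b (n - 1)\<bar> \<longleftrightarrow> b (n - 2) > \<bar>b (n - 1)\<bar>"
    and "c * q > c * b 0 + c * b 1 \<longleftrightarrow> q > b 0 + b 1"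
  using assms by (simp_all add: abs_mult flip: distrib_left)

section \<open>The counting bijections, given by multiplication with \<open>m'\<close>\<close>

text \<open>As \<open>m'\<close> is odd, multiplication by it respects the distinction between
  integral and half-integral tuples in both directions. The denominator condition on the image holds
  automatically.\<close>

lemma count_p2:
  assumes m: "m = 2 ^ i * m'" "\<not> 2 dvd m'"
  shows "card {a\<in>spin_weights n.
     (\<forall>j. j + 2 < n \<longrightarrow> a j > a (j + 1)) \<and> a (n - 2) > \<bar>a (n - 1)\<bar> \<and> real m > a 0 + a 1 \<and>
     (\<forall>w\<in>spin_weights n. p_power_denom 2 (pairing n w a / real m))}
   = card {b\<in>spin_weights n.
     (\<forall>j. j + 2 < n \<longrightarrow> b j > b (j + 1)) \<and> b (n - 2) > \<bar>b (n - 1)\<bar> \<and> real (2 ^ i) > b 0 + b 1}"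
    (is "card ?S = card ?B")
proof -
  have m0: "real m' > 0" using m(2) by (cases "m' = 0") auto
  define s where "s b = (\<lambda>j. real m' * b j)" for b :: "nat \<Rightarrow> real"
  have inj: "inj_on s ?B" using m0 by (intro inj_onI) (simp add: s_def fun_eq_iff)
  have m_eq: "real m = real m' * real (2 ^ i)" using m(1) by simp
  have "s ` ?B = ?S"
  proof (intro antisym subsetI)
    fix a assume "a \<in> s ` ?B"
    then obtain b where b: "b \<in> ?B" and a: "a = s b" by blast
    have "a \<in> spin_weights n"
    proof -
      have "a \<in> coords n" using b by (simp add: a s_def spin_weights_def coords_iff)
      moreover have "(\<forall>j<n. a j \<in> \<int>) \<or> (\<forall>j<n. a j - 1/2 \<in> \<int>)"
      proof (cases "\<forall>j<n. b j \<in> \<int>")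
        case True
        then show ?thesis by (auto simp: a s_def intro!: Ints_mult)
      next
        case False
        then have half: "\<forall>j<n. b j - 1/2 \<in> \<int>" using b by (auto simp: spin_weights_def)
        obtain q where q: "m' = 2 * q + 1" using m(2) by (elim oddE)
        have "a j - 1/2 = real m' * (b j - 1/2) + real q" for j
          by (simp add: a s_def q algebra_simps)
        then have "a j - 1/2 \<in> \<int>" if "j < n" for j
          using half that by (auto intro!: Ints_add Ints_mult)
        then show ?thesis by blast
      qed
      ultimately show ?thesis by (simp add: spin_weights_def)
    qed
    moreover have "p_power_denom 2 (pairing n w a / real m)" if w: "w \<in> spin_weights n" for w
      unfolding p_power_denom_def
    \<comment> \<open>The power \<open>2 ^ i\<close> cancels the even part of \<open>m\<close>; the
      remaining factor 4 clears the halves in \<open>w\<close> and in \<open>b\<close>.\<close>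
    proof (rule exI[of _ "i + 2"])
      have "pairing n w a / real m * real 2 ^ (i + 2) = 4 * pairing n w b"
        using m0 by (simp add: a s_def pairing_scale m_eq power_add)
      also have "\<dots> = (\<Sum>j<n. (2 * w j) * (2 * b j))"
        by (simp add: pairing_def sum_distrib_left mult_ac)
      also have "\<dots> \<in> \<int>"
      proof (intro Ints_sum Ints_mult[of "2 * _" "2 * _"])
        fix j assume j: "j \<in> {..<n}"
        show "2 * w j \<in> \<int>" using w j by (metis Ints_of_int lessThan_iff spin_weights_double)
        show "2 * b j \<in> \<int>" using b j by (metis (no_types, lifting) Ints_of_int lessThan_iff mem_Collect_eq spin_weights_double)
      qed
      finally show "pairing n w a / real m * real 2 ^ (i + 2) \<in> \<int>" .
    qed
    ultimately show "a \<in> ?S"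
      using b chain_scale(1)[OF m0, where n = n and b = b]
        chain_scale(2)[OF m0, where n = n and b = b] chain_scale(3)[OF m0, where b = b] unfolding a s_def m_eq by blast
  next
    fix a assume a: "a \<in> ?S"
    define b where "b j = a j / real m'" for j
    have ab: "a = s b" using m0 by (simp add: s_def b_def fun_eq_iff)
    have aw: "a \<in> spin_weights n" using a by simp
    have denom: "p_power_denom 2 (pairing n w a / real m)" if "w \<in> spin_weights n" for w
      using a that by blast
    have double: "\<exists>B::int. 2 * a j = real m' * of_int B" if j: "j < n" for j
    proof -
      obtain B z :: int and k where "2 * a j = real m' * of_int B" "B * int 2 ^ k = 2 * int 2 ^ i * z"
        by (rule p_power_denom_coordinate[OF two_is_prime_nat m aw j denom])
      then show ?thesis by blast
    qed
    have "b \<in> spin_weights n"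
    proof -
      have "b \<in> coords n" using aw by (simp add: b_def spin_weights_def coords_iff)
      moreover have "(\<forall>j<n. b j \<in> \<int>) \<or> (\<forall>j<n. b j - 1/2 \<in> \<int>)"
      \<comment> \<open>\<open>double\<close> gives \<open>b j\<close> only up to a half. The type
        of \<open>a\<close> decides it: \<open>2 * a j\<close> is even or odd, and the odd factor
        \<open>m'\<close> passes this parity on to \<open>B\<close>.\<close>
      proof (cases "\<forall>j<n. a j \<in> \<int>")
        case True
        have "b j \<in> \<int>" if j: "j < n" for j
        proof -
          obtain B :: int where B: "2 * a j = real m' * of_int B" using double[OF j] by blast
          obtain A :: int where A: "a j = of_int A" using True j by (metis Ints_cases)
          have "of_int (2 * A) = (of_int (int m' * B) :: real)" using A B by simp
          then have "2 * A = int m' * B" by (simp only: of_int_eq_iff)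
          then have "even (int m' * B)" by (metis dvd_triv_left)
          then have "even B" using m(2) by simp
          then obtain C where "B = 2 * C" by (elim evenE)
          then have "b j = of_int C" using B m0 by (simp add: b_def field_simps)
          then show ?thesis by simp
        qed
        then show ?thesis by blast
      next
        case False
        then have half: "\<forall>j<n. a j - 1/2 \<in> \<int>" using aw by (auto simp: spin_weights_def)
        have "b j - 1/2 \<in> \<int>" if j: "j < n" for j
        proof -
          obtain B :: int where B: "2 * a j = real m' * of_int B" using double[OF j] by blast
          obtain A :: int where A: "a j - 1/2 = of_int A" using half j by (metis Ints_cases)
          have "of_int (2 * A + 1) = (of_int (int m' * B) :: real)"
            using A B by (simp add: algebra_simps)
          then have eq: "2 * A + 1 = int m' * B" by (simp only: of_int_eq_iff)
          have "odd (2 * A + 1)" by simp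
          then have "odd (int m' * B)" unfolding eq .
          then have "odd B" by simp
          then obtain C where "B = 2 * C + 1" by (elim oddE)
          then have "b j - 1/2 = of_int C" using B m0 by (simp add: b_def field_simps)
          then show ?thesis by simp
        qed
        then show ?thesis by blast
      qed
      ultimately show ?thesis by (simp add: spin_weights_def)
    qed
    then have "b \<in> ?B"
      using a chain_scale(1)[OF m0, where n = n and b = b]
        chain_scale(2)[OF m0, where n = n and b = b] chain_scale(3)[OF m0, where b = b] unfolding ab s_def m_eq by blast
    then show "a \<in> s ` ?B" using ab by blast
  qed
  then show ?thesis using card_image[OF inj] by simp
qed

text \<open>The coordinate test already excludes half-integral tuples, since an odd \<open>p\<close>
  cannot cancel the denominator 2. For integral tuples the half-integral weights then demand an even
  coordinate sum, and nothing more.\<close>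

lemma count_odd:
  assumes p: "prime p" "p > 2" and m: "m = p ^ i * m'" "\<not> p dvd m'"
  shows "card {a\<in>spin_weights n.
     (\<forall>j. j + 2 < n \<longrightarrow> a j > a (j + 1)) \<and> a (n - 2) > \<bar>a (n - 1)\<bar> \<and> real m > a 0 + a 1 \<and>
     (\<forall>w\<in>spin_weights n. p_power_denom p (pairing n w a / real m))}
   = card {b :: nat \<Rightarrow> int. (\<forall>j\<ge>n. b j = 0) \<and>
     (\<forall>j. j + 2 < n \<longrightarrow> b j > b (j + 1)) \<and> b (n - 2) > \<bar>b (n - 1)\<bar> \<and>
     int (p ^ i) > b 0 + b 1 \<and> 2 dvd (\<Sum>j<n. b j)}"
    (is "card ?S = card ?B")
proof -
  have m0: "real m' > 0" using m(2) by (cases "m' = 0") auto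
  have p0: "p > 0" and odd: "odd p" using p prime_odd_nat by auto
  define r where "r b = (\<lambda>j. real_of_int (b j))" for b :: "nat \<Rightarrow> int"
  define s where "s b = (\<lambda>j. real m' * r b j)" for b :: "nat \<Rightarrow> int"
  have inj: "inj_on s ?B" using m0 by (intro inj_onI) (simp add: s_def r_def fun_eq_iff)
  have m_eq: "real m = real m' * real (p ^ i)" using m(1) by simp
  have chain: "(\<forall>j. j + 2 < n \<longrightarrow> r b j > r b (j + 1)) \<longleftrightarrow> (\<forall>j. j + 2 < n \<longrightarrow> b j > b (j + 1))"
    "r b (n - 2) > \<bar>r b (n - 1)\<bar> \<longleftrightarrow> b (n - 2) > \<bar>b (n - 1)\<bar>"
    "real (p ^ i) > r b 0 + r b 1 \<longleftrightarrow> int (p ^ i) > b 0 + b 1" for b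
  proof -
    show "(\<forall>j. j + 2 < n \<longrightarrow> r b j > r b (j + 1)) \<longleftrightarrow> (\<forall>j. j + 2 < n \<longrightarrow> b j > b (j + 1))"
      by (simp add: r_def)
    show "r b (n - 2) > \<bar>r b (n - 1)\<bar> \<longleftrightarrow> b (n - 2) > \<bar>b (n - 1)\<bar>"
      unfolding r_def of_int_abs[symmetric] of_int_less_iff ..
    have "real (p ^ i) = of_int (int (p ^ i))" by simp
    then show "real (p ^ i) > r b 0 + r b 1 \<longleftrightarrow> int (p ^ i) > b 0 + b 1"
      unfolding r_def of_int_add[symmetric] by (simp only: of_int_less_iff)
  qed
  have "s ` ?B = ?S"
  proof (intro antisym subsetI)
    fix a assume "a \<in> s ` ?B"
    then obtain b where b: "b \<in> ?B" and a: "a = s b" by blast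
    have "a \<in> spin_weights n"
      using b by (auto simp: a s_def r_def spin_weights_def coords_iff intro!: Ints_mult)
    moreover have "p_power_denom p (pairing n w a / real m)" if w: "w \<in> spin_weights n" for w
      unfolding p_power_denom_def
    proof (rule exI[of _ i])
      have "pairing n w a / real m * real p ^ i = pairing n w (r b)"
        using m0 p0 by (simp add: a s_def pairing_scale m_eq)
      also have "\<dots> \<in> \<int>"
      proof (cases "\<forall>j<n. w j \<in> \<int>")
        case True
        then show ?thesis unfolding pairing_def r_def by (intro Ints_sum Ints_mult) auto
      next
        case False
        then have half: "\<forall>j<n. w j - 1/2 \<in> \<int>" using w by (auto simp: spin_weights_def)
        \<comment> \<open>Writing each \<open>w j\<close> as an integer plus 1/2, the halves
          contribute half the coordinate sum, the integer \<open>c\<close>.\<close>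
        obtain c where c: "(\<Sum>j<n. b j) = 2 * c" using b by (auto elim: evenE)
        have "(\<Sum>j<n. real_of_int (b j)) = 2 * of_int c"
          using arg_cong[OF c, of real_of_int] by simp
        then have "pairing n w (r b) = (\<Sum>j<n. (w j - 1/2) * r b j) + of_int c"
          by (simp add: pairing_def left_diff_distrib sum_subtractf r_def flip: sum_divide_distrib)
        also have "\<dots> \<in> \<int>"
          using half by (intro Ints_add Ints_sum Ints_mult) (auto simp: r_def)
        finally show ?thesis .
      qed
      finally show "pairing n w a / real m * real p ^ i \<in> \<int>" .
    qed
    ultimately show "a \<in> ?S"
      using b chain_scale(1)[OF m0, where n = n and b = "r b"]
        chain_scale(2)[OF m0, where n = n and b = "r b"] chain_scale(3)[OF m0, where b = "r b"] chain[of b] unfolding a s_def m_eq by blast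
  next
    fix a assume a: "a \<in> ?S"
    have aw: "a \<in> spin_weights n" using a by simp
    have denom: "p_power_denom p (pairing n w a / real m)" if "w \<in> spin_weights n" for w
      using a that by blast
    have "\<exists>c::int. a j = real m' * of_int c" if j: "j < n" for j
    proof -
      obtain B z :: int and k where B: "2 * a j = real m' * of_int B"
        and z: "B * int p ^ k = 2 * int p ^ i * z"
        by (rule p_power_denom_coordinate[OF p(1) m aw j denom])
      have "even (B * int p ^ k)" using z by simp
      then have "even B" using odd by simp
      then obtain c where "B = 2 * c" by (elim evenE)
      then show ?thesis using B by auto
    qed
    \<comment> \<open>The value 0 beyond \<open>n\<close> is built into the choice, so that the
      chosen \<open>b\<close> is a legitimate tuple.\<close>
    then have "\<forall>j. \<exists>c::int. (j < n \<longrightarrow> a j = real m' * of_int c) \<and> (j \<ge> n \<longrightarrow> c = 0)"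
      by (metis linorder_not_le)
    then obtain b :: "nat \<Rightarrow> int" where b: "\<And>j. j < n \<Longrightarrow> a j = real m' * of_int (b j)"
      and b0: "\<And>j. j \<ge> n \<Longrightarrow> b j = 0"
      by metis
    have ab: "a = s b"
    proof
      fix j show "a j = s b j"
        using b[of j] b0[of j] aw by (cases "j < n") (auto simp: s_def r_def spin_weights_def coords_iff)
    qed
    have "even (\<Sum>j<n. b j)"
    proof -
      let ?h = "\<lambda>j. if j < n then 1/2 else (0::real)"
      have "?h \<in> spin_weights n" by (auto simp: spin_weights_def coords_iff)
      from denom[OF this] obtain k where "pairing n ?h a / real m * real p ^ k \<in> \<int>"
        unfolding p_power_denom_def by blast
      then obtain z :: int where z: "pairing n ?h a / real m * real p ^ k = of_int z"
        by (rule Ints_cases)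
      have "pairing n ?h (r b) = (\<Sum>j<n. r b j / 2)"
        unfolding pairing_def by (intro sum.cong refl) simp
      also have "\<dots> = of_int (\<Sum>j<n. b j) / 2" by (simp add: r_def flip: sum_divide_distrib)
      finally have half: "pairing n ?h (r b) = of_int (\<Sum>j<n. b j) / 2" .
      \<comment> \<open>No power of the odd prime can cancel the 2 in this denominator, so the
        coordinate sum must be even.\<close>
      have quot: "pairing n ?h a / real m = of_int (\<Sum>j<n. b j) / (2 * real p ^ i)"
        using m0 by (simp add: ab s_def pairing_scale m_eq half)
      then have "of_int ((\<Sum>j<n. b j) * int p ^ k) = (of_int (2 * (int p ^ i * z)) :: real)"
        using z p0 unfolding quot by (simp add: field_simps)
      then have "(\<Sum>j<n. b j) * int p ^ k = 2 * (int p ^ i * z)" by (simp only: of_int_eq_iff)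
      then have "even ((\<Sum>j<n. b j) * int p ^ k)" by simp
      then show ?thesis using odd by simp
    qed
    then have "b \<in> ?B"
      using a chain_scale(1)[OF m0, where n = n and b = "r b"]
        chain_scale(2)[OF m0, where n = n and b = "r b"] chain_scale(3)[OF m0, where b = "r b"] chain[of b] b0 unfolding ab s_def m_eq by blast
    then show "a \<in> s ` ?B" using ab by blast
  qed
  then show ?thesis using card_image[OF inj] by simp
qed

theorem mainTheorem5:
  fixes n m p i m' :: nat
    and ip :: "(nat \<Rightarrow> real) \<Rightarrow> (nat \<Rightarrow> real) \<Rightarrow> real"
  assumes "n > 2"
    and "m > 0"
    and "prime p"
    and "m = p ^ i * m'"
    and "\<not> p dvd m'"
    and "basic_inner_product (spin_group (2 * n)) n (spin_torus n) ip"
  shows "(p = 2 \<longrightarrow>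
           N_regular (spin_group (2 * n)) n (spin_torus n) ip m 2 =
           card {b :: nat \<Rightarrow> real. (\<forall>j\<ge>n. b j = 0) \<and>
             ((\<forall>j<n. b j \<in> \<int>) \<or> (\<forall>j<n. b j - 1/2 \<in> \<int>)) \<and>
             (\<forall>j. j + 2 < n \<longrightarrow> b j > b (j + 1)) \<and> b (n - 2) > \<bar>b (n - 1)\<bar> \<and>
             real (p ^ i) > b 0 + b 1}) \<and>
         (p > 2 \<longrightarrow>
           N_regular (spin_group (2 * n)) n (spin_torus n) ip m p =
           card {b :: nat \<Rightarrow> int. (\<forall>j\<ge>n. b j = 0) \<and>
             (\<forall>j. j + 2 < n \<longrightarrow> b j > b (j + 1)) \<and> b (n - 2) > \<bar>b (n - 1)\<bar> \<and>
             int (p ^ i) > b 0 + b 1 \<and>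
             2 dvd (\<Sum>j<n. b j)})"
proof (intro conjI impI)
  assume p2: "p = 2"
  then have m: "m = 2 ^ i * m'" "\<not> 2 dvd m'" using assms(4,5) by simp_all
  have "{b\<in>spin_weights n. (\<forall>j. j + 2 < n \<longrightarrow> b j > b (j + 1)) \<and> b (n - 2) > \<bar>b (n - 1)\<bar> \<and>
        real (2 ^ i) > b 0 + b 1}
    = {b :: nat \<Rightarrow> real. (\<forall>j\<ge>n. b j = 0) \<and>
         ((\<forall>j<n. b j \<in> \<int>) \<or> (\<forall>j<n. b j - 1/2 \<in> \<int>)) \<and>
         (\<forall>j. j + 2 < n \<longrightarrow> b j > b (j + 1)) \<and> b (n - 2) > \<bar>b (n - 1)\<bar> \<and>
         real (2 ^ i) > b 0 + b 1}"
    unfolding spin_weights_def coords_iff by blast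
  then show "N_regular (spin_group (2 * n)) n (spin_torus n) ip m 2 =
           card {b :: nat \<Rightarrow> real. (\<forall>j\<ge>n. b j = 0) \<and>
             ((\<forall>j<n. b j \<in> \<int>) \<or> (\<forall>j<n. b j - 1/2 \<in> \<int>)) \<and>
             (\<forall>j. j + 2 < n \<longrightarrow> b j > b (j + 1)) \<and> b (n - 2) > \<bar>b (n - 1)\<bar> \<and>
             real (p ^ i) > b 0 + b 1}"
    unfolding N_regular_spin[OF assms(1,6) two_is_prime_nat] count_p2[OF m] p2 by (simp only:)
next
  assume "p > 2"
  show "N_regular (spin_group (2 * n)) n (spin_torus n) ip m p =
           card {b :: nat \<Rightarrow> int. (\<forall>j\<ge>n. b j = 0) \<and>
             (\<forall>j. j + 2 < n \<longrightarrow> b j > b (j + 1)) \<and> b (n - 2) > \<bar>b (n - 1)\<bar> \<and>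
             int (p ^ i) > b 0 + b 1 \<and>
             2 dvd (\<Sum>j<n. b j)}"
    unfolding N_regular_spin[OF assms(1,6,3)] by (rule count_odd[OF assms(3) \<open>p > 2\<close> assms(4,5)])
qed

end
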